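(* For every $\gamma\in[0,1]$ there is a constant $C>0$ depending only on $\gamma$ such that for all integers $N\geq 2$, $$\Delta_{\gamma,N}\geq C,$$ where $\Delta_{\gamma,N}$ is the spectral gap of the stochastic exchange model with $N$ particles, unit mean energy per particle and rate exponent $\gamma$.
   Context: For an integer $N\ge 2$ let $\mathcal S_N=\{\boldsymbol\eta=(\eta_1,\dots,\eta_N)\in[0,\infty)^N:\ \frac1N\sum_{j=1}^N\eta_j=1\}$, let $\sigma_N$ be the uniform probability measure (normalized $(N-1)$-dimensional Lebesgue measure) on $\mathcal S_N$, and let $\mathcal H_N=L^2(\mathcal S_N,\sigma_N)$ with inner product $\langle\cdot,\cdot\rangle$ and norm $\|\cdot\|_2$. For $i<j$ and $f\in\mathcal H_N$ let $$[f]^{(i,j)}(\boldsymbol\eta)=\int_0^1 f(\boldsymbol\eta^*_{i,j,\alpha})\,d\alpha,$$ where $\boldsymbol\eta^*_{i,j,\alpha}$ is obtained from $\boldsymbol\eta$ by replacing the pair $(\eta_i,\eta_j)$ by $(\alpha(\eta_i+\eta_j),(1-\alpha)(\eta_i+\eta_j))$ and keeping all other coordinates. Equivalently, $[f]^{(i,j)}$ is the conditional expectation under $\sigma_N$ of $f$ given $\sigma\{\eta_k: k\ne i,j\}$. The generator of the stochastic exchange model is the bounded self-adjoint operator on $\mathcal H_N$ $$L_{\gamma,N}f(\boldsymbol\eta)=-N\binom N2^{-1}\sum_{i<j}(\eta_i+\eta_j)^\gamma\big[f(\boldsymbol\eta)-[f]^{(i,j)}(\boldsymbol\eta)\big],$$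 its Dirichlet form is $\mathcal E_{\gamma,N}(f,f)=-\langle f,L_{\gamma,N}f\rangle$, and the spectral gap is $$\Delta_{\gamma,N}=\inf\{\mathcal E_{\gamma,N}(f,f):\ f\in\mathcal H_N,\ \|f\|_2=1,\ \langle f,1\rangle=0\}.$$ *)

theory Defs
  imports "HOL-Analysis.Analysis"
begin

text \<open>Configurations are functions on the index set {1..N} (extensional, i.e. \<^term>\<open>undefined\<close>
  elsewhere), so that the number N of particles can be quantified over.\<close>

definition energy_simplex :: "nat \<Rightarrow> (nat \<Rightarrow> real) set" where
  "energy_simplex N = {\<eta> \<in> {1..N} \<rightarrow>\<^sub>E {0..}. (1 / real N) * (\<Sum>j=1..N. \<eta> j) = 1}"

text \<open>The (N-1)-dimensional Lebesgue measure on the simplex is transported from the first N-1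
  coordinates by the affine chart below. The surface measure of the hyperplane differs from it only
  by a constant factor, which disappears on normalization.\<close>

definition chart :: "nat \<Rightarrow> (nat \<Rightarrow> real) \<Rightarrow> (nat \<Rightarrow> real)" where
  "chart N x = x(N := real N - (\<Sum>k\<in>{1..<N}. x k))"

definition simplex_lebesgue :: "nat \<Rightarrow> (nat \<Rightarrow> real) measure" where
  "simplex_lebesgue N =
     distr (restrict_space (Pi\<^sub>M {1..<N} (\<lambda>_. lborel)) {x. chart N x \<in> energy_simplex N})
       (restrict_space (Pi\<^sub>M {1..N} (\<lambda>_. borel)) (energy_simplex N))
       (chart N)"

definition sigma_unif :: "nat \<Rightarrow> (nat \<Rightarrow> real) measure" where
  "sigma_unif N = uniform_measure (simplex_lebesgue N) (energy_simplex N)"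

text \<open>Elements of the Hilbert space are handled through Borel measurable, square-integrable
  representatives; the inner product does not depend on their choice.\<close>

definition L2_space :: "nat \<Rightarrow> ((nat \<Rightarrow> real) \<Rightarrow> real) set" where
  "L2_space N = {f \<in> borel_measurable (sigma_unif N). integrable (sigma_unif N) (\<lambda>\<eta>. (f \<eta>)\<^sup>2)}"

definition L2_inner :: "nat \<Rightarrow> ((nat \<Rightarrow> real) \<Rightarrow> real) \<Rightarrow> ((nat \<Rightarrow> real) \<Rightarrow> real) \<Rightarrow> real" where
  "L2_inner N f g = (LINT \<eta>|sigma_unif N. f \<eta> * g \<eta>)"

definition L2_norm :: "nat \<Rightarrow> ((nat \<Rightarrow> real) \<Rightarrow> real) \<Rightarrow> real" where
  "L2_norm N f = sqrt (L2_inner N f f)"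

definition exchange :: "nat \<Rightarrow> nat \<Rightarrow> real \<Rightarrow> (nat \<Rightarrow> real) \<Rightarrow> (nat \<Rightarrow> real)" where
  "exchange i j \<alpha> \<eta> = \<eta>(i := \<alpha> * (\<eta> i + \<eta> j), j := (1 - \<alpha>) * (\<eta> i + \<eta> j))"

definition pair_average :: "nat \<Rightarrow> nat \<Rightarrow> ((nat \<Rightarrow> real) \<Rightarrow> real) \<Rightarrow> (nat \<Rightarrow> real) \<Rightarrow> real" where
  "pair_average i j f \<eta> = (LINT \<alpha>:{0..1}|lborel. f (exchange i j \<alpha> \<eta>))"

text \<open>The convention \<^term>\<open>0 powr 0 = 0\<close> is harmless for \<open>\<gamma> = 0\<close>: where
  \<open>\<eta> i + \<eta> j = 0\<close> on the simplex, the bracket vanishes as well.\<close>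

definition generator :: "real \<Rightarrow> nat \<Rightarrow> ((nat \<Rightarrow> real) \<Rightarrow> real) \<Rightarrow> (nat \<Rightarrow> real) \<Rightarrow> real" where
  "generator \<gamma> N f \<eta> =
     - (real N * inverse (real (N choose 2)) *
        (\<Sum>(i, j)\<in>{(i, j). 1 \<le> i \<and> i < j \<and> j \<le> N}.
           (\<eta> i + \<eta> j) powr \<gamma> * (f \<eta> - pair_average i j f \<eta>)))"

definition dirichlet_form :: "real \<Rightarrow> nat \<Rightarrow> ((nat \<Rightarrow> real) \<Rightarrow> real) \<Rightarrow> real" where
  "dirichlet_form \<gamma> N f = - L2_inner N f (generator \<gamma> N f)"

definition spectral_gap :: "real \<Rightarrow> nat \<Rightarrow> real" where
  "spectral_gap \<gamma> N =
     Inf {dirichlet_form \<gamma> N f | f. f \<in> L2_space N \<and> L2_norm N f = 1 \<and> L2_inner N f (\<lambda>_. 1) = 0}"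

end

theory Submission
  imports Defs "HOL-Probability.Probability"
begin

text \<open>A pair exchanges at rate \<open>(\<eta> i + \<eta> j) powr \<gamma>\<close>, which is tiny when both particles are almost
empty. The proof finds the spectral gap at constant rates by a coupling, compares the degenerate
rates with constant ones, and treats by a Lyapunov function the configurations in which that
comparison loses a power of N.

Constant rates. Run two copies of the process with the same pair and the same \<open>\<alpha>\<close>. One exchange
of a random pair contracts their mean squared distance at least by the factor \<open>1 - 2 / (3 * N)\<close>
(\<open>pair_average_contraction\<close>, \<open>sum_pairs_quadratic\<close>). So the averaging operator K improves Lipschitz
constants geometrically. As K is self-adjoint, the sequence of squared norms of \<open>(K ^^ n) f\<close> is
log-convex, and its asymptotic decay already bounds the first ratio (\<open>mean_exchange_norm\<close>). Lipschitz
functions are dense in the Hilbert space, which gives the Poincare inequality \<open>poincare_uniform\<close>,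
uniformly in N.

Comparison. If particles i and j hold little energy compared with a third particle k, they can
redistribute their energy by exchanging with k one after the other
(\<open>nn_energy_reservoir\<close>). Averaging over k replaces the rate of every pair by the average
\<open>\<phi> = (\<Sum>k=1..N. \<eta> k powr \<gamma>) / N\<close> (\<open>power_mean_energy_le\<close>). For \<open>\<gamma> = 1\<close> this average is 1, and the
theorem follows. In general it is at least \<open>N powr (\<gamma> - 1)\<close>, which settles bounded N
(\<open>poincare_crude\<close>).

Many particles, \<open>0 < \<gamma> < 1\<close>. The average \<open>\<phi>\<close> is small only if few particles carry the energy,
and the process leaves such configurations quickly. Indeed \<open>H = (\<Sum>k=1..N. \<eta> k powr (1 - \<gamma>))\<close> is at most
\<open>2 * N\<close> and increases fast there: \<open>s powr \<gamma> * s powr (1 - \<gamma>) = s\<close>, and the sum of the pair energies s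
does not depend on the configuration. With \<open>3 * N - H\<close> as Lyapunov function,
\<open>lyapunov_inequality\<close> bounds a multiple of the squared norm of f by the Dirichlet form and the
integral of \<open>\<phi> * f\<^sup>2\<close>, hence by the Dirichlet form and the squared norm of \<open>\<phi> * f\<close>. The latter
is controlled by the constant-rate inequality applied to \<open>\<phi> * f\<close>: one exchange changes \<open>\<phi>\<close>
by at most \<open>2 * s powr \<gamma> / N\<close>, so the error is of relative size \<open>N powr (\<gamma> - 1)\<close>
(\<open>localised_norm\<close>) and is absorbed for large N (\<open>poincare_many_particles\<close>).\<close>

text \<open>Index sets are intervals starting at 1; the simplifier would turn them into intervals
starting at \<open>Suc 0\<close>.\<close>

declare One_nat_def [simp del]

section \<open>Uniform measure on the unit interval\<close>

definition unit_lebesgue :: "real measure" where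
  "unit_lebesgue = restrict_space lborel {0..1}"

lemma space_unit_lebesgue [simp]: "space unit_lebesgue = {0..1}"
  by (simp add: unit_lebesgue_def)

lemma prob_space_unit_lebesgue: "prob_space unit_lebesgue"
  by (rule prob_spaceI) (simp add: unit_lebesgue_def emeasure_restrict_space)

interpretation unit: prob_space unit_lebesgue
  by (rule prob_space_unit_lebesgue)

lemma measurable_unit_lebesgue: "(\<lambda>x. x) \<in> borel_measurable unit_lebesgue"
  by (simp add: unit_lebesgue_def measurable_restrict_space1)

lemma borel_measurable_unit_lebesgue:
  "f \<in> borel_measurable borel \<Longrightarrow> f \<in> borel_measurable unit_lebesgue"
  by (simp add: unit_lebesgue_def measurable_restrict_space1)

lemma nn_integral_unit_lebesgue:
  "(\<integral>\<^sup>+\<alpha>. f \<alpha> \<partial>unit_lebesgue) = (\<integral>\<^sup>+\<alpha>. f \<alpha> * indicator {0..1} \<alpha> \<partial>lborel)"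
  by (simp add: unit_lebesgue_def nn_integral_restrict_space)

lemma integral_unit_lebesgue:
  fixes f :: "real \<Rightarrow> real"
  shows "(LINT \<alpha>|unit_lebesgue. f \<alpha>) = (LINT \<alpha>:{0..1}|lborel. f \<alpha>)"
  by (simp add: unit_lebesgue_def integral_restrict_space set_lebesgue_integral_def)

text \<open>Substitution on the line needs functions on the whole line, so functions on the unit interval are
extended by zero.\<close>

lemma measurable_times_indicator_unit:
  fixes f :: "real \<Rightarrow> ennreal"
  assumes "f \<in> borel_measurable unit_lebesgue"
  shows "(\<lambda>\<alpha>. f \<alpha> * indicator {0..1} \<alpha>) \<in> borel_measurable borel"
proof -
  have "f \<in> borel_measurable (restrict_space lborel {0..1})"
    using assms by (simp add: unit_lebesgue_def)
  then show ?thesis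
    by (subst (asm) borel_measurable_restrict_space_iff_ennreal) auto
qed

lemma nn_integral_unit_reflect:
  assumes f: "f \<in> borel_measurable unit_lebesgue"
  shows "(\<integral>\<^sup>+\<alpha>. f (1 - \<alpha>) \<partial>unit_lebesgue) = (\<integral>\<^sup>+\<alpha>. f \<alpha> \<partial>unit_lebesgue)"
proof -
  have "(\<integral>\<^sup>+\<alpha>. f \<alpha> * indicator {0..1} \<alpha> \<partial>lborel)
      = (\<integral>\<^sup>+\<alpha>. f (1 + (-1) * \<alpha>) * indicator {0..1} (1 + (-1) * \<alpha>) \<partial>lborel)"
    by (subst nn_integral_real_affine[where c="-1" and t=1])
       (use measurable_times_indicator_unit[OF f] in auto)
  also have "\<dots> = (\<integral>\<^sup>+\<alpha>. f (1 - \<alpha>) * indicator {0..1} \<alpha> \<partial>lborel)"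
    by (intro nn_integral_cong) (auto simp: indicator_def)
  finally show ?thesis by (simp add: nn_integral_unit_lebesgue)
qed

lemma nn_integral_unit_scale:
  assumes f: "f \<in> borel_measurable unit_lebesgue" and c: "0 < c" "c \<le> 1"
  shows "(\<integral>\<^sup>+a. f (a / c) * indicator {0..c} a \<partial>lborel)
       = ennreal c * (\<integral>\<^sup>+\<alpha>. f \<alpha> \<partial>unit_lebesgue)"
proof -
  have m: "(\<lambda>a. f (a / c) * indicator {0..1} (a / c)) \<in> borel_measurable borel"
    using measurable_times_indicator_unit[OF f] by (rule measurable_compose[rotated]) auto
  have "(\<integral>\<^sup>+a. f (a / c) * indicator {0..c} a \<partial>lborel)
      = (\<integral>\<^sup>+a. f (a / c) * indicator {0..1} (a / c) \<partial>lborel)"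
    using c by (intro nn_integral_cong) (auto simp: indicator_def field_simps)
  also have "\<dots> = ennreal \<bar>c\<bar> * (\<integral>\<^sup>+\<alpha>. f ((0 + c * \<alpha>) / c) * indicator {0..1} ((0 + c * \<alpha>) / c) \<partial>lborel)"
    by (rule nn_integral_real_affine[OF m]) (use c in auto)
  finally show ?thesis using c by (simp add: nn_integral_unit_lebesgue)
qed

lemma integral_unit_reflect:
  fixes F :: "real \<Rightarrow> real"
  shows "(LINT \<alpha>|unit_lebesgue. F (1 - \<alpha>)) = (LINT \<alpha>|unit_lebesgue. F \<alpha>)"
proof -
  have "(LINT \<alpha>|lborel. indicator {0..1} \<alpha> *\<^sub>R F \<alpha>)
      = \<bar>-1::real\<bar> *\<^sub>R (LINT \<alpha>|lborel. indicator {0..1} (1 + (-1) * \<alpha>) *\<^sub>R F (1 + (-1) * \<alpha>))"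
    by (rule lborel_integral_real_affine) simp
  also have "\<dots> = (LINT \<alpha>|lborel. indicator {0..1} \<alpha> *\<^sub>R F (1 - \<alpha>))"
    by simp (auto intro!: Bochner_Integration.integral_cong simp: indicator_def)
  finally show ?thesis by (simp add: unit_lebesgue_def integral_restrict_space)
qed

lemma integrable_unit_bounded:
  fixes F :: "real \<Rightarrow> real"
  assumes "F \<in> borel_measurable unit_lebesgue" "\<And>\<alpha>. \<alpha> \<in> {0..1} \<Longrightarrow> \<bar>F \<alpha>\<bar> \<le> B"
  shows "integrable unit_lebesgue F"
  using assms by (intro unit.integrable_const_bound[where B=B] AE_I2) auto

lemma unit_moment_2: "(LINT \<alpha>|unit_lebesgue. \<alpha>\<^sup>2) = 1 / 3"
  using integral_power[of 0 1 2]
  by (simp add: unit_lebesgue_def integral_restrict_space mult.commute)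

lemma unit_moments:
  "(LINT \<alpha>|unit_lebesgue. \<alpha>\<^sup>2 + (1 - \<alpha>)\<^sup>2) = 2 / 3"
  "integrable unit_lebesgue (\<lambda>\<alpha>. \<alpha>\<^sup>2 + (1 - \<alpha>)\<^sup>2)"
proof -
  note [measurable] = measurable_unit_lebesgue
  have i: "integrable unit_lebesgue (\<lambda>\<alpha>. \<alpha>\<^sup>2)" "integrable unit_lebesgue (\<lambda>\<alpha>. (1 - \<alpha>)\<^sup>2)"
    by (rule integrable_unit_bounded[where B=1]; simp add: power_le_one)+
  then show "(LINT \<alpha>|unit_lebesgue. \<alpha>\<^sup>2 + (1 - \<alpha>)\<^sup>2) = 2 / 3"
    using integral_unit_reflect[of "\<lambda>\<alpha>. \<alpha>\<^sup>2"] by (simp add: unit_moment_2)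
  show "integrable unit_lebesgue (\<lambda>\<alpha>. \<alpha>\<^sup>2 + (1 - \<alpha>)\<^sup>2)" using i by simp
qed

lemma unit_moment_powr:
  assumes "0 \<le> a"
  shows "(LINT \<alpha>|unit_lebesgue. \<alpha> powr a) = 1 / (1 + a)"
proof -
  have i: "integrable unit_lebesgue (\<lambda>\<alpha>. \<alpha> powr a)"
  proof (rule integrable_unit_bounded[where B=1])
    show "(\<lambda>\<alpha>. \<alpha> powr a) \<in> borel_measurable unit_lebesgue"
      by (rule borel_measurable_unit_lebesgue) measurable
    fix \<alpha> :: real assume "\<alpha> \<in> {0..1}"
    then have "\<alpha> powr a \<le> 1 powr a" using assms by (intro powr_mono2) simp_all
    then show "\<bar>\<alpha> powr a\<bar> \<le> 1" by simp
  qed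
  then have "set_integrable lborel {0..1} (\<lambda>\<alpha>. \<alpha> powr a)"
    unfolding set_integrable_def unit_lebesgue_def by (simp add: integrable_restrict_space)
  then have "(LINT \<alpha>:{0..1}|lborel. \<alpha> powr a) = integral {0..1} (\<lambda>\<alpha>. \<alpha> powr a)"
    by (rule set_borel_integral_eq_integral)
  also have "\<dots> = 1 / (1 + a)"
    using has_integral_powr_from_0[of a 1] assms by (simp add: integral_unique add.commute)
  finally show ?thesis by (simp add: integral_unit_lebesgue)
qed

section \<open>Square-integrable functions\<close>

definition square_integrable :: "'a measure \<Rightarrow> ('a \<Rightarrow> real) \<Rightarrow> bool" where
  "square_integrable M f \<longleftrightarrow> f \<in> borel_measurable M \<and> integrable M (\<lambda>x. (f x)\<^sup>2)"

lemma square_integrable_measurable: "square_integrable M f \<Longrightarrow> f \<in> borel_measurable M"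
  by (simp add: square_integrable_def)

lemma square_integrable_square: "square_integrable M f \<Longrightarrow> integrable M (\<lambda>x. (f x)\<^sup>2)"
  by (simp add: square_integrable_def)

lemma square_integrable_mult:
  assumes f: "square_integrable M f" and g: "square_integrable M g"
  shows "integrable M (\<lambda>x. f x * g x)"
proof (rule Bochner_Integration.integrable_bound)
  show "integrable M (\<lambda>x. (f x)\<^sup>2 + (g x)\<^sup>2)"
    using f g by (simp add: square_integrable_def)
  show "(\<lambda>x. f x * g x) \<in> borel_measurable M"
    using f[THEN square_integrable_measurable] g[THEN square_integrable_measurable] by measurable
  have "\<bar>a * b\<bar> \<le> a\<^sup>2 + b\<^sup>2" for a b :: real
  proof -
    have "0 \<le> (\<bar>a\<bar> - \<bar>b\<bar>)\<^sup>2 + \<bar>a\<bar> * \<bar>b\<bar> * 2" by simp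
    moreover have "\<dots> = a\<^sup>2 + b\<^sup>2" by (simp add: power2_diff)
    moreover have "0 \<le> (\<bar>a\<bar> - \<bar>b\<bar>)\<^sup>2 + \<bar>a\<bar> * \<bar>b\<bar>" by simp
    ultimately show ?thesis by (simp add: power2_diff abs_mult)
  qed
  then show "AE x in M. norm (f x * g x) \<le> norm ((f x)\<^sup>2 + (g x)\<^sup>2)"
    by (simp add: abs_of_nonneg)
qed

lemma square_integrable_scale:
  "square_integrable M f \<Longrightarrow> square_integrable M (\<lambda>x. c * f x)"
  unfolding square_integrable_def power_mult_distrib
  by (elim conjE, intro conjI borel_measurable_times borel_measurable_const) simp_all

lemma square_integrable_add:
  assumes f: "square_integrable M f" and g: "square_integrable M g"
  shows "square_integrable M (\<lambda>x. f x + g x)"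
proof -
  have "integrable M (\<lambda>x. (f x)\<^sup>2 + (g x)\<^sup>2 + 2 * (f x * g x))"
    using f g square_integrable_mult[OF f g] by (simp add: square_integrable_def)
  then show ?thesis
    using f[THEN square_integrable_measurable] g[THEN square_integrable_measurable]
    by (simp add: square_integrable_def power2_sum mult.assoc)
qed

lemma square_integrable_diff:
  assumes f: "square_integrable M f" and g: "square_integrable M g"
  shows "square_integrable M (\<lambda>x. f x - g x)"
  using square_integrable_add[OF f square_integrable_scale[OF g, of "-1"]] by simp

lemma square_integrable_bounded_mult:
  assumes f: "square_integrable M f" and b: "b \<in> borel_measurable M"
    and B: "\<And>x. x \<in> space M \<Longrightarrow> \<bar>b x\<bar> \<le> B"
  shows "square_integrable M (\<lambda>x. b x * f x)"
  unfolding square_integrable_def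
proof
  show m: "(\<lambda>x. b x * f x) \<in> borel_measurable M"
    using f[THEN square_integrable_measurable] b by measurable
  show "integrable M (\<lambda>x. (b x * f x)\<^sup>2)"
  proof (rule Bochner_Integration.integrable_bound)
    show "integrable M (\<lambda>x. B\<^sup>2 * (f x)\<^sup>2)" using f by (simp add: square_integrable_def)
    show "(\<lambda>x. (b x * f x)\<^sup>2) \<in> borel_measurable M" using m by simp
    have "(b x)\<^sup>2 \<le> B\<^sup>2" if "x \<in> space M" for x
      using power_mono[OF B[OF that], of 2] by simp
    then show "AE x in M. norm ((b x * f x)\<^sup>2) \<le> norm (B\<^sup>2 * (f x)\<^sup>2)"
      by (intro AE_I2) (simp add: power_mult_distrib mult_right_mono)
  qed
qed

lemma (in prob_space) square_integrable_const: "square_integrable M (\<lambda>_. c)"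
  by (simp add: square_integrable_def)

lemma (in prob_space) square_integrable_bounded:
  assumes "b \<in> borel_measurable M" "\<And>x. x \<in> space M \<Longrightarrow> \<bar>b x\<bar> \<le> B"
  shows "square_integrable M b"
  using square_integrable_bounded_mult[OF square_integrable_const[of 1] assms] by simp

lemma (in prob_space) square_integrable_integrable:
  "square_integrable M f \<Longrightarrow> integrable M f"
  using square_integrable_mult[OF _ square_integrable_const[of 1]] by simp

lemma bounded_mult_integrable:
  assumes f: "integrable M (f :: 'a \<Rightarrow> real)" and b: "b \<in> borel_measurable M"
    and B: "\<And>x. x \<in> space M \<Longrightarrow> \<bar>b x\<bar> \<le> B"
  shows "integrable M (\<lambda>x. b x * f x)"
proof (rule Bochner_Integration.integrable_bound)
  show "integrable M (\<lambda>x. B * f x)" using f by simp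
  show "(\<lambda>x. b x * f x) \<in> borel_measurable M" using f b by simp
  have "\<bar>b x\<bar> \<le> \<bar>B\<bar>" if "x \<in> space M" for x using B[OF that] by simp
  then show "AE x in M. norm (b x * f x) \<le> norm (B * f x)"
    by (intro AE_I2) (simp add: abs_mult mult_right_mono)
qed

text \<open>Jensen's inequality for the square: the variance is nonnegative.\<close>

lemma (in prob_space) square_of_mean_le:
  assumes f: "square_integrable M f"
  shows "(\<integral>x. f x \<partial>M)\<^sup>2 \<le> (\<integral>x. (f x)\<^sup>2 \<partial>M)"
proof -
  let ?m = "\<integral>x. f x \<partial>M"
  note int = square_integrable_integrable[OF f] square_integrable_square[OF f]
  have "0 \<le> (\<integral>x. (f x - ?m)\<^sup>2 \<partial>M)" by simp
  also have "(\<integral>x. (f x - ?m)\<^sup>2 \<partial>M) = (\<integral>x. (f x)\<^sup>2 - 2 * ?m * f x + ?m\<^sup>2 \<partial>M)"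
    by (intro Bochner_Integration.integral_cong) (simp_all add: power2_diff algebra_simps)
  also have "\<dots> = (\<integral>x. (f x)\<^sup>2 \<partial>M) - 2 * ?m * ?m + ?m\<^sup>2"
    using int by (simp add: prob_space)
  finally show ?thesis by (simp add: power2_eq_square)
qed

text \<open>The quadratic form \<open>(s, t) \<mapsto> \<integral> (s f - t g)\<^sup>2\<close> is nonnegative; evaluate it at
\<open>s = \<integral> g\<^sup>2\<close> and \<open>t = \<integral> f g\<close>.\<close>

lemma cauchy_schwarz_integral:
  assumes f: "square_integrable M f" and g: "square_integrable M g"
  shows "(\<integral>x. f x * g x \<partial>M)\<^sup>2 \<le> (\<integral>x. (f x)\<^sup>2 \<partial>M) * (\<integral>x. (g x)\<^sup>2 \<partial>M)"
proof -
  let ?a = "\<integral>x. (f x)\<^sup>2 \<partial>M" and ?b = "\<integral>x. (g x)\<^sup>2 \<partial>M" and ?c = "\<integral>x. f x * g x \<partial>M"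
  have int: "integrable M (\<lambda>x. (f x)\<^sup>2)" "integrable M (\<lambda>x. (g x)\<^sup>2)" "integrable M (\<lambda>x. f x * g x)"
    using f g by (auto intro: square_integrable_square square_integrable_mult)
  have q: "0 \<le> s\<^sup>2 * ?a - 2 * s * t * ?c + t\<^sup>2 * ?b" for s t
  proof -
    have "0 \<le> (\<integral>x. (s * f x - t * g x)\<^sup>2 \<partial>M)" by simp
    also have "\<dots> = (\<integral>x. s\<^sup>2 * (f x)\<^sup>2 - 2 * s * t * (f x * g x) + t\<^sup>2 * (g x)\<^sup>2 \<partial>M)"
      by (intro Bochner_Integration.integral_cong) (simp_all add: power2_eq_square algebra_simps)
    also have "\<dots> = s\<^sup>2 * ?a - 2 * s * t * ?c + t\<^sup>2 * ?b"
      using int by simp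
    finally show ?thesis .
  qed
  have a0: "0 \<le> ?a" and b0: "0 \<le> ?b" by simp_all
  show ?thesis
  proof (cases "?b = 0")
    case True
    have "?c = 0"
    proof (rule ccontr)
      assume c: "?c \<noteq> 0"
      have "0 \<le> ?a - 2 * ((?a + 1) / (2 * ?c)) * ?c" using q[of 1 "(?a + 1) / (2 * ?c)"] True by simp
      also have "\<dots> = -1" using c by (simp add: field_simps)
      finally show False by simp
    qed
    then show ?thesis using True by simp
  next
    case False
    have "0 \<le> ?b\<^sup>2 * ?a - 2 * ?b * ?c * ?c + ?c\<^sup>2 * ?b" by (rule q)
    also have "\<dots> = ?b * (?a * ?b - ?c\<^sup>2)" by (simp add: power2_eq_square algebra_simps)
    finally have "0 \<le> ?a * ?b - ?c\<^sup>2" using False b0 by (simp add: zero_le_mult_iff)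
    then show ?thesis by simp
  qed
qed

lemma square_integrable_dominated:
  assumes g: "square_integrable M g" and f: "f \<in> borel_measurable M"
    and le: "\<And>x. x \<in> space M \<Longrightarrow> \<bar>f x\<bar> \<le> \<bar>g x\<bar>"
  shows "square_integrable M f"
  unfolding square_integrable_def
proof (intro conjI f)
  show "integrable M (\<lambda>x. (f x)\<^sup>2)"
    by (rule Bochner_Integration.integrable_bound[OF square_integrable_square[OF g]])
       (use f le in \<open>auto intro!: AE_I2 borel_measurable_power simp: abs_le_square_iff[symmetric]\<close>)
qed

lemma square_add_le: "(a + b)\<^sup>2 \<le> 2 * a\<^sup>2 + 2 * b\<^sup>2" for a b :: real
  using zero_le_power2[of "a - b"] by (simp add: power2_eq_square algebra_simps)

section \<open>Uniform measure on the energy simplex\<close>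

lemma measurable_chart [measurable]:
  assumes "1 \<le> N"
  shows "chart N \<in> measurable (Pi\<^sub>M {1..<N} (\<lambda>_. lborel)) (Pi\<^sub>M {1..N} (\<lambda>_. borel))"
proof (rule measurable_PiM_single')
  fix i assume i: "i \<in> {1..N}"
  show "(\<lambda>x. chart N x i) \<in> measurable (Pi\<^sub>M {1..<N} (\<lambda>_. lborel)) borel"
  proof (cases "i = N")
    case True
    have "(\<lambda>x. real N - (\<Sum>k\<in>{1..<N}. x k)) \<in> measurable (Pi\<^sub>M {1..<N} (\<lambda>_. lborel)) borel"
      by measurable
    then show ?thesis using True by (simp add: chart_def)
  next
    case False
    then have "i \<in> {1..<N}" using i by auto
    then have "(\<lambda>x. x i) \<in> measurable (Pi\<^sub>M {1..<N} (\<lambda>_. lborel)) borel" by measurable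
    then show ?thesis using False by (simp add: chart_def)
  qed
next
  show "chart N \<in> space (Pi\<^sub>M {1..<N} (\<lambda>_. lborel)) \<rightarrow> {1..N} \<rightarrow>\<^sub>E space borel"
    using assms by (auto simp: chart_def space_PiM PiE_iff extensional_def)
qed

locale exchange_model =
  fixes N :: nat
  assumes N_ge_2: "2 \<le> N"
begin

abbreviation \<sigma> :: "(nat \<Rightarrow> real) measure" where "\<sigma> \<equiv> sigma_unif N"
abbreviation S :: "(nat \<Rightarrow> real) set" where "S \<equiv> energy_simplex N"

lemma simplex_iff:
  "\<eta> \<in> S \<longleftrightarrow> \<eta> \<in> extensional {1..N} \<and> (\<forall>k\<in>{1..N}. 0 \<le> \<eta> k) \<and> (\<Sum>k=1..N. \<eta> k) = real N"
  using N_ge_2 by (auto simp: energy_simplex_def PiE_iff field_simps)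

lemma simplex_sets: "S \<in> sets (Pi\<^sub>M {1..N} (\<lambda>_. borel))"
proof -
  have "S = {\<eta> \<in> space (Pi\<^sub>M {1..N} (\<lambda>_. borel)). (\<forall>k\<in>{1..N}. 0 \<le> \<eta> k) \<and> (\<Sum>k=1..N. \<eta> k) = real N}"
    by (auto simp: simplex_iff space_PiM PiE_iff)
  also have "\<dots> \<in> sets (Pi\<^sub>M {1..N} (\<lambda>_. borel))"
    by measurable
  finally show ?thesis .
qed

lemma space_sigma [simp]: "space \<sigma> = S"
  using simplex_sets by (auto simp: sigma_unif_def simplex_lebesgue_def space_restrict_space
    dest: sets.sets_into_space)

lemma sets_sigma: "sets \<sigma> = sets (restrict_space (Pi\<^sub>M {1..N} (\<lambda>_. borel)) S)"
  by (simp add: sigma_unif_def simplex_lebesgue_def)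

text \<open>The \<open>\<sigma>\<close>-algebra on the simplex is generated by the coordinates.\<close>

lemma measurable_into_sigma:
  assumes "\<And>k. k \<in> {1..N} \<Longrightarrow> (\<lambda>x. T x k) \<in> borel_measurable M"
      and "\<And>x. x \<in> space M \<Longrightarrow> T x \<in> S"
  shows "T \<in> measurable M \<sigma>"
proof -
  have "T \<in> measurable M (Pi\<^sub>M {1..N} (\<lambda>_. borel))"
    by (rule measurable_PiM_single') (use assms in \<open>auto simp: simplex_iff PiE_iff\<close>)
  then have "T \<in> measurable M (restrict_space (Pi\<^sub>M {1..N} (\<lambda>_. borel)) S)"
    using assms(2) by (intro measurable_restrict_space2) auto
  then show ?thesis using measurable_cong_sets[OF refl sets_sigma] by blast
qed

lemma measurable_coordinate [measurable]: "(\<lambda>\<eta>. \<eta> k) \<in> borel_measurable \<sigma>"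
proof (cases "k \<in> {1..N}")
  case True
  have "(\<lambda>\<eta>. \<eta> k) \<in> borel_measurable (restrict_space (Pi\<^sub>M {1..N} (\<lambda>_. borel)) S)"
    by (rule measurable_restrict_space1) (use True in measurable)
  then show ?thesis using measurable_cong_sets[OF sets_sigma refl] by blast
next
  case False
  have "(\<lambda>\<eta>. \<eta> k) \<in> borel_measurable \<sigma> \<longleftrightarrow> (\<lambda>_. undefined :: real) \<in> borel_measurable \<sigma>"
    using False by (intro measurable_cong) (auto simp: simplex_iff extensional_def)
  then show ?thesis by simp
qed

definition chart_domain :: "(nat \<Rightarrow> real) set" where
  "chart_domain = {x \<in> space (Pi\<^sub>M {1..<N} (\<lambda>_. lborel)). chart N x \<in> S}"

lemma chart_domain_sets [measurable]: "chart_domain \<in> sets (Pi\<^sub>M {1..<N} (\<lambda>_. lborel))"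
proof -
  have "chart_domain = chart N -` S \<inter> space (Pi\<^sub>M {1..<N} (\<lambda>_. lborel))"
    by (auto simp: chart_domain_def)
  also have "\<dots> \<in> sets (Pi\<^sub>M {1..<N} (\<lambda>_. lborel))"
    using measurable_chart simplex_sets N_ge_2 by (intro measurable_sets) auto
  finally show ?thesis .
qed

text \<open>The set used to define the measure contains functions that are not extensional; only its trace on
the product space matters.\<close>

lemma restrict_space_chart_domain:
  "restrict_space (Pi\<^sub>M {1..<N} (\<lambda>_. lborel)) {x. chart N x \<in> S}
   = restrict_space (Pi\<^sub>M {1..<N} (\<lambda>_. lborel)) chart_domain"
proof -
  have "{x. chart N x \<in> S} \<inter> space (Pi\<^sub>M {1..<N} (\<lambda>_. lborel))
      = chart_domain \<inter> space (Pi\<^sub>M {1..<N} (\<lambda>_. lborel :: real measure))"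
    by (auto simp: chart_domain_def)
  moreover have "(\<inter>) {x. chart N x \<in> S} ` sets (Pi\<^sub>M {1..<N} (\<lambda>_. lborel))
      = (\<inter>) chart_domain ` sets (Pi\<^sub>M {1..<N} (\<lambda>_. lborel :: real measure))"
    by (intro image_cong refl) (auto simp: chart_domain_def dest: sets.sets_into_space)
  ultimately show ?thesis
    by (simp only: restrict_space_def)
qed

lemma measurable_chart_restricted:
  "chart N \<in> measurable (restrict_space (Pi\<^sub>M {1..<N} (\<lambda>_. lborel)) chart_domain)
     (restrict_space (Pi\<^sub>M {1..N} (\<lambda>_. borel)) S)"
  using N_ge_2
  by (intro measurable_restrict_space3 measurable_chart) (auto simp: chart_domain_def)

lemma nn_integral_simplex_lebesgue:
  assumes "g \<in> borel_measurable \<sigma>"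
  shows "(\<integral>\<^sup>+\<eta>. g \<eta> \<partial>simplex_lebesgue N)
       = (\<integral>\<^sup>+x. g (chart N x) * indicator chart_domain x \<partial>Pi\<^sub>M {1..<N} (\<lambda>_. lborel))"
proof -
  have g: "g \<in> borel_measurable (restrict_space (Pi\<^sub>M {1..N} (\<lambda>_. borel)) S)"
    using assms measurable_cong_sets[OF sets_sigma refl] by blast
  show ?thesis
    unfolding simplex_lebesgue_def restrict_space_chart_domain
    by (simp add: nn_integral_distr[OF measurable_chart_restricted] g nn_integral_restrict_space
        sets.Int_space_eq2)
qed

lemma sets_simplex_lebesgue: "sets (simplex_lebesgue N) = sets \<sigma>"
  by (simp add: sigma_unif_def)

lemma emeasure_simplex_lebesgue:
  "emeasure (simplex_lebesgue N) S = emeasure (Pi\<^sub>M {1..<N} (\<lambda>_. lborel)) chart_domain"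
proof -
  have "S \<in> sets \<sigma>" using sets.top[of \<sigma>] by simp
  then have "emeasure (simplex_lebesgue N) S = (\<integral>\<^sup>+\<eta>. indicator S \<eta> \<partial>simplex_lebesgue N)"
    by (simp add: sets_simplex_lebesgue)
  also have "\<dots> = (\<integral>\<^sup>+x. indicator chart_domain x \<partial>Pi\<^sub>M {1..<N} (\<lambda>_. lborel))"
    using \<open>S \<in> sets \<sigma>\<close> by (subst nn_integral_simplex_lebesgue)
      (auto intro!: nn_integral_cong simp: chart_domain_def split: split_indicator)
  finally show ?thesis by simp
qed

sublocale lborel_product: product_sigma_finite "\<lambda>_::nat. lborel :: real measure"
  by unfold_locales

text \<open>The chart domain lies between the boxes of side 1 and of side N, so that normalising its volume is
legitimate.\<close>

lemma chart_domain_volume: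
  "emeasure (Pi\<^sub>M {1..<N} (\<lambda>_. lborel)) chart_domain \<noteq> 0"
  "emeasure (Pi\<^sub>M {1..<N} (\<lambda>_. lborel)) chart_domain \<noteq> \<infinity>"
proof -
  let ?P = "Pi\<^sub>M {1..<N} (\<lambda>_. lborel :: real measure)"
  have box: "emeasure ?P (PiE {1..<N} (\<lambda>_. {0..c})) = ennreal c ^ (N - 1)" if "0 \<le> c" for c :: real
    using that by (subst lborel_product.emeasure_PiM) auto
  have split: "{1..N} = insert N {1..<N}" using N_ge_2 by auto
  have "PiE {1..<N} (\<lambda>_. {0..1}) \<subseteq> chart_domain"
  proof
    fix x :: "nat \<Rightarrow> real" assume x: "x \<in> PiE {1..<N} (\<lambda>_. {0..1})"
    have "(\<Sum>k\<in>{1..<N}. x k) \<le> (\<Sum>k\<in>{1..<N}. 1)" using x by (intro sum_mono) auto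
    then have "(\<Sum>k\<in>{1..<N}. x k) \<le> real N" using N_ge_2 by simp
    then show "x \<in> chart_domain" using x N_ge_2
      by (auto simp: chart_domain_def simplex_iff chart_def split space_PiM PiE_iff extensional_def)
  qed
  then have "emeasure ?P (PiE {1..<N} (\<lambda>_. {0..1})) \<le> emeasure ?P chart_domain"
    by (intro emeasure_mono chart_domain_sets)
  then show "emeasure ?P chart_domain \<noteq> 0" using box[of 1] by auto
  have "chart_domain \<subseteq> PiE {1..<N} (\<lambda>_. {0..real N})"
  proof
    fix x assume x: "x \<in> chart_domain"
    have nn: "\<And>k. k \<in> {1..<N} \<Longrightarrow> 0 \<le> x k" and s: "(\<Sum>k\<in>{1..<N}. x k) \<le> real N"
      using x by (auto simp: chart_domain_def simplex_iff chart_def split split: if_splits)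
    have "x k \<le> real N" if "k \<in> {1..<N}" for k
      using member_le_sum[of k "{1..<N}" x] nn s that by auto
    then show "x \<in> PiE {1..<N} (\<lambda>_. {0..real N})"
      using x nn by (auto simp: chart_domain_def space_PiM PiE_iff)
  qed
  then have "emeasure ?P chart_domain \<le> emeasure ?P (PiE {1..<N} (\<lambda>_. {0..real N}))"
    by (intro emeasure_mono sets_PiM_I_finite) auto
  also have "\<dots> < \<infinity>" using box[of "real N"] by (simp add: ennreal_power)
  finally show "emeasure ?P chart_domain \<noteq> \<infinity>" by simp
qed

lemma prob_space_sigma: "prob_space \<sigma>"
  unfolding sigma_unif_def
  using chart_domain_volume
  by (intro prob_space_uniform_measure) (simp_all add: emeasure_simplex_lebesgue)

lemma nn_integral_sigma:
  assumes g: "g \<in> borel_measurable \<sigma>"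
  shows "(\<integral>\<^sup>+\<eta>. g \<eta> \<partial>\<sigma>)
       = (\<integral>\<^sup>+x. g (chart N x) * indicator chart_domain x \<partial>Pi\<^sub>M {1..<N} (\<lambda>_. lborel))
         / emeasure (simplex_lebesgue N) S"
proof -
  have S: "S \<in> sets (simplex_lebesgue N)" using sets.top[of \<sigma>] by (simp add: sets_simplex_lebesgue)
  have g': "g \<in> borel_measurable (simplex_lebesgue N)"
    using g measurable_cong_sets[OF sets_simplex_lebesgue refl] by blast
  have "(\<integral>\<^sup>+\<eta>. g \<eta> * indicator S \<eta> \<partial>simplex_lebesgue N) = (\<integral>\<^sup>+\<eta>. g \<eta> \<partial>simplex_lebesgue N)"
    using sets_eq_imp_space_eq[OF sets_simplex_lebesgue]
    by (intro nn_integral_cong) (auto split: split_indicator)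
  then show ?thesis
    using nn_integral_uniform_measure[OF g' S] nn_integral_simplex_lebesgue[OF g]
    by (simp add: sigma_unif_def)
qed

lemma simplex_coordinate:
  assumes "\<eta> \<in> S" "k \<in> {1..N}"
  shows "0 \<le> \<eta> k" "\<eta> k \<le> real N"
proof -
  show "0 \<le> \<eta> k" using assms by (simp add: simplex_iff)
  have "\<eta> k \<le> (\<Sum>k=1..N. \<eta> k)"
    using assms by (intro member_le_sum) (auto simp: simplex_iff)
  then show "\<eta> k \<le> real N" using assms by (simp add: simplex_iff)
qed

lemma sum_coordinates: "\<eta> \<in> S \<Longrightarrow> (\<Sum>k=1..N. \<eta> k) = real N"
  by (simp add: simplex_iff)

section \<open>Reversibility of pair exchanges\<close>

lemma exchange_sum:
  assumes "i \<in> {1..N}" "j \<in> {1..N}" "i \<noteq> j"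
  shows "(\<Sum>k=1..N. exchange i j \<alpha> \<eta> k) = (\<Sum>k=1..N. \<eta> k)"
proof -
  have "(\<Sum>k=1..N. z k) = z i + z j + (\<Sum>k\<in>{1..N} - {i} - {j}. z k)" for z :: "nat \<Rightarrow> real"
    using assms by (simp add: sum.remove[of "{1..N}" i] sum.remove[of "{1..N} - {i}" j])
  from this[of \<eta>] this[of "exchange i j \<alpha> \<eta>"] show ?thesis
    using assms by (simp add: exchange_def algebra_simps)
qed

lemma exchange_in_simplex:
  assumes "i \<in> {1..N}" "j \<in> {1..N}" "i \<noteq> j" "\<eta> \<in> S" "\<alpha> \<in> {0..1}"
  shows "exchange i j \<alpha> \<eta> \<in> S"
  unfolding simplex_iff
proof (intro conjI)
  show "(\<Sum>k=1..N. exchange i j \<alpha> \<eta> k) = real N"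
    using exchange_sum[OF assms(1-3)] assms(4) by (simp add: simplex_iff)
qed (use assms in \<open>auto simp: simplex_iff exchange_def extensional_def\<close>)

lemma exchange_pair_sum:
  "i \<noteq> j \<Longrightarrow> exchange i j \<alpha> \<eta> i + exchange i j \<alpha> \<eta> j = \<eta> i + \<eta> j"
  by (simp add: exchange_def algebra_simps)

lemma exchange_exchange:
  "i \<noteq> j \<Longrightarrow> exchange i j \<alpha> (exchange i j \<beta> \<eta>) = exchange i j \<alpha> \<eta>"
  by (rule ext) (auto simp: exchange_def algebra_simps)

lemma exchange_commute:
  "i \<noteq> j \<Longrightarrow> exchange i j \<alpha> \<eta> = exchange j i (1 - \<alpha>) \<eta>"
  by (rule ext) (auto simp: exchange_def algebra_simps)

lemma measurable_snd_unit [measurable]: "(\<lambda>p. snd p) \<in> borel_measurable (M \<Otimes>\<^sub>M unit_lebesgue)"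
  by (rule measurable_compose[OF measurable_snd measurable_unit_lebesgue])

lemma measurable_exchange:
  assumes "i \<in> {1..N}" "j \<in> {1..N}" "i \<noteq> j"
  shows "(\<lambda>p. exchange i j (snd p) (fst p)) \<in> measurable (\<sigma> \<Otimes>\<^sub>M unit_lebesgue) \<sigma>"
proof (rule measurable_into_sigma)
  fix k assume "k \<in> {1..N}"
  have [measurable]: "(\<lambda>p. fst p l) \<in> borel_measurable (\<sigma> \<Otimes>\<^sub>M unit_lebesgue)" for l
    by (rule measurable_compose[OF measurable_fst measurable_coordinate])
  show "(\<lambda>p. exchange i j (snd p) (fst p) k) \<in> borel_measurable (\<sigma> \<Otimes>\<^sub>M unit_lebesgue)"
    by (cases "k = j"; cases "k = i"; simp add: exchange_def)
qed (use assms in \<open>auto simp: space_pair_measure intro!: exchange_in_simplex\<close>)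

definition fibre_energy :: "nat \<Rightarrow> (nat \<Rightarrow> real) \<Rightarrow> real" where
  "fibre_energy i x = real N - (\<Sum>k\<in>{1..<N} - {i}. x k)"

text \<open>The segment on which only particles i and N exchange energy. In the chart, only the coordinate i
varies along it, with uniform density.\<close>

definition fibre :: "nat \<Rightarrow> (nat \<Rightarrow> real) \<Rightarrow> real \<Rightarrow> nat \<Rightarrow> real" where
  "fibre i x y = x(i := y, N := fibre_energy i x - y)"

lemma chart_fibre:
  assumes "i \<in> {1..<N}"
  shows "chart N (x(i := y)) = fibre i x y"
proof -
  have "(\<Sum>k\<in>{1..<N}. (x(i := y)) k) = y + (\<Sum>k\<in>{1..<N} - {i}. x k)"
    using assms by (simp add: sum.remove[of "{1..<N}" i])
  then have "real N - (\<Sum>k\<in>{1..<N}. (x(i := y)) k) = fibre_energy i x - y"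
    unfolding fibre_energy_def by linarith
  then show ?thesis unfolding chart_def fibre_def by simp
qed

lemma sum_split_last:
  fixes z :: "nat \<Rightarrow> real"
  assumes "i \<in> {1..<N}"
  shows "(\<Sum>k=1..N. z k) = z N + z i + (\<Sum>k\<in>{1..<N} - {i}. z k)"
proof -
  have "{1..N} - {N} = {1..<N}" by auto
  then show ?thesis
    using assms N_ge_2 by (simp add: sum.remove[of "{1..N}" N] sum.remove[of "{1..<N}" i])
qed

lemma fibre_in_simplex:
  assumes i: "i \<in> {1..<N}" and x: "x \<in> extensional ({1..<N} - {i})"
  shows "fibre i x y \<in> S \<longleftrightarrow> (\<forall>k\<in>{1..<N} - {i}. 0 \<le> x k) \<and> y \<in> {0..fibre_energy i x}"
proof -
  have split: "{1..N} = insert N (insert i ({1..<N} - {i}))" using i N_ge_2 by auto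
  have "(\<Sum>k=1..N. fibre i x y k) = real N"
    unfolding sum_split_last[OF i] using i by (simp add: fibre_def fibre_energy_def)
  moreover have "fibre i x y \<in> extensional {1..N}"
    using x i by (auto simp: fibre_def extensional_def)
  moreover have "(\<forall>k\<in>{1..N}. 0 \<le> fibre i x y k)
      \<longleftrightarrow> (\<forall>k\<in>{1..<N} - {i}. 0 \<le> x k) \<and> y \<in> {0..fibre_energy i x}"
    unfolding split using i by (auto simp: fibre_def)
  ultimately show ?thesis by (simp add: simplex_iff)
qed

lemma measurable_along_fibre:
  fixes g :: "(nat \<Rightarrow> real) \<Rightarrow> ennreal"
  assumes i: "i \<in> {1..<N}" and x: "x \<in> extensional ({1..<N} - {i})" "\<forall>k\<in>{1..<N} - {i}. 0 \<le> x k"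
    and g: "g \<in> borel_measurable \<sigma>"
  shows "(\<lambda>y. g (fibre i x y) * indicator {0..fibre_energy i x} y) \<in> borel_measurable borel"
proof -
  have "fibre i x \<in> measurable (restrict_space borel {0..fibre_energy i x}) \<sigma>"
  proof (rule measurable_into_sigma)
    fix k
    have "(\<lambda>y. fibre i x y k) \<in> borel_measurable borel"
      by (cases "k = N"; cases "k = i") (use i in \<open>simp_all add: fibre_def\<close>)
    then show "(\<lambda>y. fibre i x y k) \<in> borel_measurable (restrict_space borel {0..fibre_energy i x})"
      by (rule measurable_restrict_space1)
  qed (use fibre_in_simplex[OF i x(1)] x(2) in \<open>auto simp: space_restrict_space\<close>)
  then have "(\<lambda>y. g (fibre i x y)) \<in> borel_measurable (restrict_space borel {0..fibre_energy i x})"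
    using g by (rule measurable_compose)
  then show ?thesis
    by (subst (asm) borel_measurable_restrict_space_iff_ennreal) auto
qed

text \<open>Fubini in the chart, with the coordinate i integrated first. This reduces invariance properties of
\<open>\<sigma>\<close> to one-dimensional substitutions along the fibres.\<close>

lemma nn_integral_sigma_fibre:
  assumes i: "i \<in> {1..<N}" and g: "g \<in> borel_measurable \<sigma>"
  shows "(\<integral>\<^sup>+\<eta>. g \<eta> \<partial>\<sigma>) =
     (\<integral>\<^sup>+x. (\<integral>\<^sup>+y. g (fibre i x y) * indicator {0..fibre_energy i x} y \<partial>lborel)
        * indicator {x. \<forall>k\<in>{1..<N} - {i}. 0 \<le> x k} x \<partial>Pi\<^sub>M ({1..<N} - {i}) (\<lambda>_. lborel))
       / emeasure (simplex_lebesgue N) S"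
proof -
  let ?J = "{1..<N} - {i}"
  have ins: "{1..<N} = insert i ?J" using i by auto
  let ?G = "\<lambda>x. g (chart N x) * indicator chart_domain x"
  have "(\<lambda>x. g (chart N x)) \<in> borel_measurable (restrict_space (Pi\<^sub>M {1..<N} (\<lambda>_. lborel)) chart_domain)"
  proof (rule measurable_compose[OF measurable_chart_restricted])
    show "g \<in> borel_measurable (restrict_space (Pi\<^sub>M {1..N} (\<lambda>_. borel)) S)"
      using g measurable_cong_sets[OF sets_sigma refl] by blast
  qed
  then have G: "?G \<in> borel_measurable (Pi\<^sub>M {1..<N} (\<lambda>_. lborel))"
    by (subst (asm) borel_measurable_restrict_space_iff_ennreal)
       (auto intro: sets.Int)
  have "(\<integral>\<^sup>+x. ?G x \<partial>Pi\<^sub>M {1..<N} (\<lambda>_. lborel))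
      = (\<integral>\<^sup>+x. (\<integral>\<^sup>+y. ?G (x(i := y)) \<partial>lborel) \<partial>Pi\<^sub>M ?J (\<lambda>_. lborel))"
    using lborel_product.product_nn_integral_insert[of ?J i ?G] G ins by simp
  also have "\<dots> = (\<integral>\<^sup>+x. (\<integral>\<^sup>+y. g (fibre i x y) * indicator {0..fibre_energy i x} y \<partial>lborel)
        * indicator {x. \<forall>k\<in>?J. 0 \<le> x k} x \<partial>Pi\<^sub>M ?J (\<lambda>_. lborel))"
  proof (intro nn_integral_cong)
    fix x :: "nat \<Rightarrow> real" assume "x \<in> space (Pi\<^sub>M ?J (\<lambda>_. lborel))"
    then have x: "x \<in> extensional ?J" by (simp add: space_PiM PiE_iff)
    have "x(i := y) \<in> chart_domain \<longleftrightarrow> (\<forall>k\<in>?J. 0 \<le> x k) \<and> y \<in> {0..fibre_energy i x}" for y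
    proof -
      have "x(i := y) \<in> space (Pi\<^sub>M {1..<N} (\<lambda>_. lborel))"
        using x i by (auto simp: space_PiM PiE_iff extensional_def)
      then show ?thesis
        using fibre_in_simplex[OF i x] chart_fibre[OF i] by (simp add: chart_domain_def)
    qed
    then have "?G (x(i := y)) = (g (fibre i x y) * indicator {0..fibre_energy i x} y)
        * indicator {x. \<forall>k\<in>?J. 0 \<le> x k} x" for y
      using chart_fibre[OF i] by (auto split: split_indicator)
    then show "(\<integral>\<^sup>+y. ?G (x(i := y)) \<partial>lborel)
        = (\<integral>\<^sup>+y. g (fibre i x y) * indicator {0..fibre_energy i x} y \<partial>lborel)
          * indicator {x. \<forall>k\<in>?J. 0 \<le> x k} x"
      by (auto split: split_indicator)
  qed
  finally show ?thesis using nn_integral_sigma[OF g] by simp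
qed

lemma nn_integral_sigma_eqI:
  assumes i: "i \<in> {1..<N}" and g: "g \<in> borel_measurable \<sigma>" and h: "h \<in> borel_measurable \<sigma>"
    and eq: "\<And>x. x \<in> extensional ({1..<N} - {i}) \<Longrightarrow> \<forall>k\<in>{1..<N} - {i}. 0 \<le> x k \<Longrightarrow>
      (\<integral>\<^sup>+y. g (fibre i x y) * indicator {0..fibre_energy i x} y \<partial>lborel)
    = (\<integral>\<^sup>+y. h (fibre i x y) * indicator {0..fibre_energy i x} y \<partial>lborel)"
  shows "(\<integral>\<^sup>+\<eta>. g \<eta> \<partial>\<sigma>) = (\<integral>\<^sup>+\<eta>. h \<eta> \<partial>\<sigma>)"
  unfolding nn_integral_sigma_fibre[OF i g] nn_integral_sigma_fibre[OF i h]
  by (intro arg_cong2[where f="(/)"] nn_integral_cong)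
     (auto simp: space_PiM PiE_iff eq split: split_indicator)

definition swap_last :: "nat \<Rightarrow> (nat \<Rightarrow> real) \<Rightarrow> (nat \<Rightarrow> real)" where
  "swap_last j \<eta> = \<eta>(j := \<eta> N, N := \<eta> j)"

lemma swap_last_measurable:
  assumes "j \<in> {1..<N}"
  shows "swap_last j \<in> measurable \<sigma> \<sigma>"
proof (rule measurable_into_sigma)
  fix k
  show "(\<lambda>\<eta>. swap_last j \<eta> k) \<in> borel_measurable \<sigma>"
    by (cases "k = N"; cases "k = j") (use assms in \<open>simp_all add: swap_last_def\<close>)
next
  fix \<eta> assume \<eta>: "\<eta> \<in> space \<sigma>"
  have "(\<Sum>k=1..N. swap_last j \<eta> k) = (\<Sum>k=1..N. \<eta> k)"
    unfolding sum_split_last[OF assms] using assms by (simp add: swap_last_def)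
  then show "swap_last j \<eta> \<in> S"
    using \<eta> assms by (auto simp: simplex_iff swap_last_def extensional_def)
qed

text \<open>The swap acts on a fibre as the reflection \<open>y \<mapsto> T - y\<close>, T being the energy of the fibre.\<close>

lemma nn_integral_swap_last:
  assumes j: "j \<in> {1..<N}" and g: "g \<in> borel_measurable \<sigma>"
  shows "(\<integral>\<^sup>+\<eta>. g (swap_last j \<eta>) \<partial>\<sigma>) = (\<integral>\<^sup>+\<eta>. g \<eta> \<partial>\<sigma>)"
proof (rule nn_integral_sigma_eqI[OF j])
  show "(\<lambda>\<eta>. g (swap_last j \<eta>)) \<in> borel_measurable \<sigma>"
    by (rule measurable_compose[OF swap_last_measurable[OF j] g])
  fix x :: "nat \<Rightarrow> real" assume x: "x \<in> extensional ({1..<N} - {j})" "\<forall>k\<in>{1..<N} - {j}. 0 \<le> x k"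
  let ?T = "fibre_energy j x"
  have sw: "swap_last j (fibre j x y) = fibre j x (?T - y)" for y
    using j by (auto simp: swap_last_def fibre_def)
  have "(\<integral>\<^sup>+y. g (fibre j x y) * indicator {0..?T} y \<partial>lborel)
      = (\<integral>\<^sup>+y. g (fibre j x (?T + (-1) * y)) * indicator {0..?T} (?T + (-1) * y) \<partial>lborel)"
    by (subst nn_integral_real_affine[OF measurable_along_fibre[OF j x g], where c="-1" and t="?T"]) auto
  also have "\<dots> = (\<integral>\<^sup>+y. g (swap_last j (fibre j x y)) * indicator {0..?T} y \<partial>lborel)"
    by (intro nn_integral_cong) (auto simp: sw indicator_def)
  finally show "(\<integral>\<^sup>+y. g (swap_last j (fibre j x y)) * indicator {0..?T} y \<partial>lborel)
      = (\<integral>\<^sup>+y. g (fibre j x y) * indicator {0..?T} y \<partial>lborel)" by simp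
qed (rule g)

lemma measurable_exchange_curried:
  assumes "i \<in> {1..N}" "j \<in> {1..N}" "i \<noteq> j" and g: "g \<in> borel_measurable \<sigma>"
  shows "(\<lambda>(\<eta>, \<alpha>). g (exchange i j \<alpha> \<eta>)) \<in> borel_measurable (\<sigma> \<Otimes>\<^sub>M unit_lebesgue)"
  using measurable_compose[OF measurable_exchange[OF assms(1-3)] g] by (simp add: case_prod_beta)

lemma measurable_nn_average:
  assumes "i \<in> {1..N}" "j \<in> {1..N}" "i \<noteq> j" and g: "g \<in> borel_measurable \<sigma>"
  shows "(\<lambda>\<eta>. \<integral>\<^sup>+\<alpha>. g (exchange i j \<alpha> \<eta>) \<partial>unit_lebesgue) \<in> borel_measurable \<sigma>"
proof -
  show ?thesis by (rule unit.borel_measurable_nn_integral[OF measurable_exchange_curried[OF assms]])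
qed

text \<open>On a fibre the exchange of i and N draws a point uniformly, and uniform is also the law of \<open>\<sigma>\<close>
along the fibre.\<close>

lemma nn_integral_exchange_last:
  assumes i: "i \<in> {1..<N}" and g: "g \<in> borel_measurable \<sigma>"
  shows "(\<integral>\<^sup>+\<eta>. (\<integral>\<^sup>+\<alpha>. g (exchange i N \<alpha> \<eta>) \<partial>unit_lebesgue) \<partial>\<sigma>) = (\<integral>\<^sup>+\<eta>. g \<eta> \<partial>\<sigma>)"
proof (rule nn_integral_sigma_eqI[OF i])
  show "(\<lambda>\<eta>. \<integral>\<^sup>+\<alpha>. g (exchange i N \<alpha> \<eta>) \<partial>unit_lebesgue) \<in> borel_measurable \<sigma>"
    by (rule measurable_nn_average) (use i g in auto)
  fix x :: "nat \<Rightarrow> real" assume x: "x \<in> extensional ({1..<N} - {i})" "\<forall>k\<in>{1..<N} - {i}. 0 \<le> x k"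
  let ?T = "fibre_energy i x"
  let ?G = "\<lambda>y. g (fibre i x y) * indicator {0..?T} y"
  have ex: "exchange i N \<alpha> (fibre i x y) = fibre i x (?T * \<alpha>)" for y \<alpha>
    using i by (auto simp: exchange_def fibre_def algebra_simps)
  consider "?T < 0" | "?T = 0" | "0 < ?T" by linarith
  then show "(\<integral>\<^sup>+y. (\<integral>\<^sup>+\<alpha>. g (exchange i N \<alpha> (fibre i x y)) \<partial>unit_lebesgue) * indicator {0..?T} y \<partial>lborel)
      = (\<integral>\<^sup>+y. ?G y \<partial>lborel)"
  proof cases
    \<comment> \<open>A fibre reduced to a point has measure zero.\<close>
    case 2
    have null: "{0..?T} \<in> null_sets lborel" unfolding 2 by (simp add: null_sets_def)
    show ?thesis by (simp only: nn_integral_null_set[OF null])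
  next
    case 3
    have "(\<integral>\<^sup>+y. ?G y \<partial>lborel) = ennreal \<bar>?T\<bar> * (\<integral>\<^sup>+\<alpha>. ?G (0 + ?T * \<alpha>) \<partial>lborel)"
      by (rule nn_integral_real_affine[OF measurable_along_fibre[OF i x g]]) (use 3 in simp)
    also have "(\<integral>\<^sup>+\<alpha>. ?G (0 + ?T * \<alpha>) \<partial>lborel)
        = (\<integral>\<^sup>+\<alpha>. g (fibre i x (?T * \<alpha>)) * indicator {0..1} \<alpha> \<partial>lborel)"
      using 3 by (intro nn_integral_cong) (auto simp: indicator_def zero_le_mult_iff)
    also have "ennreal \<bar>?T\<bar> * \<dots>
        = (\<integral>\<^sup>+y. (\<integral>\<^sup>+\<alpha>. g (exchange i N \<alpha> (fibre i x y)) \<partial>unit_lebesgue) * indicator {0..?T} y \<partial>lborel)"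
      using 3 by (simp add: ex nn_integral_unit_lebesgue nn_integral_cmult_indicator mult.commute[of "ennreal _"])
    finally show ?thesis by simp
  qed simp
qed (rule g)

text \<open>Resampling a pair preserves \<open>\<sigma>\<close>. Pairs that do not contain the last particle are conjugate, by
a swap, to pairs that do.\<close>

lemma nn_integral_exchange:
  assumes ij: "i \<in> {1..N}" "j \<in> {1..N}" "i \<noteq> j" and g: "g \<in> borel_measurable \<sigma>"
  shows "(\<integral>\<^sup>+\<eta>. (\<integral>\<^sup>+\<alpha>. g (exchange i j \<alpha> \<eta>) \<partial>unit_lebesgue) \<partial>\<sigma>) = (\<integral>\<^sup>+\<eta>. g \<eta> \<partial>\<sigma>)"
proof -
  have to_last: "(\<integral>\<^sup>+\<eta>. (\<integral>\<^sup>+\<alpha>. g (exchange i j \<alpha> \<eta>) \<partial>unit_lebesgue) \<partial>\<sigma>) = (\<integral>\<^sup>+\<eta>. g \<eta> \<partial>\<sigma>)"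
    if i: "i \<in> {1..<N}" and j: "j \<in> {1..N}" and ne: "i \<noteq> j" for i j
  proof (cases "j = N")
    case True
    then show ?thesis using nn_integral_exchange_last[OF i g] by simp
  next
    case False
    then have j': "j \<in> {1..<N}" using j by auto
    have conj: "exchange i j \<alpha> \<eta> = swap_last j (exchange i N \<alpha> (swap_last j \<eta>))" for \<alpha> \<eta>
      using i j' ne by (auto simp: exchange_def swap_last_def)
    have gs: "(\<lambda>\<eta>. g (swap_last j \<eta>)) \<in> borel_measurable \<sigma>"
      by (rule measurable_compose[OF swap_last_measurable[OF j'] g])
    have "(\<integral>\<^sup>+\<eta>. (\<integral>\<^sup>+\<alpha>. g (exchange i j \<alpha> \<eta>) \<partial>unit_lebesgue) \<partial>\<sigma>)
        = (\<integral>\<^sup>+\<eta>. (\<integral>\<^sup>+\<alpha>. g (swap_last j (exchange i N \<alpha> (swap_last j \<eta>))) \<partial>unit_lebesgue) \<partial>\<sigma>)"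
      by (simp only: conj)
    also have "\<dots> = (\<integral>\<^sup>+\<eta>. (\<integral>\<^sup>+\<alpha>. g (swap_last j (exchange i N \<alpha> \<eta>)) \<partial>unit_lebesgue) \<partial>\<sigma>)"
      by (rule nn_integral_swap_last[OF j'], rule measurable_nn_average[OF _ _ _ gs]) (use i in auto)
    also have "\<dots> = (\<integral>\<^sup>+\<eta>. g (swap_last j \<eta>) \<partial>\<sigma>)"
      by (rule nn_integral_exchange_last[OF i gs])
    also have "\<dots> = (\<integral>\<^sup>+\<eta>. g \<eta> \<partial>\<sigma>)" by (rule nn_integral_swap_last[OF j' g])
    finally show ?thesis .
  qed
  show ?thesis
  proof (cases "i = N")
    case False
    then show ?thesis using to_last[of i j] ij by auto
  next
    case True
    have "(\<integral>\<^sup>+\<alpha>. g (exchange i j \<alpha> \<eta>) \<partial>unit_lebesgue) = (\<integral>\<^sup>+\<alpha>. g (exchange j i \<alpha> \<eta>) \<partial>unit_lebesgue)"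
      if \<eta>: "\<eta> \<in> space \<sigma>" for \<eta>
    proof -
      have "(\<lambda>\<alpha>. g (exchange j i \<alpha> \<eta>)) \<in> borel_measurable unit_lebesgue"
        using measurable_Pair2[OF measurable_exchange_curried[OF ij(2,1) ij(3)[symmetric] g] \<eta>] by simp
      from nn_integral_unit_reflect[OF this] show ?thesis
        by (simp add: exchange_commute[OF ij(3)])
    qed
    then have "(\<integral>\<^sup>+\<eta>. (\<integral>\<^sup>+\<alpha>. g (exchange i j \<alpha> \<eta>) \<partial>unit_lebesgue) \<partial>\<sigma>)
        = (\<integral>\<^sup>+\<eta>. (\<integral>\<^sup>+\<alpha>. g (exchange j i \<alpha> \<eta>) \<partial>unit_lebesgue) \<partial>\<sigma>)"
      by (rule nn_integral_cong)
    then show ?thesis using to_last[of j i] ij True by auto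
  qed
qed

text \<open>The law of a configuration together with the random proportion used in one exchange.\<close>

abbreviation Q :: "((nat \<Rightarrow> real) \<times> real) measure" where "Q \<equiv> \<sigma> \<Otimes>\<^sub>M unit_lebesgue"

lemma nn_integral_Q:
  "f \<in> borel_measurable Q \<Longrightarrow> (\<integral>\<^sup>+p. f p \<partial>Q) = (\<integral>\<^sup>+\<eta>. (\<integral>\<^sup>+\<alpha>. f (\<eta>, \<alpha>) \<partial>unit_lebesgue) \<partial>\<sigma>)"
proof -
  assume f: "f \<in> borel_measurable Q"
  show ?thesis using unit.nn_integral_fst[OF f] by simp
qed

text \<open>The configurations before and after an exchange form an exchangeable pair. Resample once more:
by invariance both have the law of two independent resamplings of the same pair, and these may be
interchanged.\<close>

lemma exchangeable:
  assumes ij: "i \<in> {1..N}" "j \<in> {1..N}" "i \<noteq> j"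
  shows "distr Q (\<sigma> \<Otimes>\<^sub>M \<sigma>) (\<lambda>p. (fst p, exchange i j (snd p) (fst p)))
       = distr Q (\<sigma> \<Otimes>\<^sub>M \<sigma>) (\<lambda>p. (exchange i j (snd p) (fst p), fst p))"
proof (rule measure_eqI)
  interpret UU: pair_sigma_finite unit_lebesgue unit_lebesgue by unfold_locales
  note [measurable] = measurable_exchange[OF ij]
  fix A assume "A \<in> sets (distr Q (\<sigma> \<Otimes>\<^sub>M \<sigma>) (\<lambda>p. (fst p, exchange i j (snd p) (fst p))))"
  then have A[measurable]: "A \<in> sets (\<sigma> \<Otimes>\<^sub>M \<sigma>)" by simp
  have two: "(\<lambda>p. exchange i j (f p) (h p)) \<in> measurable M \<sigma>"
    if "h \<in> measurable M \<sigma>" "f \<in> measurable M unit_lebesgue" for f h and M :: "'b measure"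
    using measurable_compose[OF measurable_Pair[OF that] measurable_exchange[OF ij]] by simp
  note [measurable (raw)] = two
  have swap: "(\<integral>\<^sup>+\<eta>. (\<integral>\<^sup>+\<alpha>. F (\<eta>, exchange i j \<alpha> \<eta>) \<partial>unit_lebesgue) \<partial>\<sigma>) =
     (\<integral>\<^sup>+\<eta>. (\<integral>\<^sup>+\<beta>. (\<integral>\<^sup>+\<alpha>. F (exchange i j \<beta> \<eta>, exchange i j \<alpha> \<eta>) \<partial>unit_lebesgue) \<partial>unit_lebesgue) \<partial>\<sigma>)"
    if F[measurable]: "F \<in> borel_measurable (\<sigma> \<Otimes>\<^sub>M \<sigma>)" for F :: "(nat \<Rightarrow> real) \<times> (nat \<Rightarrow> real) \<Rightarrow> ennreal"
  proof -
    have "(\<lambda>\<eta>. \<integral>\<^sup>+\<alpha>. F (\<eta>, exchange i j \<alpha> \<eta>) \<partial>unit_lebesgue) \<in> borel_measurable \<sigma>"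
      by (rule unit.borel_measurable_nn_integral) measurable
    from nn_integral_exchange[OF ij this] show ?thesis
      by (simp add: exchange_exchange[OF ij(3)])
  qed
  have "emeasure (distr Q (\<sigma> \<Otimes>\<^sub>M \<sigma>) (\<lambda>p. (fst p, exchange i j (snd p) (fst p)))) A
      = (\<integral>\<^sup>+p. indicator A p \<partial>distr Q (\<sigma> \<Otimes>\<^sub>M \<sigma>) (\<lambda>p. (fst p, exchange i j (snd p) (fst p))))"
    by simp
  also have "\<dots> = (\<integral>\<^sup>+p. indicator A (fst p, exchange i j (snd p) (fst p)) \<partial>Q)"
    by (rule nn_integral_distr) measurable
  also have "\<dots> = (\<integral>\<^sup>+\<eta>. (\<integral>\<^sup>+\<alpha>. indicator A (\<eta>, exchange i j \<alpha> \<eta>) \<partial>unit_lebesgue) \<partial>\<sigma>)"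
    by (subst nn_integral_Q) simp_all
  also have "\<dots> = (\<integral>\<^sup>+\<eta>. (\<integral>\<^sup>+\<beta>. (\<integral>\<^sup>+\<alpha>. indicator A (exchange i j \<beta> \<eta>, exchange i j \<alpha> \<eta>)
      \<partial>unit_lebesgue) \<partial>unit_lebesgue) \<partial>\<sigma>)"
    by (rule swap) measurable
  also have "\<dots> = (\<integral>\<^sup>+\<eta>. (\<integral>\<^sup>+\<alpha>. (\<integral>\<^sup>+\<beta>. indicator A (exchange i j \<beta> \<eta>, exchange i j \<alpha> \<eta>)
      \<partial>unit_lebesgue) \<partial>unit_lebesgue) \<partial>\<sigma>)"
  proof (rule nn_integral_cong)
    fix \<eta> assume [measurable]: "\<eta> \<in> space \<sigma>"
    show "(\<integral>\<^sup>+\<beta>. (\<integral>\<^sup>+\<alpha>. indicator A (exchange i j \<beta> \<eta>, exchange i j \<alpha> \<eta>)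
      \<partial>unit_lebesgue) \<partial>unit_lebesgue) = (\<integral>\<^sup>+\<alpha>. (\<integral>\<^sup>+\<beta>. indicator A (exchange i j \<beta> \<eta>, exchange i j \<alpha> \<eta>)
      \<partial>unit_lebesgue) \<partial>unit_lebesgue)"
      by (rule UU.Fubini'[symmetric]) measurable
  qed
  also have "\<dots> = (\<integral>\<^sup>+\<eta>. (\<integral>\<^sup>+\<alpha>. indicator A (exchange i j \<alpha> \<eta>, \<eta>) \<partial>unit_lebesgue) \<partial>\<sigma>)"
    using swap[of "\<lambda>p. indicator A (snd p, fst p)"] by simp
  also have "\<dots> = (\<integral>\<^sup>+p. indicator A (exchange i j (snd p) (fst p), fst p) \<partial>Q)"
    by (subst nn_integral_Q) simp_all
  also have "\<dots> = (\<integral>\<^sup>+p. indicator A p \<partial>distr Q (\<sigma> \<Otimes>\<^sub>M \<sigma>) (\<lambda>p. (exchange i j (snd p) (fst p), fst p)))"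
    by (rule nn_integral_distr[symmetric]) measurable
  also have "\<dots> = emeasure (distr Q (\<sigma> \<Otimes>\<^sub>M \<sigma>) (\<lambda>p. (exchange i j (snd p) (fst p), fst p))) A"
    by simp
  finally show "emeasure (distr Q (\<sigma> \<Otimes>\<^sub>M \<sigma>) (\<lambda>p. (fst p, exchange i j (snd p) (fst p)))) A
      = emeasure (distr Q (\<sigma> \<Otimes>\<^sub>M \<sigma>) (\<lambda>p. (exchange i j (snd p) (fst p), fst p))) A" .
qed simp

section \<open>Exchange energies and the Dirichlet form\<close>

sublocale sigma: prob_space \<sigma> by (rule prob_space_sigma)
sublocale Q: pair_prob_space \<sigma> unit_lebesgue ..

abbreviation moved :: "nat \<Rightarrow> nat \<Rightarrow> (nat \<Rightarrow> real) \<times> real \<Rightarrow> (nat \<Rightarrow> real)" where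
  "moved i j p \<equiv> exchange i j (snd p) (fst p)"

definition distinct_sites :: "nat \<Rightarrow> nat \<Rightarrow> bool" where
  "distinct_sites i j \<longleftrightarrow> i \<in> {1..N} \<and> j \<in> {1..N} \<and> i \<noteq> j"

lemma distinct_sitesD: "distinct_sites i j \<Longrightarrow> i \<in> {1..N}" "distinct_sites i j \<Longrightarrow> j \<in> {1..N}" "distinct_sites i j \<Longrightarrow> i \<noteq> j"
  by (auto simp: distinct_sites_def)

lemma distinct_sites_sym: "distinct_sites i j \<Longrightarrow> distinct_sites j i"
  by (auto simp: distinct_sites_def)

lemma measurable_moved: "distinct_sites i j \<Longrightarrow> (\<lambda>p. moved i j p) \<in> measurable Q \<sigma>"
  by (auto simp: distinct_sites_def intro: measurable_exchange)

lemma moved_in_simplex: "distinct_sites i j \<Longrightarrow> p \<in> space Q \<Longrightarrow> moved i j p \<in> S"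
  by (auto simp: distinct_sites_def space_pair_measure intro!: exchange_in_simplex)

lemma fst_in_simplex: "p \<in> space Q \<Longrightarrow> fst p \<in> S"
  by (auto simp: space_pair_measure)

lemma distr_fst: "distr Q \<sigma> fst = \<sigma>"
  by (rule unit.distr_pair_fst)

lemma distr_moved:
  assumes ij: "distinct_sites i j"
  shows "distr Q \<sigma> (moved i j) = \<sigma>"
proof (rule measure_eqI)
  fix A assume "A \<in> sets (distr Q \<sigma> (moved i j))"
  then have A: "A \<in> sets \<sigma>" by simp
  have "emeasure (distr Q \<sigma> (moved i j)) A = (\<integral>\<^sup>+p. indicator A (moved i j p) \<partial>Q)"
    using A nn_integral_distr[OF measurable_moved[OF ij], of "indicator A"] by simp
  also have "\<dots> = (\<integral>\<^sup>+\<eta>. (\<integral>\<^sup>+\<alpha>. indicator A (exchange i j \<alpha> \<eta>) \<partial>unit_lebesgue) \<partial>\<sigma>)"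
    using A by (subst nn_integral_Q) (auto intro: measurable_compose[OF measurable_moved[OF ij]])
  also have "\<dots> = (\<integral>\<^sup>+\<eta>. indicator A \<eta> \<partial>\<sigma>)"
    using A by (intro nn_integral_exchange distinct_sitesD[OF ij]) simp
  finally show "emeasure (distr Q \<sigma> (moved i j)) A = emeasure \<sigma> A" using A by simp
qed simp

lemma integral_fst: "g \<in> borel_measurable \<sigma> \<Longrightarrow> (LINT p|Q. g (fst p)) = (LINT \<eta>|\<sigma>. g \<eta>)"
  for g :: "_ \<Rightarrow> real"
  using integral_distr[OF measurable_fst, of g \<sigma> unit_lebesgue] by (simp add: distr_fst)

lemma integral_moved:
  "distinct_sites i j \<Longrightarrow> g \<in> borel_measurable \<sigma> \<Longrightarrow> (LINT p|Q. g (moved i j p)) = (LINT \<eta>|\<sigma>. g \<eta>)"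
  for g :: "_ \<Rightarrow> real"
  using integral_distr[OF measurable_moved, of i j g] by (simp add: distr_moved)

lemma integrable_fst: "integrable \<sigma> g \<Longrightarrow> integrable Q (\<lambda>p. g (fst p))" for g :: "_ \<Rightarrow> real"
  using integrable_distr_eq[OF measurable_fst, of g \<sigma> unit_lebesgue] by (simp add: distr_fst)

lemma integrable_moved: "distinct_sites i j \<Longrightarrow> integrable \<sigma> g \<Longrightarrow> integrable Q (\<lambda>p. g (moved i j p))"
  for g :: "_ \<Rightarrow> real"
  using integrable_distr_eq[OF measurable_moved, of i j g] by (simp add: distr_moved)

lemma square_integrable_fst: "square_integrable \<sigma> f \<Longrightarrow> square_integrable Q (\<lambda>p. f (fst p))"
  unfolding square_integrable_def
  using integrable_fst[of "\<lambda>\<eta>. (f \<eta>)\<^sup>2"] by (auto intro: measurable_compose[OF measurable_fst])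

lemma square_integrable_moved:
  "distinct_sites i j \<Longrightarrow> square_integrable \<sigma> f \<Longrightarrow> square_integrable Q (\<lambda>p. f (moved i j p))"
  unfolding square_integrable_def
  using integrable_moved[of i j "\<lambda>\<eta>. (f \<eta>)\<^sup>2"] by (auto intro: measurable_compose[OF measurable_moved])

lemma integral_exchangeable:
  fixes F :: "(nat \<Rightarrow> real) \<Rightarrow> (nat \<Rightarrow> real) \<Rightarrow> real"
  assumes ij: "distinct_sites i j" and F: "(\<lambda>(\<eta>, \<xi>). F \<eta> \<xi>) \<in> borel_measurable (\<sigma> \<Otimes>\<^sub>M \<sigma>)"
  shows "(LINT p|Q. F (fst p) (moved i j p)) = (LINT p|Q. F (moved i j p) (fst p))"
proof -
  note [measurable] = measurable_moved[OF ij]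
  have "(LINT p|Q. F (fst p) (moved i j p))
      = (LINT q|distr Q (\<sigma> \<Otimes>\<^sub>M \<sigma>) (\<lambda>p. (fst p, moved i j p)). case_prod F q)"
    by (subst integral_distr[OF _ F]) simp_all
  also have "\<dots> = (LINT q|distr Q (\<sigma> \<Otimes>\<^sub>M \<sigma>) (\<lambda>p. (moved i j p, fst p)). case_prod F q)"
    using exchangeable[of i j] ij by (simp add: distinct_sites_def)
  also have "\<dots> = (LINT p|Q. F (moved i j p) (fst p))"
    by (subst integral_distr[OF _ F]) simp_all
  finally show ?thesis .
qed

lemma integrable_exchangeable:
  fixes F :: "(nat \<Rightarrow> real) \<Rightarrow> (nat \<Rightarrow> real) \<Rightarrow> real"
  assumes ij: "distinct_sites i j" and F: "(\<lambda>(\<eta>, \<xi>). F \<eta> \<xi>) \<in> borel_measurable (\<sigma> \<Otimes>\<^sub>M \<sigma>)"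
    and int: "integrable Q (\<lambda>p. F (moved i j p) (fst p))"
  shows "integrable Q (\<lambda>p. F (fst p) (moved i j p))"
proof -
  note [measurable] = measurable_moved[OF ij]
  have "integrable (distr Q (\<sigma> \<Otimes>\<^sub>M \<sigma>) (\<lambda>p. (moved i j p, fst p))) (case_prod F)"
    using int by (subst integrable_distr_eq[OF _ F]) simp_all
  then have "integrable (distr Q (\<sigma> \<Otimes>\<^sub>M \<sigma>) (\<lambda>p. (fst p, moved i j p))) (case_prod F)"
    using exchangeable[of i j] ij by (simp add: distinct_sites_def)
  then show ?thesis by (subst (asm) integrable_distr_eq[OF _ F]) simp_all
qed

text \<open>Rates and Lyapunov functions are bounded on the simplex, which makes all integrals against squares
of Hilbert space elements finite.\<close>

definition bounded_weight :: "((nat \<Rightarrow> real) \<Rightarrow> real) \<Rightarrow> bool" where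
  "bounded_weight w \<longleftrightarrow> w \<in> borel_measurable \<sigma> \<and> (\<exists>B. \<forall>\<eta>\<in>S. \<bar>w \<eta>\<bar> \<le> B)"

lemma bounded_weightI:
  assumes "w \<in> borel_measurable \<sigma>" "\<And>\<eta>. \<eta> \<in> S \<Longrightarrow> \<bar>w \<eta>\<bar> \<le> B"
  shows "bounded_weight w"
  using assms by (auto simp: bounded_weight_def)

lemma bounded_const: "bounded_weight (\<lambda>_. c)"
  by (rule bounded_weightI[where B="\<bar>c\<bar>"]) simp_all

lemma bounded_weight_add:
  assumes v: "bounded_weight v" and w: "bounded_weight w"
  shows "bounded_weight (\<lambda>\<eta>. v \<eta> + w \<eta>)"
proof -
  obtain B C where "\<forall>\<eta>\<in>S. \<bar>v \<eta>\<bar> \<le> B" "\<forall>\<eta>\<in>S. \<bar>w \<eta>\<bar> \<le> C"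
    using v w unfolding bounded_weight_def by blast
  then have "\<forall>\<eta>\<in>S. \<bar>v \<eta> + w \<eta>\<bar> \<le> B + C"
    by (meson abs_triangle_ineq add_mono order_trans)
  then show ?thesis using v w unfolding bounded_weight_def by (auto intro: borel_measurable_add)
qed

lemma bounded_weight_scale: "bounded_weight w \<Longrightarrow> bounded_weight (\<lambda>\<eta>. c * w \<eta>)"
  unfolding bounded_weight_def by (auto simp: abs_mult intro!: exI[of _ "\<bar>c\<bar> * _"] mult_left_mono)

lemma bounded_weight_sum:
  "(\<And>k. k \<in> K \<Longrightarrow> bounded_weight (w k)) \<Longrightarrow> bounded_weight (\<lambda>\<eta>. \<Sum>k\<in>K. w k \<eta>)"
  by (induction K rule: infinite_finite_induct) (simp_all add: bounded_const bounded_weight_add)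

lemma bounded_weight_measurable: "bounded_weight w \<Longrightarrow> w \<in> borel_measurable \<sigma>"
  by (simp add: bounded_weight_def)

lemma bounded_weight_square_integrable: "bounded_weight w \<Longrightarrow> square_integrable \<sigma> w"
  unfolding bounded_weight_def using sigma.square_integrable_bounded[of w] by auto

lemma integrable_weighted:
  assumes w: "bounded_weight w" and F: "integrable Q F"
  shows "integrable Q (\<lambda>p. w (fst p) * F p :: real)"
proof -
  obtain B where B: "\<forall>\<eta>\<in>S. \<bar>w \<eta>\<bar> \<le> B" using w by (auto simp: bounded_weight_def)
  show ?thesis
    by (rule bounded_mult_integrable[OF F, where B=B])
       (use B w fst_in_simplex in \<open>auto simp: bounded_weight_def intro: measurable_compose[OF measurable_fst]\<close>)
qed

lemma square_integrable_weighted: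
  assumes w: "bounded_weight w" and f: "square_integrable \<sigma> f"
  shows "square_integrable \<sigma> (\<lambda>\<eta>. w \<eta> * f \<eta>)"
proof -
  obtain B where B: "\<forall>\<eta>\<in>S. \<bar>w \<eta>\<bar> \<le> B" using w by (auto simp: bounded_weight_def)
  show ?thesis
    by (rule square_integrable_bounded_mult[OF f, where B=B]) (use B w in \<open>auto simp: bounded_weight_def\<close>)
qed

text \<open>For a weight that the exchange preserves, this is twice the integral of the weighted conditional
variance of f given all coordinates other than i and j.\<close>

definition energy :: "((nat \<Rightarrow> real) \<Rightarrow> real) \<Rightarrow> nat \<Rightarrow> nat \<Rightarrow> ((nat \<Rightarrow> real) \<Rightarrow> real) \<Rightarrow> real" where
  "energy w i j f = (LINT p|Q. w (fst p) * (f (fst p) - f (moved i j p))\<^sup>2)"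

lemma integrable_increment:
  assumes "distinct_sites i j" "square_integrable \<sigma> f"
  shows "integrable Q (\<lambda>p. (f (fst p) - f (moved i j p))\<^sup>2)"
  using assms
  by (intro square_integrable_square square_integrable_diff square_integrable_fst square_integrable_moved)

lemma integrable_energy:
  assumes "distinct_sites i j" "bounded_weight w" "square_integrable \<sigma> f"
  shows "integrable Q (\<lambda>p. w (fst p) * (f (fst p) - f (moved i j p))\<^sup>2)"
  using assms by (intro integrable_weighted integrable_increment)

lemma energy_mono:
  assumes "distinct_sites i j" "square_integrable \<sigma> f" "bounded_weight v" "bounded_weight w"
    and "\<And>\<eta>. \<eta> \<in> S \<Longrightarrow> v \<eta> \<le> w \<eta>"
  shows "energy v i j f \<le> energy w i j f"
  unfolding energy_def
  by (intro integral_mono integrable_energy assms mult_right_mono fst_in_simplex) simp_all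

lemma energy_nonneg:
  assumes "\<And>\<eta>. \<eta> \<in> S \<Longrightarrow> 0 \<le> w \<eta>"
  shows "0 \<le> energy w i j f"
  unfolding energy_def using assms fst_in_simplex by (intro Bochner_Integration.integral_nonneg_AE AE_I2) auto

lemma energy_scale: "energy (\<lambda>\<eta>. c * w \<eta>) i j f = c * energy w i j f"
  by (simp add: energy_def mult.assoc)

text \<open>Symmetrise the integrand over the exchangeable pair.\<close>

lemma energy_half:
  assumes ij: "distinct_sites i j" and w: "bounded_weight w" and f: "square_integrable \<sigma> f"
    and inv: "\<And>\<alpha> \<eta>. w (exchange i j \<alpha> \<eta>) = w \<eta>"
  shows "(LINT p|Q. w (fst p) * (f (fst p) * (f (fst p) - f (moved i j p)))) = energy w i j f / 2"
    and "integrable Q (\<lambda>p. w (fst p) * (f (fst p) * (f (fst p) - f (moved i j p))))"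
proof -
  let ?A = "\<lambda>p. w (fst p) * (f (fst p) * (f (fst p) - f (moved i j p)))"
  let ?B = "\<lambda>p. w (fst p) * (f (moved i j p) * (f (moved i j p) - f (fst p)))"
  note ff = square_integrable_fst[OF f] square_integrable_moved[OF ij f]
  have A: "integrable Q ?A" and B: "integrable Q ?B"
    by (intro integrable_weighted w square_integrable_mult square_integrable_diff ff)+
  note [measurable] = bounded_weight_measurable[OF w] square_integrable_measurable[OF f]
  have "(LINT p|Q. ?A p) = (LINT p|Q. w (moved i j p) * (f (moved i j p) * (f (moved i j p) - f (fst p))))"
    by (rule integral_exchangeable[OF ij, of "\<lambda>\<eta> \<xi>. w \<eta> * (f \<eta> * (f \<eta> - f \<xi>))"]) measurable
  then have eq: "(LINT p|Q. ?A p) = (LINT p|Q. ?B p)" by (simp add: inv)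
  have "energy w i j f = (LINT p|Q. ?A p + ?B p)"
    unfolding energy_def
    by (intro Bochner_Integration.integral_cong) (simp_all add: power2_eq_square algebra_simps)
  also have "\<dots> = (LINT p|Q. ?A p) + (LINT p|Q. ?B p)" using A B by simp
  finally show "(LINT p|Q. ?A p) = energy w i j f / 2" using eq by simp
  show "integrable Q ?A" by (rule A)
qed

lemma pair_average_unit: "pair_average i j f \<eta> = (LINT \<alpha>|unit_lebesgue. f (exchange i j \<alpha> \<eta>))"
  by (simp add: pair_average_def integral_unit_lebesgue)

lemma measurable_pair_average:
  assumes "distinct_sites i j" "f \<in> borel_measurable \<sigma>"
  shows "pair_average i j f \<in> borel_measurable \<sigma>"
proof -
  have "(\<lambda>(\<eta>, \<alpha>). f (exchange i j \<alpha> \<eta>)) \<in> borel_measurable Q"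
    using measurable_compose[OF measurable_moved[OF assms(1)] assms(2)] by (simp add: case_prod_beta)
  then show ?thesis
    using unit.borel_measurable_lebesgue_integral[of "\<lambda>\<eta> \<alpha>. f (exchange i j \<alpha> \<eta>)" \<sigma>]
    by (simp add: pair_average_unit[abs_def])
qed

text \<open>Fubini. The inner integrand is integrable only for almost every configuration, since an arbitrary
representative need not be integrable along every exchange.\<close>

lemma integral_against_increment:
  assumes ij: "distinct_sites i j" and w: "bounded_weight w" and f: "square_integrable \<sigma> f"
  shows "(LINT \<eta>|\<sigma>. w \<eta> * (f \<eta> * (f \<eta> - pair_average i j f \<eta>)))
       = (LINT p|Q. w (fst p) * (f (fst p) * (f (fst p) - f (moved i j p))))" (is ?eq)
    and "integrable \<sigma> (\<lambda>\<eta>. w \<eta> * (f \<eta> * (f \<eta> - pair_average i j f \<eta>)))" (is ?int)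
proof -
  let ?A = "\<lambda>p. w (fst p) * (f (fst p) * (f (fst p) - f (moved i j p)))"
  note ff = square_integrable_fst[OF f] square_integrable_moved[OF ij f]
  have A: "integrable Q ?A"
    by (intro integrable_weighted w square_integrable_mult square_integrable_diff ff)
  note [measurable] = bounded_weight_measurable[OF w] square_integrable_measurable[OF f]
    measurable_pair_average[OF ij square_integrable_measurable[OF f]]
  have "integrable Q (\<lambda>p. f (moved i j p))"
    using integrable_moved[OF ij sigma.square_integrable_integrable[OF f]] .
  from Q.AE_integrable_fst'[OF this]
  have ae: "AE \<eta> in \<sigma>. (\<integral>\<alpha>. ?A (\<eta>, \<alpha>) \<partial>unit_lebesgue) = w \<eta> * (f \<eta> * (f \<eta> - pair_average i j f \<eta>))"
    by eventually_elim (simp add: pair_average_unit unit.prob_space[simplified])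
  have m: "(\<lambda>\<eta>. \<integral>\<alpha>. ?A (\<eta>, \<alpha>) \<partial>unit_lebesgue) \<in> borel_measurable \<sigma>"
    by (rule borel_measurable_integrable[OF Q.integrable_fst'[OF A]])
  show ?int
    using integrable_cong_AE[OF m _ ae] Q.integrable_fst'[OF A] by simp
  show ?eq
    using integral_cong_AE[OF m _ ae] Q.integral_fst'[OF A] by simp
qed

definition pair_rate :: "real \<Rightarrow> nat \<Rightarrow> nat \<Rightarrow> (nat \<Rightarrow> real) \<Rightarrow> real" where
  "pair_rate \<gamma> i j \<eta> = (\<eta> i + \<eta> j) powr \<gamma>"

lemma pair_rate_exchange: "distinct_sites i j \<Longrightarrow> pair_rate \<gamma> i j (exchange i j \<alpha> \<eta>) = pair_rate \<gamma> i j \<eta>"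
  by (simp add: pair_rate_def exchange_pair_sum distinct_sitesD)

lemma bounded_pair_rate:
  assumes "distinct_sites i j" "0 \<le> \<gamma>"
  shows "bounded_weight (pair_rate \<gamma> i j)"
proof (rule bounded_weightI)
  show "pair_rate \<gamma> i j \<in> borel_measurable \<sigma>"
    unfolding pair_rate_def[abs_def] by measurable
  fix \<eta> assume "\<eta> \<in> S"
  then have "0 \<le> \<eta> i + \<eta> j" "\<eta> i + \<eta> j \<le> 2 * real N"
    using simplex_coordinate[of \<eta> i] simplex_coordinate[of \<eta> j] assms(1) by (auto simp: distinct_sites_def)
  then have "(\<eta> i + \<eta> j) powr \<gamma> \<le> (2 * real N) powr \<gamma>" using assms(2) by (intro powr_mono2)
  then show "\<bar>pair_rate \<gamma> i j \<eta>\<bar> \<le> (2 * real N) powr \<gamma>" by (simp add: pair_rate_def)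
qed

text \<open>Interchanging i and j amounts to replacing \<open>\<alpha>\<close> by \<open>1 - \<alpha>\<close>.\<close>

lemma energy_swap:
  assumes ij: "distinct_sites i j" and w: "bounded_weight w" and f: "square_integrable \<sigma> f"
  shows "energy w j i f = energy w i j f"
proof -
  have fubini: "energy w i j f
      = (LINT \<eta>|\<sigma>. (LINT \<alpha>|unit_lebesgue. w \<eta> * (f \<eta> - f (exchange i j \<alpha> \<eta>))\<^sup>2))" if "distinct_sites i j" for i j
    using Q.integral_fst'[OF integrable_energy[OF that w f]] by (simp add: energy_def)
  have "(LINT \<alpha>|unit_lebesgue. w \<eta> * (f \<eta> - f (exchange i j \<alpha> \<eta>))\<^sup>2)
      = (LINT \<alpha>|unit_lebesgue. w \<eta> * (f \<eta> - f (exchange j i \<alpha> \<eta>))\<^sup>2)" for \<eta>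
    unfolding exchange_commute[OF distinct_sitesD(3)[OF ij]]
    by (rule integral_unit_reflect[of "\<lambda>\<alpha>. w \<eta> * (f \<eta> - f (exchange j i \<alpha> \<eta>))\<^sup>2"])
  then show ?thesis
    unfolding fubini[OF ij] fubini[OF distinct_sites_sym[OF ij]] by (simp only:)
qed

text \<open>Sums run over ordered pairs, which makes double sums over particles factorise; every
unordered pair is counted twice.\<close>

definition total_energy ::
  "(nat \<Rightarrow> nat \<Rightarrow> (nat \<Rightarrow> real) \<Rightarrow> real) \<Rightarrow> ((nat \<Rightarrow> real) \<Rightarrow> real) \<Rightarrow> real" where
  "total_energy w f = (\<Sum>i=1..N. \<Sum>j\<in>{1..N} - {i}. energy (w i j) i j f)"

lemma sum_off_diagonal:
  fixes T :: "nat \<Rightarrow> nat \<Rightarrow> real"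
  assumes sym: "\<And>i j. distinct_sites i j \<Longrightarrow> T j i = T i j"
  shows "(\<Sum>i=1..N. \<Sum>j\<in>{1..N} - {i}. T i j) = 2 * (\<Sum>(i, j)\<in>{(i, j). 1 \<le> i \<and> i < j \<and> j \<le> N}. T i j)"
proof -
  let ?I = "{(i, j). 1 \<le> i \<and> i < j \<and> j \<le> N}"
  have fin: "finite ?I" by (rule finite_subset[of _ "{1..N} \<times> {1..N}"]) auto
  have "(\<Sum>i=1..N. \<Sum>j\<in>{1..N} - {i}. T i j) = (\<Sum>(i, j)\<in>Sigma {1..N} (\<lambda>i. {1..N} - {i}). T i j)"
    by (rule sum.Sigma) auto
  also have "Sigma {1..N} (\<lambda>i. {1..N} - {i}) = ?I \<union> prod.swap ` ?I"
    by (auto simp: image_iff)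
  also have "(\<Sum>(i, j)\<in>?I \<union> prod.swap ` ?I. T i j)
      = (\<Sum>(i, j)\<in>?I. T i j) + (\<Sum>(i, j)\<in>prod.swap ` ?I. T i j)"
    by (rule sum.union_disjoint) (use fin in auto)
  also have "(\<Sum>(i, j)\<in>prod.swap ` ?I. T i j) = (\<Sum>(i, j)\<in>?I. T j i)"
    by (subst sum.reindex) (auto intro!: inj_onI sum.cong)
  also have "\<dots> = (\<Sum>(i, j)\<in>?I. T i j)"
    by (intro sum.cong) (auto simp: distinct_sites_def intro!: sym)
  finally show ?thesis by simp
qed

text \<open>The factor \<open>N / (N choose 2) = 2 / (N - 1)\<close> of the generator is divided by 2 for the
symmetrisation of the quadratic form and by 2 for the passage to ordered pairs.\<close>

lemma dirichlet_form_eq: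
  assumes \<gamma>: "0 \<le> \<gamma>" and f: "square_integrable \<sigma> f"
  shows "dirichlet_form \<gamma> N f = total_energy (pair_rate \<gamma>) f / (2 * (real N - 1))"
proof -
  let ?I = "{(i, j). 1 \<le> i \<and> i < j \<and> j \<le> N}"
  let ?c = "real N * inverse (real (N choose 2))"
  let ?T = "\<lambda>q \<eta>. pair_rate \<gamma> (fst q) (snd q) \<eta> * (f \<eta> * (f \<eta> - pair_average (fst q) (snd q) f \<eta>))"
  have distinct_sites: "distinct_sites (fst q) (snd q)" if "q \<in> ?I" for q
    using that by (auto simp: distinct_sites_def)
  have T: "integrable \<sigma> (?T q)" "(LINT \<eta>|\<sigma>. ?T q \<eta>) = energy (pair_rate \<gamma> (fst q) (snd q)) (fst q) (snd q) f / 2"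
    if "q \<in> ?I" for q
    using integral_against_increment[OF distinct_sites[OF that] bounded_pair_rate[OF distinct_sites[OF that] \<gamma>] f]
      energy_half(1)[OF distinct_sites[OF that] bounded_pair_rate[OF distinct_sites[OF that] \<gamma>] f
        pair_rate_exchange[OF distinct_sites[OF that]]]
    by auto
  have "f \<eta> * generator \<gamma> N f \<eta> = - (?c * (\<Sum>q\<in>?I. ?T q \<eta>))" for \<eta>
    unfolding generator_def pair_rate_def
    by (simp add: sum_distrib_left case_prod_beta mult.left_commute mult.assoc)
  then have "dirichlet_form \<gamma> N f = (LINT \<eta>|\<sigma>. ?c * (\<Sum>q\<in>?I. ?T q \<eta>))"
    by (simp add: dirichlet_form_def L2_inner_def)
  also have "\<dots> = ?c * (\<Sum>q\<in>?I. energy (pair_rate \<gamma> (fst q) (snd q)) (fst q) (snd q) f / 2)"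
  proof -
    have "(LINT \<eta>|\<sigma>. (\<Sum>q\<in>?I. ?T q \<eta>)) = (\<Sum>q\<in>?I. (LINT \<eta>|\<sigma>. ?T q \<eta>))"
      by (rule Bochner_Integration.integral_sum) (rule T(1))
    also have "\<dots> = (\<Sum>q\<in>?I. energy (pair_rate \<gamma> (fst q) (snd q)) (fst q) (snd q) f / 2)"
      by (intro sum.cong refl T(2))
    finally show ?thesis by simp
  qed
  also have "\<dots> = ?c * (total_energy (pair_rate \<gamma>) f / 2 / 2)"
  proof -
    have "energy (pair_rate \<gamma> j i) j i f = energy (pair_rate \<gamma> i j) i j f" if "distinct_sites i j" for i j
      using energy_swap[OF that bounded_pair_rate[OF that \<gamma>] f]
      by (simp add: pair_rate_def[abs_def] add.commute)
    from sum_off_diagonal[of "\<lambda>i j. energy (pair_rate \<gamma> i j) i j f", OF this]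
    show ?thesis
      by (simp add: total_energy_def case_prod_beta sum_divide_distrib[symmetric])
  qed
  also have "?c = 2 / (real N - 1)"
  proof -
    have "real (N choose 2) = real N * (real N - 1) / 2"
      using N_ge_2 by (simp add: choose_two real_of_nat_div of_nat_diff)
    then show ?thesis using N_ge_2 by (simp add: field_simps)
  qed
  finally show ?thesis using N_ge_2 by (simp add: field_simps)
qed

end

section \<open>Spectral gap at constant rates: Lipschitz functions\<close>

text \<open>The ratios \<open>b (Suc n) / b n\<close> of a log-convex sequence increase, so the first one is at most the
asymptotic one. For \<open>b n\<close> the squared norm of the n-th iterate of a self-adjoint operator, this
turns decay with an uncontrolled constant into a bound on the norm of a single step.\<close>

lemma log_convex_ratio_bound:
  fixes b :: "nat \<Rightarrow> real"
  assumes nonneg: "\<And>n. 0 \<le> b n" and conv: "\<And>n. (b (Suc n))\<^sup>2 \<le> b n * b (Suc (Suc n))"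
    and decay: "\<And>n. b n \<le> C * \<rho> ^ n" and \<rho>: "0 < \<rho>"
  shows "b 1 \<le> \<rho> * b 0"
proof (cases "b 1 = 0")
  case True
  then show ?thesis using nonneg[of 0] \<rho> by simp
next
  case False
  then have b1: "0 < b 1" using nonneg[of 1] by simp
  have b0: "0 < b 0"
  proof (rule ccontr)
    assume "\<not> 0 < b 0"
    then have "b 0 = 0" using nonneg[of 0] by simp
    then show False using conv[of 0] b1 by (simp add: One_nat_def)
  qed
  define r where "r = b 1 / b 0"
  have r: "0 < r" using b0 b1 by (simp add: r_def)
  have step: "0 < b n \<and> r * b n \<le> b (Suc n)" for n
  proof (induction n)
    case 0
    then show ?case using b0 by (simp add: r_def One_nat_def)
  next
    case (Suc n)
    then have pos: "0 < b n" "0 < b (Suc n)" using r by (auto intro: less_le_trans[OF mult_pos_pos])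
    have "r * b (Suc n) * b n \<le> b (Suc n) * b (Suc n)" using Suc pos by simp
    also have "\<dots> \<le> b (Suc (Suc n)) * b n" using conv[of n] by (simp add: power2_eq_square mult.commute)
    finally show ?case using pos by simp
  qed
  have lower: "b 0 * r ^ n \<le> b n" for n
  proof (induction n)
    case (Suc n)
    have "b 0 * r ^ Suc n = r * (b 0 * r ^ n)" by simp
    also have "\<dots> \<le> r * b n" using Suc r by simp
    also have "\<dots> \<le> b (Suc n)" using step by simp
    finally show ?case .
  qed simp
  have "r \<le> \<rho>"
  proof (rule ccontr)
    assume "\<not> r \<le> \<rho>"
    then have "1 < r / \<rho>" using \<rho> by simp
    then obtain n where n: "C / b 0 < (r / \<rho>) ^ n" using real_arch_pow by blast
    have "b 0 * r ^ n \<le> C * \<rho> ^ n" using lower[of n] decay[of n] by simp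
    then have "(r / \<rho>) ^ n \<le> C / b 0" using b0 \<rho> by (simp add: power_divide field_simps)
    then show False using n by simp
  qed
  then show ?thesis using b0 by (simp add: r_def field_simps)
qed

context exchange_model
begin

definition sqdist :: "(nat \<Rightarrow> real) \<Rightarrow> (nat \<Rightarrow> real) \<Rightarrow> real" where
  "sqdist \<eta> \<xi> = (\<Sum>k=1..N. (\<eta> k - \<xi> k)\<^sup>2)"

text \<open>The constant L is the square of the usual Lipschitz constant for the Euclidean distance: the coupling
contracts mean squares.\<close>

definition sq_lipschitz :: "real \<Rightarrow> ((nat \<Rightarrow> real) \<Rightarrow> real) \<Rightarrow> bool" where
  "sq_lipschitz L f \<longleftrightarrow> f \<in> borel_measurable \<sigma> \<and> (\<forall>\<eta>\<in>S. \<forall>\<xi>\<in>S. (f \<eta> - f \<xi>)\<^sup>2 \<le> L * sqdist \<eta> \<xi>)"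

lemma sq_lipschitzD:
  "sq_lipschitz L f \<Longrightarrow> f \<in> borel_measurable \<sigma>"
  "sq_lipschitz L f \<Longrightarrow> \<eta> \<in> S \<Longrightarrow> \<xi> \<in> S \<Longrightarrow> (f \<eta> - f \<xi>)\<^sup>2 \<le> L * sqdist \<eta> \<xi>"
  by (auto simp: sq_lipschitz_def)

lemma sqdist_nonneg: "0 \<le> sqdist \<eta> \<xi>"
  by (simp add: sqdist_def sum_nonneg)

lemma sqdist_le:
  assumes "\<eta> \<in> S" "\<xi> \<in> S"
  shows "sqdist \<eta> \<xi> \<le> real N ^ 3"
proof -
  have "sqdist \<eta> \<xi> \<le> (\<Sum>k=1..N. (real N)\<^sup>2)"
    unfolding sqdist_def
  proof (rule sum_mono)
    fix k assume "k \<in> {1..N}"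
    then have "\<bar>\<eta> k - \<xi> k\<bar> \<le> real N"
      using simplex_coordinate[OF assms(1)] simplex_coordinate[OF assms(2)] by (smt (verit))
    then show "(\<eta> k - \<xi> k)\<^sup>2 \<le> (real N)\<^sup>2" using power_mono[of "\<bar>\<eta> k - \<xi> k\<bar>" "real N" 2] by simp
  qed
  then show ?thesis by (simp add: power3_eq_cube power2_eq_square mult.assoc)
qed

lemma simplex_nonempty: "S \<noteq> {}"
  using sigma.not_empty by simp

lemma bounded_sq_lipschitz:
  assumes f: "sq_lipschitz L f"
  shows "bounded_weight f"
proof -
  obtain \<eta>0 where \<eta>0: "\<eta>0 \<in> S" using simplex_nonempty by auto
  show ?thesis
  proof (rule bounded_weightI)
    show "f \<in> borel_measurable \<sigma>" by (rule sq_lipschitzD[OF f])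
    fix \<eta> assume \<eta>: "\<eta> \<in> S"
    have "(f \<eta> - f \<eta>0)\<^sup>2 \<le> \<bar>L\<bar> * real N ^ 3"
    proof -
      have "(f \<eta> - f \<eta>0)\<^sup>2 \<le> L * sqdist \<eta> \<eta>0" by (rule sq_lipschitzD(2)[OF f \<eta> \<eta>0])
      also have "\<dots> \<le> \<bar>L\<bar> * sqdist \<eta> \<eta>0" by (simp add: mult_right_mono sqdist_nonneg)
      also have "\<dots> \<le> \<bar>L\<bar> * real N ^ 3" by (intro mult_left_mono sqdist_le \<eta> \<eta>0) simp
      finally show ?thesis .
    qed
    moreover have "\<bar>x\<bar> \<le> 1 + x\<^sup>2" for x :: real
      using zero_le_power2[of "\<bar>x\<bar> - 1"] by (simp add: power2_diff)
    ultimately have "\<bar>f \<eta> - f \<eta>0\<bar> \<le> 1 + \<bar>L\<bar> * real N ^ 3" by (smt (verit))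
    then show "\<bar>f \<eta>\<bar> \<le> \<bar>f \<eta>0\<bar> + 1 + \<bar>L\<bar> * real N ^ 3" by linarith
  qed
qed

definition pairs :: "(nat \<times> nat) set" where
  "pairs = Sigma {1..N} (\<lambda>i. {1..N} - {i})"

lemma sum_pairs: "(\<Sum>q\<in>pairs. T (fst q) (snd q)) = (\<Sum>i=1..N. \<Sum>j\<in>{1..N} - {i}. T i j)"
  unfolding pairs_def by (subst sum.Sigma) (auto simp: case_prod_beta)

lemma card_pairs: "real (card pairs) = real N * (real N - 1)"
proof -
  have "card pairs = (\<Sum>i=1..N. card ({1..N} - {i}))" by (simp add: pairs_def)
  also have "\<dots> = N * (N - 1)" by simp
  finally show ?thesis using N_ge_2 by (simp add: of_nat_diff)
qed

lemma card_pairs_pos: "0 < real (card pairs)"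
  using N_ge_2 by (simp only: card_pairs) simp

lemma pairs_sites: "q \<in> pairs \<Longrightarrow> distinct_sites (fst q) (snd q)"
  by (auto simp: pairs_def distinct_sites_def)

text \<open>One step of the discrete-time process that resamples a pair chosen uniformly at random.\<close>

definition mean_exchange :: "((nat \<Rightarrow> real) \<Rightarrow> real) \<Rightarrow> (nat \<Rightarrow> real) \<Rightarrow> real" where
  "mean_exchange f \<eta> = (\<Sum>q\<in>pairs. pair_average (fst q) (snd q) f \<eta>) / real (card pairs)"

lemma sqdist_exchange:
  assumes ij: "distinct_sites i j"
  shows "sqdist (exchange i j \<alpha> \<eta>) (exchange i j \<alpha> \<xi>)
    = sqdist \<eta> \<xi> - (\<eta> i - \<xi> i)\<^sup>2 - (\<eta> j - \<xi> j)\<^sup>2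
      + (\<alpha>\<^sup>2 + (1 - \<alpha>)\<^sup>2) * ((\<eta> i - \<xi> i) + (\<eta> j - \<xi> j))\<^sup>2"
proof -
  have split: "(\<Sum>k=1..N. z k) = z i + z j + (\<Sum>k\<in>{1..N} - {i} - {j}. z k)" for z :: "nat \<Rightarrow> real"
    using ij by (simp add: distinct_sites_def sum.remove[of "{1..N}" i] sum.remove[of "{1..N} - {i}" j])
  have rest: "(\<Sum>k\<in>{1..N} - {i} - {j}. (exchange i j \<alpha> \<eta> k - exchange i j \<alpha> \<xi> k)\<^sup>2)
      = (\<Sum>k\<in>{1..N} - {i} - {j}. (\<eta> k - \<xi> k)\<^sup>2)"
    by (intro sum.cong) (auto simp: exchange_def)
  show ?thesis
    unfolding sqdist_def split[of "\<lambda>k. (exchange i j \<alpha> \<eta> k - exchange i j \<alpha> \<xi> k)\<^sup>2"]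
      split[of "\<lambda>k. (\<eta> k - \<xi> k)\<^sup>2"] rest
    using distinct_sitesD(3)[OF ij] by (simp add: exchange_def power2_eq_square algebra_simps)
qed

lemma square_integrable_along_exchange:
  assumes ij: "distinct_sites i j" and f: "bounded_weight f" and \<eta>: "\<eta> \<in> S"
  shows "square_integrable unit_lebesgue (\<lambda>\<alpha>. f (exchange i j \<alpha> \<eta>))"
proof -
  obtain B where B: "\<forall>\<eta>\<in>S. \<bar>f \<eta>\<bar> \<le> B" using f by (auto simp: bounded_weight_def)
  have m: "(\<lambda>(\<eta>, \<alpha>). f (exchange i j \<alpha> \<eta>)) \<in> borel_measurable Q"
    using measurable_compose[OF measurable_moved[OF ij] bounded_weight_measurable[OF f]]
    by (simp add: case_prod_beta)
  show ?thesis
  proof (rule unit.square_integrable_bounded[where B=B])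
    show "(\<lambda>\<alpha>. f (exchange i j \<alpha> \<eta>)) \<in> borel_measurable unit_lebesgue"
      using measurable_Pair2[OF m, of \<eta>] \<eta> by simp
    show "\<And>\<alpha>. \<alpha> \<in> space unit_lebesgue \<Longrightarrow> \<bar>f (exchange i j \<alpha> \<eta>)\<bar> \<le> B"
      using B exchange_in_simplex[OF distinct_sitesD[OF ij] \<eta>] by simp
  qed
qed

text \<open>Synchronous coupling: both configurations are resampled with the same \<open>\<alpha>\<close>, and
\<open>\<alpha>\<^sup>2 + (1 - \<alpha>)\<^sup>2\<close> has mean 2/3.\<close>

lemma pair_average_contraction:
  assumes ij: "distinct_sites i j" and f: "sq_lipschitz L f" and \<eta>: "\<eta> \<in> S" and \<xi>: "\<xi> \<in> S"
  shows "(pair_average i j f \<eta> - pair_average i j f \<xi>)\<^sup>2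
    \<le> L * (sqdist \<eta> \<xi> - (\<eta> i - \<xi> i)\<^sup>2 - (\<eta> j - \<xi> j)\<^sup>2 + 2 / 3 * ((\<eta> i - \<xi> i) + (\<eta> j - \<xi> j))\<^sup>2)"
proof -
  note si = square_integrable_along_exchange[OF ij bounded_sq_lipschitz[OF f]]
  let ?d = "\<lambda>\<alpha>. f (exchange i j \<alpha> \<eta>) - f (exchange i j \<alpha> \<xi>)"
  let ?D = "sqdist \<eta> \<xi> - (\<eta> i - \<xi> i)\<^sup>2 - (\<eta> j - \<xi> j)\<^sup>2"
  let ?E = "((\<eta> i - \<xi> i) + (\<eta> j - \<xi> j))\<^sup>2"
  have d: "square_integrable unit_lebesgue ?d" by (intro square_integrable_diff si \<eta> \<xi>)
  have "pair_average i j f \<eta> - pair_average i j f \<xi> = (LINT \<alpha>|unit_lebesgue. ?d \<alpha>)"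
    unfolding pair_average_unit
    using unit.square_integrable_integrable[OF si[OF \<eta>]] unit.square_integrable_integrable[OF si[OF \<xi>]]
    by simp
  then have "(pair_average i j f \<eta> - pair_average i j f \<xi>)\<^sup>2 \<le> (LINT \<alpha>|unit_lebesgue. (?d \<alpha>)\<^sup>2)"
    using unit.square_of_mean_le[OF d] by simp
  also have "\<dots> \<le> (LINT \<alpha>|unit_lebesgue. L * ?D + L * ?E * (\<alpha>\<^sup>2 + (1 - \<alpha>)\<^sup>2))"
  proof (rule integral_mono)
    show "integrable unit_lebesgue (\<lambda>\<alpha>. (?d \<alpha>)\<^sup>2)" by (rule square_integrable_square[OF d])
    show "integrable unit_lebesgue (\<lambda>\<alpha>. L * ?D + L * ?E * (\<alpha>\<^sup>2 + (1 - \<alpha>)\<^sup>2))"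
      using unit_moments(2) by simp
    fix \<alpha> assume "\<alpha> \<in> space unit_lebesgue"
    then have "(?d \<alpha>)\<^sup>2 \<le> L * sqdist (exchange i j \<alpha> \<eta>) (exchange i j \<alpha> \<xi>)"
      by (intro sq_lipschitzD(2)[OF f] exchange_in_simplex distinct_sitesD[OF ij] \<eta> \<xi>) simp_all
    then show "(?d \<alpha>)\<^sup>2 \<le> L * ?D + L * ?E * (\<alpha>\<^sup>2 + (1 - \<alpha>)\<^sup>2)"
      by (simp add: sqdist_exchange[OF ij] algebra_simps)
  qed
  also have "\<dots> = L * ?D + L * ?E * (2 / 3)"
  proof -
    have "(LINT \<alpha>|unit_lebesgue. L * ?D + L * ?E * (\<alpha>\<^sup>2 + (1 - \<alpha>)\<^sup>2))
        = (LINT \<alpha>|unit_lebesgue. L * ?D) + (LINT \<alpha>|unit_lebesgue. L * ?E * (\<alpha>\<^sup>2 + (1 - \<alpha>)\<^sup>2))"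
      using unit_moments(2) by (intro Bochner_Integration.integral_add) simp_all
    also have "(LINT \<alpha>|unit_lebesgue. L * ?D) = L * ?D"
      using unit.prob_space by simp
    also have "(LINT \<alpha>|unit_lebesgue. L * ?E * (\<alpha>\<^sup>2 + (1 - \<alpha>)\<^sup>2)) = L * ?E * (2 / 3)"
      by (simp only: Bochner_Integration.integral_mult_right_zero unit_moments(1))
    finally show ?thesis .
  qed
  finally show ?thesis by (simp add: algebra_simps)
qed

text \<open>For a difference x of two configurations, the coordinates sum to zero. Therefore the mixed terms
\<open>x i * x j\<close> over distinct i and j add up to minus the sum of squares, which produces the
contraction.\<close>

lemma sum_pairs_quadratic:
  fixes x :: "nat \<Rightarrow> real"
  assumes "(\<Sum>k=1..N. x k) = 0"
  shows "(\<Sum>q\<in>pairs. D - (x (fst q))\<^sup>2 - (x (snd q))\<^sup>2 + 2 / 3 * (x (fst q) + x (snd q))\<^sup>2)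
    = real N * (real N - 1) * D - (2 * real N + 2) / 3 * (\<Sum>k=1..N. (x k)\<^sup>2)"
proof -
  let ?A = "\<Sum>k=1..N. (x k)\<^sup>2"
  let ?h = "\<lambda>i j. 4 / 3 * (x i * x j) - 1 / 3 * (x i)\<^sup>2 - 1 / 3 * (x j)\<^sup>2"
  have row: "(\<Sum>j\<in>{1..N} - {i}. ?h i j) = (\<Sum>j=1..N. ?h i j) - 2 / 3 * (x i)\<^sup>2" if "i \<in> {1..N}" for i
    using that by (simp add: sum_diff1 power2_eq_square)
  have full: "(\<Sum>j=1..N. ?h i j) = - real N / 3 * (x i)\<^sup>2 - 1 / 3 * ?A" for i
  proof -
    have "(\<Sum>j=1..N. ?h i j) = 4 / 3 * (x i * (\<Sum>j=1..N. x j)) - real N * (1 / 3 * (x i)\<^sup>2) - 1 / 3 * ?A"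
      by (simp only: sum_subtractf sum_distrib_left[symmetric] sum_constant card_atLeastAtMost diff_Suc_1
          Suc_eq_plus1 add_diff_cancel_right')
    then show ?thesis using assms by simp
  qed
  have "(\<Sum>q\<in>pairs. D - (x (fst q))\<^sup>2 - (x (snd q))\<^sup>2 + 2 / 3 * (x (fst q) + x (snd q))\<^sup>2)
      = (\<Sum>q\<in>pairs. D + ?h (fst q) (snd q))"
    by (intro sum.cong) (simp_all add: power2_eq_square algebra_simps)
  also have "\<dots> = real N * (real N - 1) * D + (\<Sum>q\<in>pairs. ?h (fst q) (snd q))"
    by (simp add: sum.distrib card_pairs)
  also have "(\<Sum>q\<in>pairs. ?h (fst q) (snd q)) = (\<Sum>i=1..N. \<Sum>j\<in>{1..N} - {i}. ?h i j)"
    by (rule sum_pairs)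
  also have "\<dots> = (\<Sum>i=1..N. - real N / 3 * (x i)\<^sup>2 - 1 / 3 * ?A - 2 / 3 * (x i)\<^sup>2)"
    by (intro sum.cong refl) (simp only: row full)
  also have "\<dots> = - real N / 3 * ?A - real N / 3 * ?A - 2 / 3 * ?A"
    by (simp add: sum_subtractf sum_distrib_left sum_negf)
  finally show ?thesis by (simp add: field_simps)
qed

text \<open>The exact factor from the coupling is \<open>1 - 2 * (N + 1) / (3 * N * (N - 1))\<close>. It vanishes for two
particles, whereas this larger number is always positive.\<close>

definition contraction :: real where "contraction = 1 - 2 / (3 * real N)"

lemma contraction_pos: "0 < contraction"
  using N_ge_2 by (simp add: contraction_def field_simps)

lemma measurable_mean_exchange:
  assumes "f \<in> borel_measurable \<sigma>"
  shows "mean_exchange f \<in> borel_measurable \<sigma>"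
proof -
  have "(\<lambda>\<eta>. (\<Sum>q\<in>pairs. pair_average (fst q) (snd q) f \<eta>) / real (card pairs)) \<in> borel_measurable \<sigma>"
    by (intro borel_measurable_divide borel_measurable_sum borel_measurable_const
        measurable_pair_average pairs_sites assms)
  then show ?thesis by (simp add: mean_exchange_def[abs_def])
qed

lemma sq_lipschitz_mono:
  "sq_lipschitz L f \<Longrightarrow> L \<le> L' \<Longrightarrow> sq_lipschitz L' f"
  unfolding sq_lipschitz_def using sqdist_nonneg by (meson mult_right_mono order_trans)

lemma mean_exchange_lipschitz:
  assumes f: "sq_lipschitz L f" and L: "0 \<le> L"
  shows "sq_lipschitz (L * contraction) (mean_exchange f)"
  unfolding sq_lipschitz_def
proof (intro conjI ballI)
  show "mean_exchange f \<in> borel_measurable \<sigma>"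
    by (rule measurable_mean_exchange[OF sq_lipschitzD(1)[OF f]])
  fix \<eta> \<xi> assume \<eta>: "\<eta> \<in> S" and \<xi>: "\<xi> \<in> S"
  let ?c = "real (card pairs)"
  define x where "x k = \<eta> k - \<xi> k" for k
  have x0: "(\<Sum>k=1..N. x k) = 0"
    using \<eta> \<xi> by (simp add: x_def simplex_iff sum_subtractf)
  have D: "sqdist \<eta> \<xi> = (\<Sum>k=1..N. (x k)\<^sup>2)" by (simp add: sqdist_def x_def)
  let ?a = "\<lambda>q. pair_average (fst q) (snd q) f \<eta> - pair_average (fst q) (snd q) f \<xi>"
  have "(mean_exchange f \<eta> - mean_exchange f \<xi>)\<^sup>2 = (\<Sum>q\<in>pairs. ?a q)\<^sup>2 / ?c\<^sup>2"
    by (simp add: mean_exchange_def sum_subtractf diff_divide_distrib[symmetric] power_divide)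
  also have "\<dots> \<le> ((\<Sum>q\<in>pairs. (?a q)\<^sup>2) * ?c) / ?c\<^sup>2"
    using sum_squared_le_sum_of_squares[of ?a pairs] by (simp add: divide_right_mono)
  also have "\<dots> = (\<Sum>q\<in>pairs. (?a q)\<^sup>2) / ?c"
    using card_pairs_pos by (simp add: power2_eq_square)
  also have "\<dots> \<le> (\<Sum>q\<in>pairs. L * (sqdist \<eta> \<xi> - (x (fst q))\<^sup>2 - (x (snd q))\<^sup>2
      + 2 / 3 * (x (fst q) + x (snd q))\<^sup>2)) / ?c"
    unfolding x_def
    by (intro divide_right_mono sum_mono pair_average_contraction[OF pairs_sites f \<eta> \<xi>]) simp_all
  also have "\<dots> = L * (?c * sqdist \<eta> \<xi> - (2 * real N + 2) / 3 * sqdist \<eta> \<xi>) / ?c"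
    by (simp only: sum_distrib_left[symmetric] sum_pairs_quadratic[OF x0] card_pairs D)
  also have "\<dots> \<le> L * contraction * sqdist \<eta> \<xi>"
  proof -
    have "?c * sqdist \<eta> \<xi> - (2 * real N + 2) / 3 * sqdist \<eta> \<xi> \<le> contraction * ?c * sqdist \<eta> \<xi>"
    proof -
      have "contraction * ?c = ?c - 2 / 3 * (real N - 1)"
        using N_ge_2 by (simp add: contraction_def card_pairs field_simps)
      then have "contraction * ?c - ?c + (2 * real N + 2) / 3 = 4 / 3" by (simp add: field_simps)
      then have "0 \<le> (contraction * ?c - ?c + (2 * real N + 2) / 3) * sqdist \<eta> \<xi>"
        by (intro mult_nonneg_nonneg sqdist_nonneg) linarith
      then show ?thesis by (simp add: algebra_simps)
    qed
    then have "L * (?c * sqdist \<eta> \<xi> - (2 * real N + 2) / 3 * sqdist \<eta> \<xi>) / ?c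
        \<le> L * (contraction * ?c * sqdist \<eta> \<xi>) / ?c"
      using L by (intro divide_right_mono mult_left_mono) simp_all
    also have "\<dots> = L * contraction * sqdist \<eta> \<xi>" using card_pairs_pos by simp
    finally show ?thesis .
  qed
  finally show "(mean_exchange f \<eta> - mean_exchange f \<xi>)\<^sup>2 \<le> L * contraction * sqdist \<eta> \<xi>" .
qed

lemma integral_against_average:
  assumes ij: "distinct_sites i j" and g: "bounded_weight g" and f: "square_integrable \<sigma> f"
  shows "(LINT \<eta>|\<sigma>. g \<eta> * pair_average i j f \<eta>) = (LINT p|Q. g (fst p) * f (moved i j p))" (is ?eq)
    and "integrable \<sigma> (\<lambda>\<eta>. g \<eta> * pair_average i j f \<eta>)" (is ?int)
proof -
  let ?A = "\<lambda>p. g (fst p) * f (moved i j p)"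
  have fm: "integrable Q (\<lambda>p. f (moved i j p))"
    by (rule integrable_moved[OF ij sigma.square_integrable_integrable[OF f]])
  then have A: "integrable Q ?A" by (rule integrable_weighted[OF g])
  have eq: "(\<integral>\<alpha>. ?A (\<eta>, \<alpha>) \<partial>unit_lebesgue) = g \<eta> * pair_average i j f \<eta>" for \<eta>
    by (simp add: pair_average_unit)
  show ?eq using Q.integral_fst'[OF A] by (simp only: eq)
  show ?int using Q.integrable_fst'[OF A] by (simp only: eq)
qed

lemma mean_exchange_integral:
  assumes g: "bounded_weight g" and f: "bounded_weight f"
  shows "(LINT \<eta>|\<sigma>. g \<eta> * mean_exchange f \<eta>)
      = (\<Sum>q\<in>pairs. (LINT p|Q. g (fst p) * f (moved (fst q) (snd q) p))) / real (card pairs)"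
proof -
  note f2 = bounded_weight_square_integrable[OF f]
  have "(LINT \<eta>|\<sigma>. g \<eta> * mean_exchange f \<eta>)
      = (LINT \<eta>|\<sigma>. (\<Sum>q\<in>pairs. g \<eta> * pair_average (fst q) (snd q) f \<eta>) / real (card pairs))"
    by (simp add: mean_exchange_def sum_distrib_left)
  also have "\<dots> = (LINT \<eta>|\<sigma>. (\<Sum>q\<in>pairs. g \<eta> * pair_average (fst q) (snd q) f \<eta>)) / real (card pairs)"
    by (rule Bochner_Integration.integral_divide_zero)
  also have "(LINT \<eta>|\<sigma>. (\<Sum>q\<in>pairs. g \<eta> * pair_average (fst q) (snd q) f \<eta>))
      = (\<Sum>q\<in>pairs. (LINT \<eta>|\<sigma>. g \<eta> * pair_average (fst q) (snd q) f \<eta>))"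
    by (rule Bochner_Integration.integral_sum) (rule integral_against_average(2)[OF pairs_sites g f2])
  also have "\<dots> = (\<Sum>q\<in>pairs. (LINT p|Q. g (fst p) * f (moved (fst q) (snd q) p)))"
    by (intro sum.cong refl integral_against_average(1)[OF pairs_sites g f2])
  finally show ?thesis .
qed

lemma mean_exchange_self_adjoint:
  assumes g: "bounded_weight g" and f: "bounded_weight f"
  shows "(LINT \<eta>|\<sigma>. g \<eta> * mean_exchange f \<eta>) = (LINT \<eta>|\<sigma>. mean_exchange g \<eta> * f \<eta>)"
proof -
  note [measurable] = bounded_weight_measurable[OF g] bounded_weight_measurable[OF f]
  have "(LINT p|Q. g (fst p) * f (moved (fst q) (snd q) p)) = (LINT p|Q. f (fst p) * g (moved (fst q) (snd q) p))"
    if "q \<in> pairs" for q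
  proof -
    have "(LINT p|Q. g (fst p) * f (moved (fst q) (snd q) p)) = (LINT p|Q. g (moved (fst q) (snd q) p) * f (fst p))"
      by (rule integral_exchangeable[OF pairs_sites[OF that], of "\<lambda>\<eta> \<xi>. g \<eta> * f \<xi>"]) measurable
    then show ?thesis by (simp add: mult.commute)
  qed
  then have "(LINT \<eta>|\<sigma>. g \<eta> * mean_exchange f \<eta>) = (LINT \<eta>|\<sigma>. f \<eta> * mean_exchange g \<eta>)"
    unfolding mean_exchange_integral[OF g f] mean_exchange_integral[OF f g] by simp
  then show ?thesis by (simp add: mult.commute)
qed

text \<open>The adjoint of the averaging operator preserves constants.\<close>

lemma integral_mean_exchange:
  assumes f: "bounded_weight f"
  shows "(LINT \<eta>|\<sigma>. mean_exchange f \<eta>) = (LINT \<eta>|\<sigma>. f \<eta>)"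
proof -
  have "mean_exchange (\<lambda>_. 1) = (\<lambda>_. 1)"
    using card_pairs_pos unit.prob_space by (auto simp: mean_exchange_def pair_average_unit)
  then show ?thesis
    using mean_exchange_self_adjoint[OF bounded_const[of 1] f] by simp
qed

text \<open>The Lipschitz constants of the iterates decay geometrically, hence so do the norms, as the iterates
keep mean zero. Self-adjointness makes the squared norms log-convex by Cauchy-Schwarz.\<close>

lemma mean_exchange_norm:
  assumes f: "sq_lipschitz L f" and mean: "(LINT \<eta>|\<sigma>. f \<eta>) = 0"
  shows "(LINT \<eta>|\<sigma>. (mean_exchange f \<eta>)\<^sup>2) \<le> contraction * (LINT \<eta>|\<sigma>. (f \<eta>)\<^sup>2)"
proof -
  define h where "h n = (mean_exchange ^^ n) f" for n
  define L' where "L' = \<bar>L\<bar>"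
  have lip: "sq_lipschitz (L' * contraction ^ n) (h n)" for n
  proof (induction n)
    case 0
    show ?case using sq_lipschitz_mono[OF f, of L'] by (simp add: h_def L'_def)
  next
    case (Suc n)
    from mean_exchange_lipschitz[OF this] contraction_pos show ?case
      by (simp add: h_def L'_def mult.assoc mult.commute[of contraction])
  qed
  note bd = bounded_sq_lipschitz[OF lip]
  have hS: "h (Suc n) = mean_exchange (h n)" for n by (simp add: h_def)
  have mean_h: "(LINT \<eta>|\<sigma>. h n \<eta>) = 0" for n
    by (induction n) (simp_all add: hS integral_mean_exchange[OF bd], simp add: h_def mean)
  define b where "b n = (LINT \<eta>|\<sigma>. (h n \<eta>)\<^sup>2)" for n
  have "b 1 \<le> contraction * b 0"
  proof (rule log_convex_ratio_bound)
    fix n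
    show "0 \<le> b n" by (simp add: b_def)
    have "b (Suc n) = (LINT \<eta>|\<sigma>. h n \<eta> * h (Suc (Suc n)) \<eta>)"
      using mean_exchange_self_adjoint[OF bd bd, of n "Suc n"] by (simp add: b_def hS power2_eq_square)
    then show "(b (Suc n))\<^sup>2 \<le> b n * b (Suc (Suc n))"
      using cauchy_schwarz_integral[OF bd[THEN bounded_weight_square_integrable] bd[THEN bounded_weight_square_integrable]]
      by (simp add: b_def)
    show "b n \<le> (L' * real N ^ 3) * contraction ^ n"
    proof -
      have "(h n \<eta>)\<^sup>2 \<le> L' * real N ^ 3 * contraction ^ n" if \<eta>: "\<eta> \<in> S" for \<eta>
      proof -
        have si: "square_integrable \<sigma> (\<lambda>\<xi>. h n \<eta> - h n \<xi>)"
          by (intro square_integrable_diff sigma.square_integrable_const bd[THEN bounded_weight_square_integrable])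
        have "h n \<eta> = (LINT \<xi>|\<sigma>. h n \<eta> - h n \<xi>)"
          using mean_h[of n] sigma.square_integrable_integrable[OF bd[THEN bounded_weight_square_integrable, of n]]
            sigma.prob_space by simp
        then have "(h n \<eta>)\<^sup>2 \<le> (LINT \<xi>|\<sigma>. (h n \<eta> - h n \<xi>)\<^sup>2)"
          using sigma.square_of_mean_le[OF si] by simp
        also have "\<dots> \<le> (LINT \<xi>|\<sigma>. L' * contraction ^ n * real N ^ 3)"
        proof (rule integral_mono)
          show "integrable \<sigma> (\<lambda>\<xi>. (h n \<eta> - h n \<xi>)\<^sup>2)" by (rule square_integrable_square[OF si])
          fix \<xi> assume "\<xi> \<in> space \<sigma>"
          then have \<xi>: "\<xi> \<in> S" by simp
          have "(h n \<eta> - h n \<xi>)\<^sup>2 \<le> L' * contraction ^ n * sqdist \<eta> \<xi>" by (rule sq_lipschitzD(2)[OF lip \<eta> \<xi>])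
          also have "\<dots> \<le> L' * contraction ^ n * real N ^ 3"
            using contraction_pos by (intro mult_left_mono sqdist_le \<eta> \<xi>) (simp add: L'_def)
          finally show "(h n \<eta> - h n \<xi>)\<^sup>2 \<le> L' * contraction ^ n * real N ^ 3" .
        qed simp
        also have "\<dots> = L' * real N ^ 3 * contraction ^ n" using sigma.prob_space by simp
        finally show ?thesis .
      qed
      then have "b n \<le> (LINT \<eta>|\<sigma>. L' * real N ^ 3 * contraction ^ n)"
        unfolding b_def
        by (intro integral_mono square_integrable_square bd[THEN bounded_weight_square_integrable]) simp_all
      then show ?thesis using sigma.prob_space by simp
    qed
  qed (rule contraction_pos)
  then show ?thesis by (simp add: b_def h_def One_nat_def)
qed

abbreviation uniform_energy :: "((nat \<Rightarrow> real) \<Rightarrow> real) \<Rightarrow> real" where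
  "uniform_energy f \<equiv> total_energy (\<lambda>_ _ _. 1) f"

lemma uniform_energy_pairs: "uniform_energy f = (\<Sum>q\<in>pairs. energy (\<lambda>_. 1) (fst q) (snd q) f)"
  unfolding total_energy_def sum_pairs[of "\<lambda>i j. energy (\<lambda>_. 1) i j f"] ..

text \<open>The norm bound gives \<open>2 \<langle>f, K f\<rangle> \<le> (1 + contraction) \<parallel>f\<parallel>\<^sup>2\<close>, and the energy is a multiple of
\<open>\<langle>f, f - K f\<rangle>\<close>.\<close>

lemma poincare_lipschitz_centred:
  assumes f: "sq_lipschitz L f" and mean: "(LINT \<eta>|\<sigma>. f \<eta>) = 0"
  shows "real N * (LINT \<eta>|\<sigma>. (f \<eta>)\<^sup>2) \<le> 3 * uniform_energy f"
proof -
  note bd = bounded_sq_lipschitz[OF f]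
  note f2 = bounded_weight_square_integrable[OF bd]
  note kbd = bounded_sq_lipschitz[OF mean_exchange_lipschitz[OF sq_lipschitz_mono[OF f], of "\<bar>L\<bar>"]]
  have k2: "square_integrable \<sigma> (mean_exchange f)"
    by (rule bounded_weight_square_integrable[OF kbd]) simp_all
  let ?c = "real (card pairs)"
  let ?V = "LINT \<eta>|\<sigma>. (f \<eta>)\<^sup>2"
  have e: "energy (\<lambda>_. 1) (fst q) (snd q) f = 2 * ?V - 2 * (LINT p|Q. f (fst p) * f (moved (fst q) (snd q) p))"
    if "q \<in> pairs" for q
  proof -
    note ij = pairs_sites[OF that]
    note i1 = square_integrable_fst[OF f2] and i2 = square_integrable_moved[OF ij f2]
    have "energy (\<lambda>_. 1) (fst q) (snd q) f / 2
        = (LINT p|Q. (f (fst p))\<^sup>2 - f (fst p) * f (moved (fst q) (snd q) p))"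
      using energy_half(1)[OF ij bounded_const[of 1] f2]
      by (simp add: right_diff_distrib power2_eq_square)
    also have "\<dots> = (LINT p|Q. (f (fst p))\<^sup>2) - (LINT p|Q. f (fst p) * f (moved (fst q) (snd q) p))"
      using square_integrable_square[OF i1] square_integrable_mult[OF i1 i2] by simp
    also have "(LINT p|Q. (f (fst p))\<^sup>2) = ?V"
      using integral_fst[of "\<lambda>\<eta>. (f \<eta>)\<^sup>2"] square_integrable_measurable[OF f2] by simp
    finally show ?thesis by simp
  qed
  have "uniform_energy f = (\<Sum>q\<in>pairs. 2 * ?V - 2 * (LINT p|Q. f (fst p) * f (moved (fst q) (snd q) p)))"
    unfolding uniform_energy_pairs by (intro sum.cong refl e)
  also have "\<dots> = 2 * ?c * ?V - 2 * (\<Sum>q\<in>pairs. (LINT p|Q. f (fst p) * f (moved (fst q) (snd q) p)))"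
    by (simp add: sum_subtractf sum_distrib_left)
  also have "(\<Sum>q\<in>pairs. (LINT p|Q. f (fst p) * f (moved (fst q) (snd q) p)))
      = ?c * (LINT \<eta>|\<sigma>. f \<eta> * mean_exchange f \<eta>)"
    using mean_exchange_integral[OF bd bd] card_pairs_pos by simp
  finally have E: "uniform_energy f = ?c * (2 * ?V - 2 * (LINT \<eta>|\<sigma>. f \<eta> * mean_exchange f \<eta>))"
    by (simp add: algebra_simps)
  have "2 * (LINT \<eta>|\<sigma>. f \<eta> * mean_exchange f \<eta>) \<le> ?V + (LINT \<eta>|\<sigma>. (mean_exchange f \<eta>)\<^sup>2)"
  proof -
    have "2 * (LINT \<eta>|\<sigma>. f \<eta> * mean_exchange f \<eta>) = (LINT \<eta>|\<sigma>. 2 * (f \<eta> * mean_exchange f \<eta>))" by simp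
    also have "\<dots> \<le> (LINT \<eta>|\<sigma>. (f \<eta>)\<^sup>2 + (mean_exchange f \<eta>)\<^sup>2)"
      using square_integrable_mult[OF f2 k2] square_integrable_square[OF f2] square_integrable_square[OF k2]
    proof (intro integral_mono)
      fix \<eta>
      show "2 * (f \<eta> * mean_exchange f \<eta>) \<le> (f \<eta>)\<^sup>2 + (mean_exchange f \<eta>)\<^sup>2"
        using sum_squares_bound[of "f \<eta>" "mean_exchange f \<eta>"] by simp
    qed simp_all
    also have "\<dots> = ?V + (LINT \<eta>|\<sigma>. (mean_exchange f \<eta>)\<^sup>2)"
      using square_integrable_square[OF f2] square_integrable_square[OF k2] by simp
    finally show ?thesis .
  qed
  also have "\<dots> \<le> ?V + contraction * ?V" using mean_exchange_norm[OF f mean] by simp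
  finally have "(1 - contraction) * ?V \<le> 2 * ?V - 2 * (LINT \<eta>|\<sigma>. f \<eta> * mean_exchange f \<eta>)"
    by (simp add: algebra_simps)
  then have "?c * ((1 - contraction) * ?V) \<le> uniform_energy f"
    unfolding E using card_pairs_pos by (intro mult_left_mono) simp_all
  moreover have "?c * (1 - contraction) = 2 / 3 * (real N - 1)"
    using N_ge_2 by (simp add: card_pairs contraction_def field_simps)
  moreover have "real N * ?V \<le> 2 * (real N - 1) * ?V"
    using N_ge_2 by (intro mult_right_mono) simp_all
  ultimately show ?thesis by (simp add: mult.assoc[symmetric])
qed

end

section \<open>Spectral gap at constant rates: square-integrable functions\<close>

lemma product_increment_le:
  fixes a b c d :: real
  assumes "0 \<le> a" "a \<le> 1" "0 \<le> d" "d \<le> 1"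
  shows "(a * b - c * d)\<^sup>2 \<le> 2 * (a - c)\<^sup>2 + 2 * (b - d)\<^sup>2"
proof -
  have "(a * b - c * d)\<^sup>2 = (a * (b - d) + d * (a - c))\<^sup>2" by (simp add: algebra_simps)
  also have "\<dots> \<le> 2 * (a * (b - d))\<^sup>2 + 2 * (d * (a - c))\<^sup>2" by (rule square_add_le)
  also have "\<dots> \<le> 2 * (b - d)\<^sup>2 + 2 * (a - c)\<^sup>2"
    using assms by (intro add_mono mult_left_mono) (simp_all add: power_mult_distrib mult_left_le_one_le power_le_one)
  finally show ?thesis by simp
qed

context exchange_model
begin

definition approximable :: "((nat \<Rightarrow> real) \<Rightarrow> real) \<Rightarrow> bool" where
  "approximable f \<longleftrightarrow> (\<forall>\<epsilon>>0. \<exists>g L. sq_lipschitz L g \<and> (LINT \<eta>|\<sigma>. (f \<eta> - g \<eta>)\<^sup>2) < \<epsilon>)"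

text \<open>The approximating functions take values in the unit interval so that their products approximate
intersections. With this the approximable events form a \<open>\<sigma>\<close>-algebra.\<close>

definition approximable_event :: "(nat \<Rightarrow> real) set \<Rightarrow> bool" where
  "approximable_event A \<longleftrightarrow> A \<in> sets \<sigma> \<and>
     (\<forall>\<epsilon>>0. \<exists>g L. sq_lipschitz L g \<and> (\<forall>\<eta>. 0 \<le> g \<eta> \<and> g \<eta> \<le> 1) \<and>
        (LINT \<eta>|\<sigma>. (indicator A \<eta> - g \<eta>)\<^sup>2) < \<epsilon>)"

lemma square_integrable_lipschitz: "sq_lipschitz L g \<Longrightarrow> square_integrable \<sigma> g"
  by (rule bounded_weight_square_integrable[OF bounded_sq_lipschitz])

lemma square_integrable_indicator: "A \<in> sets \<sigma> \<Longrightarrow> square_integrable \<sigma> (indicator A)"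
  by (rule sigma.square_integrable_bounded[where B=1]) auto

lemma approximation_step:
  assumes f: "square_integrable \<sigma> f" and h: "square_integrable \<sigma> h" and g: "square_integrable \<sigma> g"
  shows "(LINT \<eta>|\<sigma>. (f \<eta> - g \<eta>)\<^sup>2) \<le> 2 * (LINT \<eta>|\<sigma>. (f \<eta> - h \<eta>)\<^sup>2) + 2 * (LINT \<eta>|\<sigma>. (h \<eta> - g \<eta>)\<^sup>2)"
proof -
  note i = square_integrable_square[OF square_integrable_diff]
  have "(LINT \<eta>|\<sigma>. (f \<eta> - g \<eta>)\<^sup>2) \<le> (LINT \<eta>|\<sigma>. 2 * (f \<eta> - h \<eta>)\<^sup>2 + 2 * (h \<eta> - g \<eta>)\<^sup>2)"
  proof (rule integral_mono)
    fix \<eta>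
    show "(f \<eta> - g \<eta>)\<^sup>2 \<le> 2 * (f \<eta> - h \<eta>)\<^sup>2 + 2 * (h \<eta> - g \<eta>)\<^sup>2"
      using square_add_le[of "f \<eta> - h \<eta>" "h \<eta> - g \<eta>"] by simp
  qed (use i[OF f g] i[OF f h] i[OF h g] in simp_all)
  also have "\<dots> = 2 * (LINT \<eta>|\<sigma>. (f \<eta> - h \<eta>)\<^sup>2) + 2 * (LINT \<eta>|\<sigma>. (h \<eta> - g \<eta>)\<^sup>2)"
    using i[OF f h] i[OF h g] by simp
  finally show ?thesis .
qed

lemma sq_lipschitz_shift:
  assumes "sq_lipschitz L g"
  shows "sq_lipschitz L (\<lambda>\<eta>. c - g \<eta>)" "sq_lipschitz L (\<lambda>\<eta>. g \<eta> - c)"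
proof -
  have [measurable]: "g \<in> borel_measurable \<sigma>" by (rule sq_lipschitzD(1)[OF assms])
  show "sq_lipschitz L (\<lambda>\<eta>. c - g \<eta>)" "sq_lipschitz L (\<lambda>\<eta>. g \<eta> - c)"
    using assms unfolding sq_lipschitz_def by (auto simp: power2_commute)
qed

lemma approximable_event_compl:
  assumes A: "approximable_event A"
  shows "approximable_event (S - A)"
  unfolding approximable_event_def
proof (intro conjI allI impI)
  show "S - A \<in> sets \<sigma>"
    using A sets.compl_sets[of A \<sigma>] by (simp add: approximable_event_def)
  fix \<epsilon> :: real assume "0 < \<epsilon>"
  then obtain g L where g: "sq_lipschitz L g" "\<forall>\<eta>. 0 \<le> g \<eta> \<and> g \<eta> \<le> 1"
      "(LINT \<eta>|\<sigma>. (indicator A \<eta> - g \<eta>)\<^sup>2) < \<epsilon>"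
    using A unfolding approximable_event_def by blast
  have "sq_lipschitz L (\<lambda>\<eta>. 1 - g \<eta>)"
    by (rule sq_lipschitz_shift(1)[OF g(1)])
  moreover have "(LINT \<eta>|\<sigma>. (indicator (S - A) \<eta> - (1 - g \<eta>))\<^sup>2) = (LINT \<eta>|\<sigma>. (indicator A \<eta> - g \<eta>)\<^sup>2)"
    by (intro Bochner_Integration.integral_cong) (auto simp: indicator_def power2_commute)
  ultimately show "\<exists>g L. sq_lipschitz L g \<and> (\<forall>\<eta>. 0 \<le> g \<eta> \<and> g \<eta> \<le> 1) \<and>
      (LINT \<eta>|\<sigma>. (indicator (S - A) \<eta> - g \<eta>)\<^sup>2) < \<epsilon>"
    using g(2,3) by (intro exI[of _ "\<lambda>\<eta>. 1 - g \<eta>"] exI[of _ L]) auto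
qed

lemma approximable_event_Int:
  assumes A: "approximable_event A" and B: "approximable_event B"
  shows "approximable_event (A \<inter> B)"
  unfolding approximable_event_def
proof (intro conjI allI impI)
  have sets: "A \<in> sets \<sigma>" "B \<in> sets \<sigma>" using A B by (auto simp: approximable_event_def)
  then show "A \<inter> B \<in> sets \<sigma>" by simp
  fix \<epsilon> :: real assume "0 < \<epsilon>"
  then have e: "0 < \<epsilon> / 4" by simp
  obtain g L where g: "sq_lipschitz L g" "\<And>\<eta>. 0 \<le> g \<eta>" "\<And>\<eta>. g \<eta> \<le> 1"
      "(LINT \<eta>|\<sigma>. (indicator A \<eta> - g \<eta>)\<^sup>2) < \<epsilon> / 4"
    using A e unfolding approximable_event_def by blast
  obtain h M where h: "sq_lipschitz M h" "\<And>\<eta>. 0 \<le> h \<eta>" "\<And>\<eta>. h \<eta> \<le> 1"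
      "(LINT \<eta>|\<sigma>. (indicator B \<eta> - h \<eta>)\<^sup>2) < \<epsilon> / 4"
    using B e unfolding approximable_event_def by blast
  have lip: "sq_lipschitz (2 * L + 2 * M) (\<lambda>\<eta>. g \<eta> * h \<eta>)"
    unfolding sq_lipschitz_def
  proof (intro conjI ballI)
    show "(\<lambda>\<eta>. g \<eta> * h \<eta>) \<in> borel_measurable \<sigma>"
      using g(1) h(1) by (auto simp: sq_lipschitz_def intro: borel_measurable_times)
    fix \<eta> \<xi> assume "\<eta> \<in> S" "\<xi> \<in> S"
    then have "2 * (g \<eta> - g \<xi>)\<^sup>2 + 2 * (h \<eta> - h \<xi>)\<^sup>2 \<le> (2 * L + 2 * M) * sqdist \<eta> \<xi>"
      using sq_lipschitzD(2)[OF g(1)] sq_lipschitzD(2)[OF h(1)] by (fastforce simp: algebra_simps)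
    then show "(g \<eta> * h \<eta> - g \<xi> * h \<xi>)\<^sup>2 \<le> (2 * L + 2 * M) * sqdist \<eta> \<xi>"
      using product_increment_le[of "g \<eta>" "h \<xi>" "h \<eta>" "g \<xi>"] g(2,3) h(2,3) by fastforce
  qed
  note i1 = square_integrable_diff[OF square_integrable_indicator[OF sets(1)] square_integrable_lipschitz[OF g(1)]]
  note i2 = square_integrable_diff[OF square_integrable_indicator[OF sets(2)] square_integrable_lipschitz[OF h(1)]]
  have iAB: "square_integrable \<sigma> (\<lambda>\<eta>. indicator (A \<inter> B) \<eta> - g \<eta> * h \<eta>)"
    using sets by (intro square_integrable_diff square_integrable_indicator square_integrable_lipschitz[OF lip]) simp
  have "(LINT \<eta>|\<sigma>. (indicator (A \<inter> B) \<eta> - g \<eta> * h \<eta>)\<^sup>2)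
      \<le> (LINT \<eta>|\<sigma>. 2 * (indicator A \<eta> - g \<eta>)\<^sup>2 + 2 * (indicator B \<eta> - h \<eta>)\<^sup>2)"
  proof (rule integral_mono)
    show "integrable \<sigma> (\<lambda>\<eta>. (indicator (A \<inter> B) \<eta> - g \<eta> * h \<eta>)\<^sup>2)" by (rule square_integrable_square[OF iAB])
    show "integrable \<sigma> (\<lambda>\<eta>. 2 * (indicator A \<eta> - g \<eta>)\<^sup>2 + 2 * (indicator B \<eta> - h \<eta>)\<^sup>2)"
      using square_integrable_square[OF i1] square_integrable_square[OF i2] by simp
    fix \<eta>
    show "(indicator (A \<inter> B) \<eta> - g \<eta> * h \<eta>)\<^sup>2 \<le> 2 * (indicator A \<eta> - g \<eta>)\<^sup>2 + 2 * (indicator B \<eta> - h \<eta>)\<^sup>2"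
      using product_increment_le[of "indicator A \<eta>" "h \<eta>" "indicator B \<eta>" "g \<eta>"] h(2,3)
      by (simp add: indicator_inter_arith)
  qed
  also have "\<dots> = 2 * (LINT \<eta>|\<sigma>. (indicator A \<eta> - g \<eta>)\<^sup>2) + 2 * (LINT \<eta>|\<sigma>. (indicator B \<eta> - h \<eta>)\<^sup>2)"
    using square_integrable_square[OF i1] square_integrable_square[OF i2] by simp
  also have "\<dots> < \<epsilon>" using g(4) h(4) by simp
  finally have lt: "(LINT \<eta>|\<sigma>. (indicator (A \<inter> B) \<eta> - g \<eta> * h \<eta>)\<^sup>2) < \<epsilon>" .
  have range: "0 \<le> g \<eta> * h \<eta> \<and> g \<eta> * h \<eta> \<le> 1" for \<eta>
    using g(2,3) h(2,3) by (simp add: mult_le_one)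
  show "\<exists>g L. sq_lipschitz L g \<and> (\<forall>\<eta>. 0 \<le> g \<eta> \<and> g \<eta> \<le> 1) \<and>
      (LINT \<eta>|\<sigma>. (indicator (A \<inter> B) \<eta> - g \<eta>)\<^sup>2) < \<epsilon>"
    using lip lt range by blast
qed

lemma approximable_event_empty: "approximable_event {}"
  unfolding approximable_event_def
  by (auto intro!: exI[of _ "\<lambda>_. 0"] exI[of _ 0] simp: sq_lipschitz_def)

lemma approximable_event_Un:
  assumes "approximable_event A" "approximable_event B"
  shows "approximable_event (A \<union> B)"
proof -
  have "A \<subseteq> S" "B \<subseteq> S"
    using assms sets.sets_into_space[of _ \<sigma>] by (auto simp: approximable_event_def)
  then have "A \<union> B = S - (S - A) \<inter> (S - B)" by auto
  then show ?thesis
    using approximable_event_compl[OF approximable_event_Int[OF approximable_event_compl approximable_event_compl]]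
      assms by simp
qed

lemma approximable_event_limit:
  assumes A: "A \<in> sets \<sigma>" and B: "\<And>n. approximable_event (B n)"
    and lim: "(\<lambda>n. LINT \<eta>|\<sigma>. (indicator A \<eta> - indicator (B n) \<eta> :: real)\<^sup>2) \<longlonglongrightarrow> 0"
  shows "approximable_event A"
  unfolding approximable_event_def
proof (intro conjI allI impI A)
  fix \<epsilon> :: real assume "0 < \<epsilon>"
  then have e: "0 < \<epsilon> / 4" by simp
  from order_tendstoD(2)[OF lim e]
  obtain n where n: "(LINT \<eta>|\<sigma>. (indicator A \<eta> - indicator (B n) \<eta> :: real)\<^sup>2) < \<epsilon> / 4"
    by (auto simp: eventually_sequentially)
  obtain g L where g: "sq_lipschitz L g" "\<forall>\<eta>. 0 \<le> g \<eta> \<and> g \<eta> \<le> 1"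
      "(LINT \<eta>|\<sigma>. (indicator (B n) \<eta> - g \<eta>)\<^sup>2) < \<epsilon> / 4"
    using B[of n] e unfolding approximable_event_def by blast
  have "B n \<in> sets \<sigma>" using B by (simp add: approximable_event_def)
  then have "(LINT \<eta>|\<sigma>. (indicator A \<eta> - g \<eta>)\<^sup>2) < \<epsilon>"
    using approximation_step[OF square_integrable_indicator[OF A] square_integrable_indicator
      square_integrable_lipschitz[OF g(1)], of "B n"] n g(3) by simp
  then show "\<exists>g L. sq_lipschitz L g \<and> (\<forall>\<eta>. 0 \<le> g \<eta> \<and> g \<eta> \<le> 1) \<and> (LINT \<eta>|\<sigma>. (indicator A \<eta> - g \<eta>)\<^sup>2) < \<epsilon>"
    using g by blast
qed

lemma approximable_event_UN:
  assumes A: "\<And>n::nat. approximable_event (A n)"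
  shows "approximable_event (\<Union>n. A n)"
proof (rule approximable_event_limit[where B="\<lambda>n. \<Union>i<n. A i"])
  have sets: "A n \<in> sets \<sigma>" for n using A by (simp add: approximable_event_def)
  then show "(\<Union>n. A n) \<in> sets \<sigma>" by auto
  show "approximable_event (\<Union>i<n. A i)" for n
    by (induction n) (simp_all add: approximable_event_empty lessThan_Suc approximable_event_Un A)
  show "(\<lambda>n. LINT \<eta>|\<sigma>. (indicator (\<Union>n. A n) \<eta> - indicator (\<Union>i<n. A i) \<eta> :: real)\<^sup>2) \<longlonglongrightarrow> 0"
  proof -
    have "(\<lambda>n. LINT \<eta>|\<sigma>. (indicator (\<Union>n. A n) \<eta> - indicator (\<Union>i<n. A i) \<eta> :: real)\<^sup>2)
        \<longlonglongrightarrow> (LINT \<eta>|\<sigma>. (0::real))"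
    proof (rule integral_dominated_convergence[where w="\<lambda>_. 1"])
      show "AE \<eta> in \<sigma>. (\<lambda>n. (indicator (\<Union>n. A n) \<eta> - indicator (\<Union>i<n. A i) \<eta> :: real)\<^sup>2) \<longlonglongrightarrow> 0"
      proof (rule AE_I2)
        fix \<eta>
        have "(\<lambda>n. indicator (\<Union>i<n. A i) \<eta> :: real) \<longlonglongrightarrow> indicator (\<Union>i. A i) \<eta>"
          by (rule LIMSEQ_indicator_UN)
        from tendsto_power[OF tendsto_diff[OF tendsto_const[of "indicator (\<Union>i. A i) \<eta>"] this], of 2]
        show "(\<lambda>n. (indicator (\<Union>n. A n) \<eta> - indicator (\<Union>i<n. A i) \<eta> :: real)\<^sup>2) \<longlonglongrightarrow> 0" by simp
      qed
    qed (use sets in \<open>auto simp: indicator_def intro!: borel_measurable_power borel_measurable_diff borel_measurable_indicator\<close>)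
    then show ?thesis by simp
  qed
qed

text \<open>Ramps of slope n decrease to the indicator.\<close>

lemma approximable_half_space:
  assumes k: "k \<in> {1..N}"
  shows "approximable_event {\<eta> \<in> S. \<eta> k \<le> a}"
  unfolding approximable_event_def
proof (intro conjI allI impI)
  let ?A = "{\<eta> \<in> S. \<eta> k \<le> a}"
  have "{\<eta> \<in> space \<sigma>. \<eta> k \<le> a} \<in> sets \<sigma>" by measurable
  then show A: "?A \<in> sets \<sigma>" by simp
  define g where "g n \<eta> = max 0 (min 1 (1 - real n * (\<eta> k - a)))" for n and \<eta> :: "nat \<Rightarrow> real"
  have m: "g n \<in> borel_measurable \<sigma>" for n unfolding g_def[abs_def] by measurable
  have range: "0 \<le> g n \<eta> \<and> g n \<eta> \<le> 1" for n \<eta> by (simp add: g_def)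
  have lip: "sq_lipschitz ((real n)\<^sup>2) (g n)" for n
    unfolding sq_lipschitz_def
  proof (intro conjI ballI m)
    fix \<eta> \<xi> :: "nat \<Rightarrow> real"
    have "\<bar>g n \<eta> - g n \<xi>\<bar> \<le> \<bar>real n * (\<eta> k - \<xi> k)\<bar>"
      by (simp add: g_def algebra_simps max_def min_def abs_if)
    then have "(g n \<eta> - g n \<xi>)\<^sup>2 \<le> (real n)\<^sup>2 * (\<eta> k - \<xi> k)\<^sup>2"
      using power_mono[of "\<bar>g n \<eta> - g n \<xi>\<bar>" "\<bar>real n * (\<eta> k - \<xi> k)\<bar>" 2] by (simp add: power_mult_distrib)
    also have "(\<eta> k - \<xi> k)\<^sup>2 \<le> sqdist \<eta> \<xi>"
      unfolding sqdist_def using k by (intro member_le_sum) auto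
    finally show "(g n \<eta> - g n \<xi>)\<^sup>2 \<le> (real n)\<^sup>2 * sqdist \<eta> \<xi>" by (simp add: mult_left_mono)
  qed
  have "(\<lambda>n. LINT \<eta>|\<sigma>. (indicator ?A \<eta> - g n \<eta>)\<^sup>2) \<longlonglongrightarrow> (LINT \<eta>|\<sigma>. (0::real))"
  proof (rule integral_dominated_convergence[where w="\<lambda>_. 1"])
    show "AE \<eta> in \<sigma>. (\<lambda>n. (indicator ?A \<eta> - g n \<eta>)\<^sup>2) \<longlonglongrightarrow> 0"
    proof (rule AE_I2)
      fix \<eta> assume \<eta>: "\<eta> \<in> space \<sigma>"
      show "(\<lambda>n. (indicator ?A \<eta> - g n \<eta>)\<^sup>2) \<longlonglongrightarrow> 0"
      proof (cases "\<eta> k \<le> a")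
        case True
        then have "g n \<eta> = 1" for n by (simp add: g_def mult_nonneg_nonpos)
        then show ?thesis using True \<eta> by simp
      next
        case False
        obtain n0 where n0: "1 / (\<eta> k - a) < real n0" using reals_Archimedean2 by blast
        have "g n \<eta> = 0" if "n0 \<le> n" for n
        proof -
          have "1 / (\<eta> k - a) \<le> real n" using n0 that by (simp add: less_imp_le order_trans[of _ "real n0"])
          then have "1 \<le> real n * (\<eta> k - a)" using False by (simp add: field_simps)
          then show ?thesis by (simp add: g_def)
        qed
        then have "\<forall>\<^sub>F n in sequentially. (indicator ?A \<eta> - g n \<eta>)\<^sup>2 = 0"
          using False by (auto simp: eventually_sequentially)
        then show ?thesis by (rule tendsto_eventually)
      qed
    qed
    show "AE \<eta> in \<sigma>. norm ((indicator ?A \<eta> - g n \<eta>)\<^sup>2) \<le> 1" for n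
    proof (rule AE_I2)
      fix \<eta>
      have "\<bar>indicator ?A \<eta> - g n \<eta>\<bar> \<le> 1" using range[of n \<eta>] by (auto simp: indicator_def)
      then show "norm ((indicator ?A \<eta> - g n \<eta>)\<^sup>2) \<le> 1"
        by (simp add: abs_square_le_1)
    qed
    show "(\<lambda>\<eta>. (indicator ?A \<eta> - g n \<eta>)\<^sup>2) \<in> borel_measurable \<sigma>" for n
      using A m by (intro borel_measurable_power borel_measurable_diff borel_measurable_indicator)
  qed simp_all
  then have lim: "(\<lambda>n. LINT \<eta>|\<sigma>. (indicator ?A \<eta> - g n \<eta>)\<^sup>2) \<longlonglongrightarrow> 0" by simp
  fix \<epsilon> :: real assume "0 < \<epsilon>"
  from order_tendstoD(2)[OF lim this]
  obtain n where "(LINT \<eta>|\<sigma>. (indicator ?A \<eta> - g n \<eta>)\<^sup>2) < \<epsilon>"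
    by (auto simp: eventually_sequentially)
  then show "\<exists>g L. sq_lipschitz L g \<and> (\<forall>\<eta>. 0 \<le> g \<eta> \<and> g \<eta> \<le> 1) \<and>
      (LINT \<eta>|\<sigma>. (indicator ?A \<eta> - g \<eta>)\<^sup>2) < \<epsilon>"
    using lip range by blast
qed

lemma approximable_coordinate_event:
  assumes k: "k \<in> {1..N}" and B: "B \<in> sets borel"
  shows "approximable_event {\<eta> \<in> S. \<eta> k \<in> B}"
proof -
  have "B \<in> sigma_sets UNIV (range (\<lambda>a::real. {..a}))"
    using B by (simp add: borel_eq_atMost)
  then show ?thesis
  proof induction
    case (Basic B)
    then show ?case using approximable_half_space[OF k] by auto
  next
    case Empty
    show ?case using approximable_event_empty by simp
  next
    case (Compl B)
    have "{\<eta> \<in> S. \<eta> k \<in> UNIV - B} = S - {\<eta> \<in> S. \<eta> k \<in> B}" by auto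
    then show ?case using approximable_event_compl[OF Compl.IH] by simp
  next
    case (Union B)
    have "{\<eta> \<in> S. \<eta> k \<in> (\<Union>n. B n)} = (\<Union>n. {\<eta> \<in> S. \<eta> k \<in> B n})" by auto
    then show ?case using approximable_event_UN[OF Union.IH] by simp
  qed
qed

text \<open>Two inductions over generated \<open>\<sigma>\<close>-algebras: first for the values of a single coordinate, then for
the product.\<close>

lemma approximable_all_events:
  assumes "A \<in> sets \<sigma>"
  shows "approximable_event A"
proof -
  let ?\<Omega> = "{1..N} \<rightarrow>\<^sub>E (UNIV :: real set)"
  have sub: "S \<subseteq> ?\<Omega>" by (simp add: subset_iff simplex_iff PiE_iff)
  have "approximable_event (C \<inter> S)" if "C \<in> sets (Pi\<^sub>M {1..N} (\<lambda>_. borel))" for C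
  proof -
    have "C \<in> sigma_sets ?\<Omega> {{f \<in> ?\<Omega>. f i \<in> B} | i B. i \<in> {1..N} \<and> B \<in> sets (borel :: real measure)}"
      using that by (simp add: sets_PiM_single)
    then show ?thesis
    proof induction
      case (Basic C)
      then obtain i B where iB: "i \<in> {1..N}" "B \<in> sets borel" and C: "C = {f \<in> ?\<Omega>. f i \<in> B}" by blast
      have "C \<inter> S = {\<eta> \<in> S. \<eta> i \<in> B}" using sub by (auto simp: C)
      then show ?case using approximable_coordinate_event[OF iB] by simp
    next
      case Empty
      show ?case using approximable_event_empty by simp
    next
      case (Compl C)
      have "(?\<Omega> - C) \<inter> S = S - C \<inter> S" using sub by auto
      then show ?case using approximable_event_compl[OF Compl.IH] by simp
    next
      case (Union C)
      have "(\<Union>n. C n) \<inter> S = (\<Union>n. C n \<inter> S)" by auto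
      then show ?case using approximable_event_UN[OF Union.IH] by simp
    qed
  qed
  moreover obtain C where "C \<in> sets (Pi\<^sub>M {1..N} (\<lambda>_. borel))" "A = S \<inter> C"
    using assms by (auto simp: sets_sigma sets_restrict_space)
  ultimately show ?thesis by (simp add: Int_commute)
qed

lemma approximable_limit:
  assumes f: "square_integrable \<sigma> f" and h: "\<And>n::nat. square_integrable \<sigma> (h n)" "\<And>n. approximable (h n)"
    and lim: "(\<lambda>n. LINT \<eta>|\<sigma>. (f \<eta> - h n \<eta>)\<^sup>2) \<longlonglongrightarrow> 0"
  shows "approximable f"
  unfolding approximable_def
proof (intro allI impI)
  fix \<epsilon> :: real assume "0 < \<epsilon>"
  then have e: "0 < \<epsilon> / 4" by simp
  from order_tendstoD(2)[OF lim e]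
  obtain n where n: "(LINT \<eta>|\<sigma>. (f \<eta> - h n \<eta>)\<^sup>2) < \<epsilon> / 4"
    by (auto simp: eventually_sequentially)
  obtain g L where g: "sq_lipschitz L g" "(LINT \<eta>|\<sigma>. (h n \<eta> - g \<eta>)\<^sup>2) < \<epsilon> / 4"
    using h(2)[of n] e unfolding approximable_def by blast
  have "(LINT \<eta>|\<sigma>. (f \<eta> - g \<eta>)\<^sup>2) < \<epsilon>"
    using approximation_step[OF f h(1)[of n] square_integrable_lipschitz[OF g(1)]] n g(2) by simp
  then show "\<exists>g L. sq_lipschitz L g \<and> (LINT \<eta>|\<sigma>. (f \<eta> - g \<eta>)\<^sup>2) < \<epsilon>" using g(1) by blast
qed

lemma approximable_combination:
  assumes f: "square_integrable \<sigma> f" "approximable f" and h: "square_integrable \<sigma> h" "approximable h"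
  shows "approximable (\<lambda>\<eta>. f \<eta> + c * h \<eta>)"
  unfolding approximable_def
proof (intro allI impI)
  fix \<epsilon> :: real assume \<epsilon>: "0 < \<epsilon>"
  have "0 < \<epsilon> / 4" "0 < \<epsilon> / (4 * (1 + c\<^sup>2))" using \<epsilon> by (simp_all add: add_pos_nonneg)
  then obtain g L k M where g: "sq_lipschitz L g" "(LINT \<eta>|\<sigma>. (f \<eta> - g \<eta>)\<^sup>2) < \<epsilon> / 4"
    and k: "sq_lipschitz M k" "(LINT \<eta>|\<sigma>. (h \<eta> - k \<eta>)\<^sup>2) < \<epsilon> / (4 * (1 + c\<^sup>2))"
    using f(2) h(2) unfolding approximable_def by meson
  have lip: "sq_lipschitz (2 * L + 2 * (c\<^sup>2 * M)) (\<lambda>\<eta>. g \<eta> + c * k \<eta>)"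
    unfolding sq_lipschitz_def
  proof (intro conjI ballI)
    show "(\<lambda>\<eta>. g \<eta> + c * k \<eta>) \<in> borel_measurable \<sigma>"
      using g(1) k(1) by (auto simp: sq_lipschitz_def intro!: borel_measurable_times borel_measurable_add)
    fix \<eta> \<xi> assume S: "\<eta> \<in> S" "\<xi> \<in> S"
    have "(g \<eta> + c * k \<eta> - (g \<xi> + c * k \<xi>))\<^sup>2 = ((g \<eta> - g \<xi>) + c * (k \<eta> - k \<xi>))\<^sup>2"
      by (simp add: algebra_simps)
    also have "\<dots> \<le> 2 * (g \<eta> - g \<xi>)\<^sup>2 + 2 * (c * (k \<eta> - k \<xi>))\<^sup>2" by (rule square_add_le)
    also have "\<dots> \<le> 2 * (L * sqdist \<eta> \<xi>) + 2 * (c\<^sup>2 * (M * sqdist \<eta> \<xi>))"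
      unfolding power_mult_distrib
      by (intro add_mono mult_left_mono sq_lipschitzD(2)[OF g(1) S] sq_lipschitzD(2)[OF k(1) S]) simp_all
    finally show "(g \<eta> + c * k \<eta> - (g \<xi> + c * k \<xi>))\<^sup>2 \<le> (2 * L + 2 * (c\<^sup>2 * M)) * sqdist \<eta> \<xi>"
      by (simp add: algebra_simps)
  qed
  note i1 = square_integrable_diff[OF f(1) square_integrable_lipschitz[OF g(1)]]
  note i2 = square_integrable_diff[OF h(1) square_integrable_lipschitz[OF k(1)]]
  have i: "square_integrable \<sigma> (\<lambda>\<eta>. f \<eta> + c * h \<eta> - (g \<eta> + c * k \<eta>))"
    by (intro square_integrable_diff square_integrable_lipschitz[OF lip] square_integrable_add
        square_integrable_scale f(1) h(1))
  have "(LINT \<eta>|\<sigma>. (f \<eta> + c * h \<eta> - (g \<eta> + c * k \<eta>))\<^sup>2)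
      \<le> (LINT \<eta>|\<sigma>. 2 * (f \<eta> - g \<eta>)\<^sup>2 + 2 * (c\<^sup>2 * (h \<eta> - k \<eta>)\<^sup>2))"
  proof (rule integral_mono)
    fix \<eta>
    have "f \<eta> + c * h \<eta> - (g \<eta> + c * k \<eta>) = (f \<eta> - g \<eta>) + c * (h \<eta> - k \<eta>)" by (simp add: algebra_simps)
    then show "(f \<eta> + c * h \<eta> - (g \<eta> + c * k \<eta>))\<^sup>2 \<le> 2 * (f \<eta> - g \<eta>)\<^sup>2 + 2 * (c\<^sup>2 * (h \<eta> - k \<eta>)\<^sup>2)"
      using square_add_le[of "f \<eta> - g \<eta>" "c * (h \<eta> - k \<eta>)"] by (simp only: power_mult_distrib)
  qed (use square_integrable_square[OF i] square_integrable_square[OF i1] square_integrable_square[OF i2] in simp_all)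
  also have "\<dots> = 2 * (LINT \<eta>|\<sigma>. (f \<eta> - g \<eta>)\<^sup>2) + 2 * (c\<^sup>2 * (LINT \<eta>|\<sigma>. (h \<eta> - k \<eta>)\<^sup>2))"
    using square_integrable_square[OF i1] square_integrable_square[OF i2] by simp
  also have "\<dots> < \<epsilon>"
  proof -
    have "c\<^sup>2 * (LINT \<eta>|\<sigma>. (h \<eta> - k \<eta>)\<^sup>2) \<le> (1 + c\<^sup>2) * (LINT \<eta>|\<sigma>. (h \<eta> - k \<eta>)\<^sup>2)"
      by (intro mult_right_mono) simp_all
    also have "\<dots> < (1 + c\<^sup>2) * (\<epsilon> / (4 * (1 + c\<^sup>2)))"
      using k(2) by (intro mult_strict_left_mono) (simp_all add: add_pos_nonneg)
    also have "\<dots> = \<epsilon> / 4"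
      using add_pos_nonneg[of 1 "c\<^sup>2"] by (simp add: field_simps)
    finally show ?thesis using g(2) by simp
  qed
  finally show "\<exists>g L. sq_lipschitz L g \<and> (LINT \<eta>|\<sigma>. (f \<eta> + c * h \<eta> - g \<eta>)\<^sup>2) < \<epsilon>"
    using lip by blast
qed

lemma approximable_zero: "approximable (\<lambda>_. 0)"
  unfolding approximable_def
  by (auto intro!: exI[of _ "\<lambda>_. 0"] exI[of _ 0] simp: sq_lipschitz_def)

lemma approximable_nonneg:
  assumes "f \<in> borel_measurable \<sigma>" "\<And>\<eta>. 0 \<le> f \<eta>"
  shows "square_integrable \<sigma> f \<longrightarrow> approximable f"
  using assms
proof (induction f rule: borel_measurable_induct_real)
  case (set A)
  then show ?case
    using approximable_all_events[of A] unfolding approximable_def approximable_event_def by blast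
next
  case (mult u c)
  show ?case
  proof (cases "c = 0")
    case True
    then show ?thesis using approximable_zero by simp
  next
    case False
    have "square_integrable \<sigma> u" if "square_integrable \<sigma> (\<lambda>x. c * u x)"
      using square_integrable_scale[OF that, of "1 / c"] False by simp
    then show ?thesis
      using mult.IH approximable_combination[OF sigma.square_integrable_const[of 0] approximable_zero, of u c]
      by simp
  qed
next
  case (add u v)
  show ?case
  proof
    assume uv: "square_integrable \<sigma> (\<lambda>x. v x + u x)"
    have "square_integrable \<sigma> u" "square_integrable \<sigma> v"
      by (rule square_integrable_dominated[OF uv]; use add.hyps in simp)+
    then show "approximable (\<lambda>x. v x + u x)"
      using approximable_combination[of v u 1] add.IH by simp
  qed
next
  case (seq U)
  show ?case
  proof
    assume f: "square_integrable \<sigma> f"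
    have le: "U n x \<le> f x" if "x \<in> space \<sigma>" for n x
      using seq.hyps(3) seq.hyps(4)[OF that] by (intro incseq_le) (auto simp: incseq_def le_fun_def)
    have U: "square_integrable \<sigma> (U n)" for n
      by (rule square_integrable_dominated[OF f]) (use seq.hyps le in \<open>auto intro: order_trans[OF le]\<close>)
    have m: "f \<in> borel_measurable \<sigma>" by (rule square_integrable_measurable[OF f])
    have "(\<lambda>n. LINT \<eta>|\<sigma>. (f \<eta> - U n \<eta>)\<^sup>2) \<longlonglongrightarrow> (LINT \<eta>|\<sigma>. (0::real))"
    proof (rule integral_dominated_convergence[where w="\<lambda>\<eta>. (f \<eta>)\<^sup>2"])
      show "integrable \<sigma> (\<lambda>\<eta>. (f \<eta>)\<^sup>2)" by (rule square_integrable_square[OF f])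
      show "(\<lambda>\<eta>. (f \<eta> - U n \<eta>)\<^sup>2) \<in> borel_measurable \<sigma>" for n
        using m seq.hyps(1) by (intro borel_measurable_power borel_measurable_diff)
      show "AE \<eta> in \<sigma>. (\<lambda>n. (f \<eta> - U n \<eta>)\<^sup>2) \<longlonglongrightarrow> 0"
      proof (rule AE_I2)
        fix \<eta> assume "\<eta> \<in> space \<sigma>"
        from tendsto_power[OF tendsto_diff[OF tendsto_const[of "f \<eta>"] seq.hyps(4)[OF this]], of 2]
        show "(\<lambda>n. (f \<eta> - U n \<eta>)\<^sup>2) \<longlonglongrightarrow> 0" by simp
      qed
      show "AE \<eta> in \<sigma>. norm ((f \<eta> - U n \<eta>)\<^sup>2) \<le> (f \<eta>)\<^sup>2" for n
      proof (rule AE_I2)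
        fix \<eta> assume "\<eta> \<in> space \<sigma>"
        then have "0 \<le> f \<eta> - U n \<eta>" "f \<eta> - U n \<eta> \<le> f \<eta>" using le[of \<eta> n] seq.hyps(2)[of n \<eta>] by simp_all
        then show "norm ((f \<eta> - U n \<eta>)\<^sup>2) \<le> (f \<eta>)\<^sup>2" by (simp add: power_mono)
      qed
    qed simp
    then show "approximable f"
      using approximable_limit[OF f U] seq.IH U by simp
  qed
qed

lemma approximable_L2:
  assumes f: "square_integrable \<sigma> f"
  shows "approximable f"
proof -
  have m: "f \<in> borel_measurable \<sigma>" by (rule square_integrable_measurable[OF f])
  have p: "square_integrable \<sigma> (\<lambda>\<eta>. max 0 (f \<eta>))" "square_integrable \<sigma> (\<lambda>\<eta>. max 0 (- f \<eta>))"
    using m by (auto intro!: square_integrable_dominated[OF f] borel_measurable_max)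
  have "approximable (\<lambda>\<eta>. max 0 (f \<eta>) + (-1) * max 0 (- f \<eta>))"
    by (rule approximable_combination[OF p(1) _ p(2)])
       (use p approximable_nonneg[OF square_integrable_measurable[OF p(1)]]
          approximable_nonneg[OF square_integrable_measurable[OF p(2)]] in simp_all)
  moreover have "max 0 (f \<eta>) + (-1) * max 0 (- f \<eta>) = f \<eta>" for \<eta> by (simp add: max_def)
  ultimately show ?thesis by (simp only:)
qed

lemma energy_add_le:
  assumes ij: "distinct_sites i j" and w: "bounded_weight w" "\<And>\<eta>. \<eta> \<in> S \<Longrightarrow> 0 \<le> w \<eta>"
    and f: "square_integrable \<sigma> f" and g: "square_integrable \<sigma> g"
  shows "energy w i j (\<lambda>\<eta>. f \<eta> + g \<eta>) \<le> 2 * energy w i j f + 2 * energy w i j g"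
proof -
  note i1 = integrable_energy[OF ij w(1) f] and i2 = integrable_energy[OF ij w(1) g]
    and i3 = integrable_energy[OF ij w(1) square_integrable_add[OF f g]]
  have "energy w i j (\<lambda>\<eta>. f \<eta> + g \<eta>) \<le> (LINT p|Q. 2 * (w (fst p) * (f (fst p) - f (moved i j p))\<^sup>2)
      + 2 * (w (fst p) * (g (fst p) - g (moved i j p))\<^sup>2))"
    unfolding energy_def
  proof (rule integral_mono[OF i3])
    show "integrable Q (\<lambda>p. 2 * (w (fst p) * (f (fst p) - f (moved i j p))\<^sup>2)
      + 2 * (w (fst p) * (g (fst p) - g (moved i j p))\<^sup>2))" using i1 i2 by simp
    fix p assume "p \<in> space Q"
    then have "0 \<le> w (fst p)" using w(2) fst_in_simplex by simp
    from mult_left_mono[OF square_add_le[of "f (fst p) - f (moved i j p)" "g (fst p) - g (moved i j p)"] this]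
    show "w (fst p) * (f (fst p) + g (fst p) - (f (moved i j p) + g (moved i j p)))\<^sup>2
      \<le> 2 * (w (fst p) * (f (fst p) - f (moved i j p))\<^sup>2) + 2 * (w (fst p) * (g (fst p) - g (moved i j p))\<^sup>2)"
      by (simp add: algebra_simps)
  qed
  then show ?thesis using i1 i2 by (simp add: energy_def)
qed

text \<open>The energy at constant rates is a bounded quadratic form, so the Poincare inequality passes to
limits.\<close>

lemma uniform_energy_le:
  assumes f: "square_integrable \<sigma> f"
  shows "uniform_energy f \<le> 4 * real (card pairs) * (LINT \<eta>|\<sigma>. (f \<eta>)\<^sup>2)"
proof -
  have "energy (\<lambda>_. 1) (fst q) (snd q) f \<le> 4 * (LINT \<eta>|\<sigma>. (f \<eta>)\<^sup>2)" if "q \<in> pairs" for q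
  proof -
    note ij = pairs_sites[OF that]
    note i1 = square_integrable_square[OF square_integrable_fst[OF f]]
      and i2 = square_integrable_square[OF square_integrable_moved[OF ij f]]
    have m: "(\<lambda>\<eta>. (f \<eta>)\<^sup>2) \<in> borel_measurable \<sigma>"
      using square_integrable_measurable[OF f] by simp
    have "energy (\<lambda>_. 1) (fst q) (snd q) f \<le> (LINT p|Q. 2 * (f (fst p))\<^sup>2 + 2 * (f (moved (fst q) (snd q) p))\<^sup>2)"
      unfolding energy_def mult_1 using i1 i2 square_add_le[of "f _" "- f _"]
      by (intro integral_mono integrable_increment ij f) simp_all
    also have "\<dots> = 2 * (LINT \<eta>|\<sigma>. (f \<eta>)\<^sup>2) + 2 * (LINT \<eta>|\<sigma>. (f \<eta>)\<^sup>2)"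
      using i1 i2 integral_fst[OF m] integral_moved[OF ij m] by simp
    finally show ?thesis by simp
  qed
  then have "uniform_energy f \<le> (\<Sum>q\<in>pairs. 4 * (LINT \<eta>|\<sigma>. (f \<eta>)\<^sup>2))"
    unfolding uniform_energy_pairs by (rule sum_mono)
  then show ?thesis by (simp add: mult_ac)
qed

lemma energy_shift: "energy w i j (\<lambda>\<eta>. f \<eta> - c) = energy w i j f"
  by (simp add: energy_def)

lemma variance_le:
  assumes f: "square_integrable \<sigma> f"
  shows "(LINT \<eta>|\<sigma>. (f \<eta>)\<^sup>2) - (LINT \<eta>|\<sigma>. f \<eta>)\<^sup>2 \<le> (LINT \<eta>|\<sigma>. (f \<eta> - c)\<^sup>2)"
proof -
  let ?m = "LINT \<eta>|\<sigma>. f \<eta>"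
  have "(LINT \<eta>|\<sigma>. (f \<eta> - c)\<^sup>2) = (LINT \<eta>|\<sigma>. (f \<eta>)\<^sup>2 - 2 * c * f \<eta> + c\<^sup>2)"
    by (intro Bochner_Integration.integral_cong) (simp_all add: power2_diff mult_ac)
  also have "\<dots> = (LINT \<eta>|\<sigma>. (f \<eta>)\<^sup>2) - 2 * c * ?m + c\<^sup>2"
    using square_integrable_square[OF f] sigma.square_integrable_integrable[OF f] sigma.prob_space by simp
  finally show ?thesis using zero_le_power2[of "?m - c"] by (simp add: power2_diff mult_ac)
qed

text \<open>Density only has to provide the inequality up to a constant, which allows the use of
\<open>(a + b)\<^sup>2 \<le> 2 a\<^sup>2 + 2 b\<^sup>2\<close> in place of continuity; this is why 3 becomes 12.\<close>

lemma poincare_uniform: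
  assumes f: "square_integrable \<sigma> f"
  shows "real N * ((LINT \<eta>|\<sigma>. (f \<eta>)\<^sup>2) - (LINT \<eta>|\<sigma>. f \<eta>)\<^sup>2) \<le> 12 * uniform_energy f"
proof -
  let ?V = "(LINT \<eta>|\<sigma>. (f \<eta>)\<^sup>2) - (LINT \<eta>|\<sigma>. f \<eta>)\<^sup>2"
  let ?K = "48 * real (card pairs) + 2 * real N"
  have K: "0 < ?K" using N_ge_2 by (simp add: add_nonneg_pos)
  \<comment> \<open>The factor by which the squared approximation error enters the estimate is \<open>?K\<close>.\<close>
  have "real N * ?V \<le> 12 * uniform_energy f + e" if e: "0 < e" for e
  proof -
    have "0 < e / ?K" using e K by simp
    then obtain g L where g: "sq_lipschitz L g" and err: "(LINT \<eta>|\<sigma>. (f \<eta> - g \<eta>)\<^sup>2) < e / ?K"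
      using approximable_L2[OF f] unfolding approximable_def by blast
    let ?h = "\<lambda>\<eta>. g \<eta> - f \<eta>"
    let ?r = "LINT \<eta>|\<sigma>. (f \<eta> - g \<eta>)\<^sup>2"
    have g2: "square_integrable \<sigma> g" by (rule square_integrable_lipschitz[OF g])
    have h2: "square_integrable \<sigma> ?h" by (rule square_integrable_diff[OF g2 f])
    let ?m = "LINT \<eta>|\<sigma>. g \<eta>"
    have lip: "sq_lipschitz L (\<lambda>\<eta>. g \<eta> - ?m)"
      by (rule sq_lipschitz_shift(2)[OF g])
    have "(LINT \<eta>|\<sigma>. g \<eta> - ?m) = 0"
      using sigma.square_integrable_integrable[OF g2] sigma.prob_space by simp
    from poincare_lipschitz_centred[OF lip this]
    have G: "real N * (LINT \<eta>|\<sigma>. (g \<eta> - ?m)\<^sup>2) \<le> 3 * uniform_energy g"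
      by (simp add: total_energy_def energy_shift)
    have "?V \<le> (LINT \<eta>|\<sigma>. (f \<eta> - ?m)\<^sup>2)" by (rule variance_le[OF f])
    also have "\<dots> \<le> 2 * ?r + 2 * (LINT \<eta>|\<sigma>. (g \<eta> - ?m)\<^sup>2)"
      by (rule approximation_step[OF f g2 sigma.square_integrable_const])
    finally have V: "real N * ?V \<le> real N * (2 * ?r + 2 * (LINT \<eta>|\<sigma>. (g \<eta> - ?m)\<^sup>2))"
      by (intro mult_left_mono) simp_all
    have "uniform_energy g \<le> 2 * uniform_energy f + 2 * uniform_energy ?h"
    proof -
      have "uniform_energy g = uniform_energy (\<lambda>\<eta>. f \<eta> + ?h \<eta>)" by simp
      also have "\<dots> \<le> (\<Sum>q\<in>pairs. 2 * energy (\<lambda>_. 1) (fst q) (snd q) f + 2 * energy (\<lambda>_. 1) (fst q) (snd q) ?h)"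
        unfolding uniform_energy_pairs
        by (intro sum_mono energy_add_le pairs_sites bounded_const f h2) simp_all
      finally show ?thesis by (simp add: uniform_energy_pairs sum.distrib sum_distrib_left)
    qed
    also have "uniform_energy ?h \<le> 4 * real (card pairs) * ?r"
      using uniform_energy_le[OF h2] by (simp add: power2_commute)
    finally have "uniform_energy g \<le> 2 * uniform_energy f + 8 * real (card pairs) * ?r" by simp
    then have "real N * ?V \<le> 12 * uniform_energy f + ?K * ?r"
      using V G by (simp add: algebra_simps)
    also have "?K * ?r \<le> e" using err K by (simp add: field_simps)
    finally show ?thesis by simp
  qed
  then show ?thesis by (rule field_le_epsilon)
qed

end

section \<open>Exchanges through a third particle\<close>

lemma ennreal_half_half: "ennreal (1/2) * ennreal (1/2) = ennreal (1/4)"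
  by (subst ennreal_mult[symmetric]) (simp_all del: ennreal_divide_numeral)

lemma ennreal_four_quarters: "4 * (x * ennreal (1/4)) = x" for x :: ennreal
proof -
  have "(4::ennreal) * ennreal (1/4) = ennreal 4 * ennreal (1/4)" by (simp only: ennreal_numeral)
  also have "\<dots> = ennreal (4 * (1/4))" by (rule ennreal_mult[symmetric]) simp_all
  finally have "(4::ennreal) * ennreal (1/4) = 1" by simp
  then show ?thesis by (metis mult.left_commute mult.right_neutral)
qed

lemma ennreal_two_halves: "2 * x * ennreal (1/2) = x" for x :: ennreal
proof -
  have "(2::ennreal) * ennreal (1/2) = ennreal 2 * ennreal (1/2)" by (simp only: ennreal_numeral)
  also have "\<dots> = ennreal (2 * (1/2))" by (rule ennreal_mult[symmetric]) simp_all
  finally have "(2::ennreal) * ennreal (1/2) = 1" by simp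
  then show ?thesis by (metis mult.assoc mult.commute mult.right_neutral)
qed

lemma ennreal_double_sum:
  "0 \<le> x \<Longrightarrow> 0 \<le> y \<Longrightarrow> ennreal (2 * x + 2 * y) = 2 * ennreal x + 2 * ennreal y"
  by (simp add: ennreal_plus ennreal_mult)

lemma nn_integral_linear_combination:
  assumes [measurable]: "f \<in> borel_measurable M" "g \<in> borel_measurable M"
  shows "(\<integral>\<^sup>+x. c * f x + d * g x \<partial>M) = c * (\<integral>\<^sup>+x. f x \<partial>M) + d * (\<integral>\<^sup>+x. g x \<partial>M)"
  by (simp add: nn_integral_add nn_integral_cmult)

definition half_lebesgue :: "real measure" where
  "half_lebesgue = restrict_space lborel {0..1/2}"

lemma space_half_lebesgue [simp]: "space half_lebesgue = {0..1/2}"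
  by (simp add: half_lebesgue_def)

lemma measurable_half_lebesgue: "(\<lambda>x. x) \<in> borel_measurable half_lebesgue"
  by (simp add: half_lebesgue_def measurable_restrict_space1)

lemma finite_half_lebesgue: "finite_measure half_lebesgue"
  by (rule finite_measureI) (simp add: half_lebesgue_def emeasure_restrict_space)

lemma emeasure_half_lebesgue: "emeasure half_lebesgue {0..1/2} = ennreal (1/2)"
  by (simp add: half_lebesgue_def emeasure_restrict_space)

lemma measurable_half_rescale:
  assumes "1/2 \<le> c"
  shows "(\<lambda>a. a / c) \<in> measurable half_lebesgue unit_lebesgue"
  unfolding unit_lebesgue_def
proof (rule measurable_restrict_space2)
  show "(\<lambda>a. a / c) \<in> space half_lebesgue \<rightarrow> {0..1}"
    using assms by (auto simp: field_simps)
  show "(\<lambda>a. a / c) \<in> measurable half_lebesgue lborel"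
    using measurable_half_lebesgue by simp
qed

text \<open>The interval from 0 to 1/2 is contained in the one from 0 to c, on which Lebesgue measure is c times
the law of \<open>c * \<alpha>\<close> for uniform \<open>\<alpha>\<close>.\<close>

lemma nn_integral_half_rescale:
  assumes F: "F \<in> borel_measurable unit_lebesgue" and c: "1/2 \<le> c" "c \<le> 1"
  shows "(\<integral>\<^sup>+a. F (a / c) \<partial>half_lebesgue) \<le> (\<integral>\<^sup>+\<alpha>. F \<alpha> \<partial>unit_lebesgue)"
proof -
  have "(\<integral>\<^sup>+a. F (a / c) \<partial>half_lebesgue) = (\<integral>\<^sup>+a. F (a / c) * indicator {0..1/2} a \<partial>lborel)"
    by (simp add: half_lebesgue_def nn_integral_restrict_space)
  also have "\<dots> \<le> (\<integral>\<^sup>+a. F (a / c) * indicator {0..c} a \<partial>lborel)"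
    using c by (intro nn_integral_mono) (auto split: split_indicator)
  also have "\<dots> = ennreal c * (\<integral>\<^sup>+\<alpha>. F \<alpha> \<partial>unit_lebesgue)"
    by (rule nn_integral_unit_scale[OF F]) (use c in auto)
  also have "\<dots> \<le> 1 * (\<integral>\<^sup>+\<alpha>. F \<alpha> \<partial>unit_lebesgue)"
    using c by (intro mult_right_mono) simp_all
  finally show ?thesis by simp
qed

interpretation half: finite_measure half_lebesgue
  by (rule finite_half_lebesgue)

context exchange_model
begin

definition triple_sum :: "nat \<Rightarrow> nat \<Rightarrow> nat \<Rightarrow> (nat \<Rightarrow> real) \<Rightarrow> real" where
  "triple_sum i j k \<eta> = \<eta> i + \<eta> j + \<eta> k"

text \<open>Particles i and j receive the fractions a and b of the energy of the triple, and k the rest. The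
result depends on \<open>\<eta>\<close> only through what an exchange of i and j preserves, so it serves as a common
reference for a configuration and its resampling at i and j.\<close>

definition reference_point :: "nat \<Rightarrow> nat \<Rightarrow> nat \<Rightarrow> real \<Rightarrow> real \<Rightarrow> (nat \<Rightarrow> real) \<Rightarrow> (nat \<Rightarrow> real)" where
  "reference_point i j k a b \<eta> = \<eta>(i := a * triple_sum i j k \<eta>, j := b * triple_sum i j k \<eta>,
     k := (1 - a - b) * triple_sum i j k \<eta>)"

text \<open>The energy as an extended nonnegative number, which spares integrability side conditions for
functions evaluated at reference points.\<close>

definition nn_energy :: "((nat \<Rightarrow> real) \<Rightarrow> real) \<Rightarrow> nat \<Rightarrow> nat \<Rightarrow> ((nat \<Rightarrow> real) \<Rightarrow> real) \<Rightarrow> ennreal" where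
  "nn_energy w i j f
     = (\<integral>\<^sup>+\<eta>. (\<integral>\<^sup>+\<alpha>. ennreal (w \<eta> * (f \<eta> - f (exchange i j \<alpha> \<eta>))\<^sup>2) \<partial>unit_lebesgue) \<partial>\<sigma>)"

lemma measurable_increment_curried:
  assumes ij: "distinct_sites i j" and w: "w \<in> borel_measurable \<sigma>" and f: "f \<in> borel_measurable \<sigma>"
  shows "(\<lambda>(\<eta>, \<alpha>). ennreal (w \<eta> * (f \<eta> - f (exchange i j \<alpha> \<eta>))\<^sup>2)) \<in> borel_measurable Q"
proof -
  note [measurable] = measurable_moved[OF ij] w f
  have "(\<lambda>p. ennreal (w (fst p) * (f (fst p) - f (moved i j p))\<^sup>2)) \<in> borel_measurable Q"
    by measurable
  then show ?thesis by (simp add: case_prod_beta)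
qed

lemma nn_energy_eq:
  assumes ij: "distinct_sites i j" and w: "bounded_weight w" "\<And>\<eta>. \<eta> \<in> S \<Longrightarrow> 0 \<le> w \<eta>" and f: "square_integrable \<sigma> f"
  shows "nn_energy w i j f = ennreal (energy w i j f)"
proof -
  have "nn_energy w i j f = (\<integral>\<^sup>+p. ennreal (w (fst p) * (f (fst p) - f (moved i j p))\<^sup>2) \<partial>Q)"
    using nn_integral_Q[OF measurable_increment_curried[OF ij bounded_weight_measurable[OF w(1)]
        square_integrable_measurable[OF f]]]
    by (simp add: nn_energy_def case_prod_beta)
  also have "\<dots> = ennreal (energy w i j f)"
    unfolding energy_def
    by (rule nn_integral_eq_integral[OF integrable_energy[OF ij w(1) f]])
       (use w(2) fst_in_simplex in \<open>auto intro!: AE_I2\<close>)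
  finally show ?thesis .
qed

lemma reference_point_in_simplex:
  assumes ij: "distinct_sites i j" "distinct_sites i k" "distinct_sites j k" and \<eta>: "\<eta> \<in> S" and a: "a \<in> {0..1/2}" and b: "b \<in> {0..1/2}"
  shows "reference_point i j k a b \<eta> \<in> S"
proof -
  have T: "0 \<le> triple_sum i j k \<eta>"
    using ij \<eta> by (simp add: triple_sum_def simplex_iff distinct_sites_def)
  have split: "(\<Sum>l=1..N. z l) = z i + z j + z k + (\<Sum>l\<in>{1..N} - {i} - {j} - {k}. z l)" for z :: "nat \<Rightarrow> real"
    using ij by (simp add: distinct_sites_def sum.remove[of "{1..N}" i] sum.remove[of "{1..N} - {i}" j]
        sum.remove[of "{1..N} - {i} - {j}" k])
  have "(\<Sum>l=1..N. reference_point i j k a b \<eta> l) = (\<Sum>l=1..N. \<eta> l)"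
    unfolding split using distinct_sitesD(3)[OF ij(1)] distinct_sitesD(3)[OF ij(2)] distinct_sitesD(3)[OF ij(3)]
    by (simp add: reference_point_def triple_sum_def algebra_simps)
  then show ?thesis
    using ij \<eta> T a b by (auto simp: simplex_iff reference_point_def distinct_sites_def extensional_def)
qed

lemma measurable_reference_point:
  assumes ij: "distinct_sites i j" "distinct_sites i k" "distinct_sites j k"
  shows "(\<lambda>x. reference_point i j k (snd (fst x)) (snd x) (fst (fst x)))
    \<in> measurable ((\<sigma> \<Otimes>\<^sub>M half_lebesgue) \<Otimes>\<^sub>M half_lebesgue) \<sigma>"
proof (rule measurable_into_sigma)
  let ?M = "(\<sigma> \<Otimes>\<^sub>M half_lebesgue) \<Otimes>\<^sub>M half_lebesgue"
  have [measurable]: "(\<lambda>x. fst (fst x) l) \<in> borel_measurable ?M" for l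
    by (rule measurable_compose[OF measurable_compose[OF measurable_fst measurable_fst] measurable_coordinate])
  have [measurable]: "(\<lambda>x. snd (fst x)) \<in> borel_measurable ?M" "(\<lambda>x. snd x) \<in> borel_measurable ?M"
    by (rule measurable_compose[OF measurable_compose[OF measurable_fst measurable_snd] measurable_half_lebesgue],
        rule measurable_compose[OF measurable_snd measurable_half_lebesgue])
  fix l
  show "(\<lambda>x. reference_point i j k (snd (fst x)) (snd x) (fst (fst x)) l) \<in> borel_measurable ?M"
    by (cases "l = k"; cases "l = j"; cases "l = i"; simp add: reference_point_def triple_sum_def)
qed (use reference_point_in_simplex[OF ij] in \<open>auto simp: space_pair_measure\<close>)

lemma reference_point_exchange:
  assumes "distinct_sites i j" "distinct_sites i k" "distinct_sites j k"
  shows "reference_point i j k a b (exchange i j \<alpha> \<eta>) = reference_point i j k a b \<eta>"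
proof -
  have "triple_sum i j k (exchange i j \<alpha> \<eta>) = triple_sum i j k \<eta>"
    using assms by (simp add: triple_sum_def exchange_def distinct_sites_def algebra_simps)
  then show ?thesis using assms by (auto simp: reference_point_def exchange_def distinct_sites_def)
qed

text \<open>The rate of the whole triple, on the event that k holds more than half of its energy. Only there is
the direct exchange of i and j too slow.\<close>

definition reservoir_weight :: "real \<Rightarrow> nat \<Rightarrow> nat \<Rightarrow> nat \<Rightarrow> (nat \<Rightarrow> real) \<Rightarrow> real" where
  "reservoir_weight \<gamma> i j k \<eta> =
     (if triple_sum i j k \<eta> < 2 * \<eta> k then triple_sum i j k \<eta> powr \<gamma> else 0)"

lemma triple_sum_bounds:
  assumes "distinct_sites i j" "distinct_sites i k" "distinct_sites j k" "\<eta> \<in> S"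
  shows "0 \<le> triple_sum i j k \<eta>" "triple_sum i j k \<eta> \<le> 3 * real N"
  using assms simplex_coordinate[OF assms(4), of i] simplex_coordinate[OF assms(4), of j]
    simplex_coordinate[OF assms(4), of k]
  by (auto simp: triple_sum_def distinct_sites_def)

lemma bounded_triple_powr:
  assumes ij: "distinct_sites i j" "distinct_sites i k" "distinct_sites j k" and \<gamma>: "0 \<le> \<gamma>"
  shows "bounded_weight (\<lambda>\<eta>. triple_sum i j k \<eta> powr \<gamma>)" "bounded_weight (reservoir_weight \<gamma> i j k)"
proof -
  have [measurable]: "(\<lambda>\<eta>. triple_sum i j k \<eta>) \<in> borel_measurable \<sigma>"
    unfolding triple_sum_def by measurable
  have le: "triple_sum i j k \<eta> powr \<gamma> \<le> (3 * real N) powr \<gamma>" if "\<eta> \<in> S" for \<eta>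
    using triple_sum_bounds[OF ij that] \<gamma> by (intro powr_mono2)
  show "bounded_weight (\<lambda>\<eta>. triple_sum i j k \<eta> powr \<gamma>)"
    by (rule bounded_weightI[where B="(3 * real N) powr \<gamma>"]) (use le in auto)
  show "bounded_weight (reservoir_weight \<gamma> i j k)"
  proof (rule bounded_weightI[where B="(3 * real N) powr \<gamma>"])
    show "reservoir_weight \<gamma> i j k \<in> borel_measurable \<sigma>"
      unfolding reservoir_weight_def[abs_def] by measurable
  qed (use le in \<open>auto simp: reservoir_weight_def\<close>)
qed

lemma half_power_bound:
  fixes x y :: real
  assumes "0 \<le> \<gamma>" "\<gamma> \<le> 1" "0 \<le> x" "x \<le> 2 * y"
  shows "x powr \<gamma> \<le> 2 * y powr \<gamma>"
proof -
  have y: "0 \<le> y" using assms by simp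
  have "x powr \<gamma> \<le> (2 * y) powr \<gamma>" using assms by (intro powr_mono2) simp_all
  also have "\<dots> = 2 powr \<gamma> * y powr \<gamma>" using y by (simp add: powr_mult)
  also have "2 powr \<gamma> \<le> (2::real)" using powr_mono[of \<gamma> 1 "2::real"] assms by simp
  finally show ?thesis by (simp add: mult_right_mono)
qed

text \<open>The path to a reference point: the exchange of i with k sets the energy of i, then the exchange of
j with k sets that of j. Both are possible because a, b and the fraction of j are at most 1/2.
The denominators of the proportions \<open>a / c\<close> and \<open>b / (1 - a)\<close> lie between 1/2 and 1, as
\<open>nn_integral_half_rescale\<close> requires.\<close>

lemma reservoir_path:
  assumes ij: "distinct_sites i j" "distinct_sites i k" "distinct_sites j k"
    and T: "0 < triple_sum i j k \<eta>" and big: "triple_sum i j k \<eta> < 2 * \<eta> k" and \<eta>: "\<eta> \<in> S"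
    and a: "a \<in> {0..1/2}" and b: "b \<in> {0..1/2}"
  defines "c \<equiv> (\<eta> i + \<eta> k) / triple_sum i j k \<eta>"
  shows "1/2 \<le> c" "c \<le> 1"
    "exchange j k (b / (1 - a)) (exchange i k (a / c) \<eta>) = reference_point i j k a b \<eta>"
    "exchange i k (a / c) \<eta> j + exchange i k (a / c) \<eta> k = (1 - a) * triple_sum i j k \<eta>"
proof -
  let ?T = "triple_sum i j k \<eta>"
  have nn: "0 \<le> \<eta> i" "0 \<le> \<eta> j" "0 \<le> \<eta> k" using ij \<eta> by (auto simp: distinct_sites_def simplex_iff)
  have ne: "i \<noteq> j" "i \<noteq> k" "j \<noteq> k" using ij by (auto simp: distinct_sites_def)
  show "1/2 \<le> c" "c \<le> 1"
    using T big nn by (simp_all add: c_def triple_sum_def field_simps)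
  then have cT: "\<eta> i + \<eta> k = c * ?T" "c \<noteq> 0" using T by (auto simp: c_def)
  have \<eta>j: "\<eta> j = (1 - c) * ?T" using cT(1) by (simp add: triple_sum_def algebra_simps)
  have e: "exchange i k (a / c) \<eta> i = a * ?T" "exchange i k (a / c) \<eta> k = (c - a) * ?T"
    "exchange i k (a / c) \<eta> j = (1 - c) * ?T"
    "\<And>l. l \<noteq> i \<Longrightarrow> l \<noteq> k \<Longrightarrow> exchange i k (a / c) \<eta> l = \<eta> l"
    using ne cT \<eta>j by (simp_all add: exchange_def field_simps)
  show s: "exchange i k (a / c) \<eta> j + exchange i k (a / c) \<eta> k = (1 - a) * ?T"
    by (simp only: e) (simp add: algebra_simps)
  have a1: "1 - a \<noteq> 0" using a by auto
  have "exchange j k (b / (1 - a)) (exchange i k (a / c) \<eta>)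
      = (exchange i k (a / c) \<eta>)(j := b / (1 - a) * ((1 - a) * ?T), k := (1 - b / (1 - a)) * ((1 - a) * ?T))"
    unfolding exchange_def[of j k] s ..
  also have "\<dots> = reference_point i j k a b \<eta>"
  proof
    fix l
    have "(1 - b / (1 - a)) * ((1 - a) * ?T) = (1 - a - b) * ?T" using a1 by (simp add: field_simps)
    moreover have "b / (1 - a) * ((1 - a) * ?T) = b * ?T" using a1 by simp
    ultimately show "((exchange i k (a / c) \<eta>)(j := b / (1 - a) * ((1 - a) * ?T),
        k := (1 - b / (1 - a)) * ((1 - a) * ?T))) l = reference_point i j k a b \<eta> l"
      using ne e by (simp add: reference_point_def)
  qed
  finally show "exchange j k (b / (1 - a)) (exchange i k (a / c) \<eta>) = reference_point i j k a b \<eta>" .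
qed

text \<open>A configuration and its resampling at i and j are both compared with the same random reference
point, and each of these comparisons follows the path through k. Before either exchange on the
path the pair concerned holds at least half of the energy of the triple, so its rate is comparable
to the rate of the triple.\<close>

lemma nn_energy_reservoir:
  assumes ij: "distinct_sites i j" "distinct_sites i k" "distinct_sites j k" and \<gamma>: "0 \<le> \<gamma>" "\<gamma> \<le> 1" and f: "f \<in> borel_measurable \<sigma>"
  shows "nn_energy (reservoir_weight \<gamma> i j k) i j f
    \<le> 32 * nn_energy (pair_rate \<gamma> i k) i k f + 64 * nn_energy (pair_rate \<gamma> j k) j k f"
proof -
  let ?w = "reservoir_weight \<gamma> i j k" and ?\<tau> = "reference_point i j k"
  let ?F = "\<lambda>\<eta> a b. ennreal (?w \<eta> * (f \<eta> - f (?\<tau> a b \<eta>))\<^sup>2)"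
  define R where "R \<eta> = (\<integral>\<^sup>+a. (\<integral>\<^sup>+b. ?F \<eta> a b \<partial>half_lebesgue) \<partial>half_lebesgue)" for \<eta>
  define G1 where "G1 \<eta> = (\<integral>\<^sup>+\<alpha>. ennreal (2 * pair_rate \<gamma> i k \<eta> * (f \<eta> - f (exchange i k \<alpha> \<eta>))\<^sup>2) \<partial>unit_lebesgue)" for \<eta>
  define G2 where "G2 \<eta> = (\<integral>\<^sup>+\<alpha>. ennreal (2 * pair_rate \<gamma> j k \<eta> * (f \<eta> - f (exchange j k \<alpha> \<eta>))\<^sup>2) \<partial>unit_lebesgue)" for \<eta>
  have [measurable]: "f \<in> borel_measurable \<sigma>" "?w \<in> borel_measurable \<sigma>"
    "pair_rate \<gamma> i k \<in> borel_measurable \<sigma>" "pair_rate \<gamma> j k \<in> borel_measurable \<sigma>"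
    using f bounded_triple_powr(2)[OF ij \<gamma>(1)] bounded_pair_rate[OF ij(2) \<gamma>(1)] bounded_pair_rate[OF ij(3) \<gamma>(1)]
    by (auto simp: bounded_weight_def)
  have m3: "(\<lambda>x. ?F (fst (fst x)) (snd (fst x)) (snd x))
      \<in> borel_measurable ((\<sigma> \<Otimes>\<^sub>M half_lebesgue) \<Otimes>\<^sub>M half_lebesgue)"
    using measurable_reference_point[OF ij] by measurable
  have m2: "(\<lambda>x. \<integral>\<^sup>+b. ?F (fst x) (snd x) b \<partial>half_lebesgue) \<in> borel_measurable (\<sigma> \<Otimes>\<^sub>M half_lebesgue)"
    using half.borel_measurable_nn_integral_fst[OF m3] by simp
  have R[measurable]: "R \<in> borel_measurable \<sigma>"
    unfolding R_def using half.borel_measurable_nn_integral_fst[OF m2] by simp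
  have mF: "(\<lambda>b. ?F \<eta> a b) \<in> borel_measurable half_lebesgue"
    "(\<lambda>a. \<integral>\<^sup>+b. ?F \<eta> a b \<partial>half_lebesgue) \<in> borel_measurable half_lebesgue"
    if "\<eta> \<in> S" "a \<in> {0..1/2}" for \<eta> a
    using measurable_Pair2[OF m3, of "(\<eta>, a)"] measurable_Pair2[OF m2, of \<eta>] that
    by (simp_all add: space_pair_measure)
  have mG1: "(\<lambda>\<eta>. 2 * pair_rate \<gamma> i k \<eta>) \<in> borel_measurable \<sigma>"
    and mG2: "(\<lambda>\<eta>. 2 * pair_rate \<gamma> j k \<eta>) \<in> borel_measurable \<sigma>" by measurable
  have G[measurable]: "G1 \<in> borel_measurable \<sigma>" "G2 \<in> borel_measurable \<sigma>"
    unfolding G1_def[abs_def] G2_def[abs_def]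
    by (rule unit.borel_measurable_nn_integral[OF measurable_increment_curried[OF ij(2) mG1 f]],
        rule unit.borel_measurable_nn_integral[OF measurable_increment_curried[OF ij(3) mG2 f]])
  have intG: "(\<integral>\<^sup>+\<eta>. G1 \<eta> \<partial>\<sigma>) = 2 * nn_energy (pair_rate \<gamma> i k) i k f"
    "(\<integral>\<^sup>+\<eta>. G2 \<eta> \<partial>\<sigma>) = 2 * nn_energy (pair_rate \<gamma> j k) j k f"
  proof -
    have "nn_energy (\<lambda>\<eta>. 2 * pair_rate \<gamma> x y \<eta>) x y f = 2 * nn_energy (pair_rate \<gamma> x y) x y f"
      if xy: "distinct_sites x y" for x y
    proof -
      have [measurable]: "pair_rate \<gamma> x y \<in> borel_measurable \<sigma>"
        using bounded_pair_rate[OF xy \<gamma>(1)] by (simp add: bounded_weight_def)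
      have "pair_rate \<gamma> x y \<in> borel_measurable \<sigma>" by measurable
      note m = measurable_increment_curried[OF xy this f]
      have "nn_energy (\<lambda>\<eta>. 2 * pair_rate \<gamma> x y \<eta>) x y f
          = (\<integral>\<^sup>+\<eta>. (\<integral>\<^sup>+\<alpha>. 2 * ennreal (pair_rate \<gamma> x y \<eta> * (f \<eta> - f (exchange x y \<alpha> \<eta>))\<^sup>2) \<partial>unit_lebesgue) \<partial>\<sigma>)"
        unfolding nn_energy_def by (simp add: ennreal_mult pair_rate_def mult.assoc)
      also have "\<dots> = (\<integral>\<^sup>+\<eta>. 2 * (\<integral>\<^sup>+\<alpha>. ennreal (pair_rate \<gamma> x y \<eta> * (f \<eta> - f (exchange x y \<alpha> \<eta>))\<^sup>2) \<partial>unit_lebesgue) \<partial>\<sigma>)"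
        by (intro nn_integral_cong nn_integral_cmult) (use measurable_Pair2[OF m] in auto)
      also have "\<dots> = 2 * nn_energy (pair_rate \<gamma> x y) x y f"
        unfolding nn_energy_def
        by (rule nn_integral_cmult[OF unit.borel_measurable_nn_integral[OF m]])
      finally show ?thesis .
    qed
    from this[OF ij(2)] this[OF ij(3)]
    show "(\<integral>\<^sup>+\<eta>. G1 \<eta> \<partial>\<sigma>) = 2 * nn_energy (pair_rate \<gamma> i k) i k f"
      "(\<integral>\<^sup>+\<eta>. G2 \<eta> \<partial>\<sigma>) = 2 * nn_energy (pair_rate \<gamma> j k) j k f"
      by (simp_all add: nn_energy_def G1_def G2_def)
  qed
  have half_const: "(\<integral>\<^sup>+a. (\<integral>\<^sup>+b. x \<partial>half_lebesgue) \<partial>half_lebesgue) = x * ennreal (1/4)" for x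
    by (simp only: nn_integral_const space_half_lebesgue emeasure_half_lebesgue mult.assoc ennreal_half_half)

  \<comment> \<open>Averaging over the square of reference points, of area 1/4, costs a factor 4, the
    triangle inequality a factor 2, and the two configurations, both with the law \<open>\<sigma>\<close>,
    another factor 2.\<close>
  have step1: "nn_energy ?w i j f \<le> 16 * (\<integral>\<^sup>+\<eta>. R \<eta> \<partial>\<sigma>)"
  proof -
    have pt: "ennreal (?w \<eta> * (f \<eta> - f (exchange i j \<alpha> \<eta>))\<^sup>2) \<le> 8 * R \<eta> + 8 * R (exchange i j \<alpha> \<eta>)"
      if \<eta>: "\<eta> \<in> S" and \<alpha>: "\<alpha> \<in> {0..1}" for \<eta> \<alpha>
    proof -
      let ?\<xi> = "exchange i j \<alpha> \<eta>"
      have \<xi>: "?\<xi> \<in> S" by (rule exchange_in_simplex[OF distinct_sitesD[OF ij(1)] \<eta> \<alpha>])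
      have w: "?w ?\<xi> = ?w \<eta>" "0 \<le> ?w \<eta>"
        using ij by (simp_all add: reservoir_weight_def triple_sum_def exchange_pair_sum distinct_sites_def)
          (simp add: exchange_def)
      have "ennreal (?w \<eta> * (f \<eta> - f ?\<xi>)\<^sup>2) \<le> 2 * ?F \<eta> a b + 2 * ?F ?\<xi> a b" for a b
      proof -
        have "(f \<eta> - f ?\<xi>)\<^sup>2 \<le> 2 * (f \<eta> - f (?\<tau> a b \<eta>))\<^sup>2 + 2 * (f ?\<xi> - f (?\<tau> a b \<eta>))\<^sup>2"
          using square_add_le[of "f \<eta> - f (?\<tau> a b \<eta>)" "f (?\<tau> a b \<eta>) - f ?\<xi>"]
          by (simp add: power2_commute)
        from mult_left_mono[OF this w(2)]
        have "?w \<eta> * (f \<eta> - f ?\<xi>)\<^sup>2 \<le> 2 * (?w \<eta> * (f \<eta> - f (?\<tau> a b \<eta>))\<^sup>2)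
            + 2 * (?w ?\<xi> * (f ?\<xi> - f (?\<tau> a b ?\<xi>))\<^sup>2)"
          by (simp add: w(1) reference_point_exchange[OF ij] algebra_simps)
        from ennreal_leI[OF this] show ?thesis
          using w by (simp add: ennreal_plus ennreal_mult)
      qed
      then have "(\<integral>\<^sup>+a. (\<integral>\<^sup>+b. ennreal (?w \<eta> * (f \<eta> - f ?\<xi>)\<^sup>2) \<partial>half_lebesgue) \<partial>half_lebesgue)
          \<le> (\<integral>\<^sup>+a. (\<integral>\<^sup>+b. 2 * ?F \<eta> a b + 2 * ?F ?\<xi> a b \<partial>half_lebesgue) \<partial>half_lebesgue)"
        by (intro nn_integral_mono)
      also have "\<dots> = (\<integral>\<^sup>+a. 2 * (\<integral>\<^sup>+b. ?F \<eta> a b \<partial>half_lebesgue) + 2 * (\<integral>\<^sup>+b. ?F ?\<xi> a b \<partial>half_lebesgue) \<partial>half_lebesgue)"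
        by (intro nn_integral_cong nn_integral_linear_combination mF \<eta> \<xi>) simp_all
      also have "\<dots> = 2 * R \<eta> + 2 * R ?\<xi>"
        unfolding R_def by (rule nn_integral_linear_combination; rule mF(2)[of _ 0]) (simp_all add: \<eta> \<xi>)
      finally have le: "ennreal (?w \<eta> * (f \<eta> - f ?\<xi>)\<^sup>2) * ennreal (1/4) \<le> 2 * R \<eta> + 2 * R ?\<xi>"
        unfolding half_const .
      have "ennreal (?w \<eta> * (f \<eta> - f ?\<xi>)\<^sup>2) = 4 * (ennreal (?w \<eta> * (f \<eta> - f ?\<xi>)\<^sup>2) * ennreal (1/4))"
        by (rule ennreal_four_quarters[symmetric])
      also have "\<dots> \<le> 4 * (2 * R \<eta> + 2 * R ?\<xi>)" by (intro mult_left_mono le) simp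
      also have "\<dots> = 8 * R \<eta> + 8 * R ?\<xi>" by (simp add: distrib_left mult.assoc[symmetric])
      finally show ?thesis .
    qed
    have mR: "(\<lambda>(\<eta>, \<alpha>). R (exchange i j \<alpha> \<eta>)) \<in> borel_measurable Q"
      by (rule measurable_exchange_curried[OF distinct_sitesD[OF ij(1)] R])
    have "nn_energy ?w i j f
        \<le> (\<integral>\<^sup>+\<eta>. (\<integral>\<^sup>+\<alpha>. 8 * R \<eta> + 8 * R (exchange i j \<alpha> \<eta>) \<partial>unit_lebesgue) \<partial>\<sigma>)"
      unfolding nn_energy_def using pt by (intro nn_integral_mono) simp
    also have "\<dots> = (\<integral>\<^sup>+\<eta>. 8 * R \<eta> + 8 * (\<integral>\<^sup>+\<alpha>. R (exchange i j \<alpha> \<eta>) \<partial>unit_lebesgue) \<partial>\<sigma>)"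
    proof (intro nn_integral_cong)
      fix \<eta> assume \<eta>: "\<eta> \<in> space \<sigma>"
      have "(\<lambda>\<alpha>. R (exchange i j \<alpha> \<eta>)) \<in> borel_measurable unit_lebesgue"
        using measurable_Pair2[OF mR \<eta>] by simp
      then show "(\<integral>\<^sup>+\<alpha>. 8 * R \<eta> + 8 * R (exchange i j \<alpha> \<eta>) \<partial>unit_lebesgue)
          = 8 * R \<eta> + 8 * (\<integral>\<^sup>+\<alpha>. R (exchange i j \<alpha> \<eta>) \<partial>unit_lebesgue)"
        using nn_integral_linear_combination[of "\<lambda>_. R \<eta>" unit_lebesgue "\<lambda>\<alpha>. R (exchange i j \<alpha> \<eta>)" 8 8]
          unit.emeasure_space_1 by simp
    qed
    also have "\<dots> = 8 * (\<integral>\<^sup>+\<eta>. R \<eta> \<partial>\<sigma>) + 8 * (\<integral>\<^sup>+\<eta>. (\<integral>\<^sup>+\<alpha>. R (exchange i j \<alpha> \<eta>) \<partial>unit_lebesgue) \<partial>\<sigma>)"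
      by (rule nn_integral_linear_combination[OF R measurable_nn_average[OF distinct_sitesD[OF ij(1)] R]])
    also have "\<dots> = 8 * (\<integral>\<^sup>+\<eta>. R \<eta> \<partial>\<sigma>) + 8 * (\<integral>\<^sup>+\<eta>. R \<eta> \<partial>\<sigma>)"
      by (simp only: nn_integral_exchange[OF distinct_sitesD[OF ij(1)] R])
    also have "\<dots> = 16 * (\<integral>\<^sup>+\<eta>. R \<eta> \<partial>\<sigma>)" by (simp add: distrib_right[symmetric])
    finally show ?thesis .
  qed

  \<comment> \<open>The two exchanges on the path.\<close>
  have step2: "R \<eta> \<le> G1 \<eta> + 2 * (\<integral>\<^sup>+\<alpha>. G2 (exchange i k \<alpha> \<eta>) \<partial>unit_lebesgue)" if \<eta>: "\<eta> \<in> S" for \<eta>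
  proof (cases "0 < triple_sum i j k \<eta> \<and> triple_sum i j k \<eta> < 2 * \<eta> k")
    case False
    then have "?w \<eta> = 0" using triple_sum_bounds(1)[OF ij \<eta>] by (auto simp: reservoir_weight_def)
    then show ?thesis by (simp add: R_def)
  next
    case True
    let ?T = "triple_sum i j k \<eta>"
    define c where "c = (\<eta> i + \<eta> k) / ?T"
    note path = reservoir_path[OF ij True[THEN conjunct1] True[THEN conjunct2] \<eta>, folded c_def]
    have c: "1/2 \<le> c" "c \<le> 1" using path(1,2)[of 0 0] by simp_all
    define \<xi> where "\<xi> a = exchange i k (a / c) \<eta>" for a
    define A where "A \<alpha> = ennreal (2 * pair_rate \<gamma> i k \<eta> * (f \<eta> - f (exchange i k \<alpha> \<eta>))\<^sup>2)" for \<alpha>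
    define B where "B a \<beta> = ennreal (2 * pair_rate \<gamma> j k (\<xi> a) * (f (\<xi> a) - f (exchange j k \<beta> (\<xi> a)))\<^sup>2)" for a \<beta>
    have mA: "A \<in> borel_measurable unit_lebesgue"
      using measurable_Pair2[OF measurable_increment_curried[OF ij(2) mG1 f], of \<eta>] \<eta>
      by (simp add: A_def[abs_def])
    have \<xi>S: "\<xi> a \<in> S" if "a \<in> {0..1/2}" for a
      unfolding \<xi>_def using that c by (intro exchange_in_simplex distinct_sitesD[OF ij(2)] \<eta>) (auto simp: field_simps)
    have mB: "B a \<in> borel_measurable unit_lebesgue" if "a \<in> {0..1/2}" for a
      using measurable_Pair2[OF measurable_increment_curried[OF ij(3) mG2 f], of "\<xi> a"]
        \<xi>S[OF that] by (simp add: B_def[abs_def])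
    have mA': "(\<lambda>a. A (a / c)) \<in> borel_measurable half_lebesgue"
      by (rule measurable_compose[OF measurable_half_rescale[OF c(1)] mA])
    have "(\<lambda>(\<eta>, \<alpha>). G2 (exchange i k \<alpha> \<eta>)) \<in> borel_measurable Q"
      by (rule measurable_exchange_curried[OF distinct_sitesD[OF ij(2)] G(2)])
    from measurable_Pair2[OF this, of \<eta>]
    have mG3: "(\<lambda>\<alpha>. G2 (exchange i k \<alpha> \<eta>)) \<in> borel_measurable unit_lebesgue" using \<eta> by simp
    have mG2': "(\<lambda>a. G2 (\<xi> a)) \<in> borel_measurable half_lebesgue"
      unfolding \<xi>_def by (rule measurable_compose[OF measurable_half_rescale[OF c(1)] mG3])
    have pt: "?F \<eta> a b \<le> 2 * A (a / c) + 2 * B a (b / (1 - a))" if a: "a \<in> {0..1/2}" and b: "b \<in> {0..1/2}" for a b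
    proof -
      have \<tau>: "?\<tau> a b \<eta> = exchange j k (b / (1 - a)) (\<xi> a)" using path(3)[OF a b] by (simp add: \<xi>_def)
      have w: "?w \<eta> = ?T powr \<gamma>" using True by (simp add: reservoir_weight_def)
      have wA: "?w \<eta> \<le> 2 * pair_rate \<gamma> i k \<eta>"
        unfolding w pair_rate_def using True c(1) \<gamma> by (intro half_power_bound) (simp_all add: c_def field_simps)
      have wB: "?w \<eta> \<le> 2 * pair_rate \<gamma> j k (\<xi> a)"
        unfolding w pair_rate_def \<xi>_def path(4)[OF a b] using True a \<gamma>
        by (intro half_power_bound) (simp_all add: field_simps)
      have "?w \<eta> * (f \<eta> - f (?\<tau> a b \<eta>))\<^sup>2
          \<le> ?w \<eta> * (2 * (f \<eta> - f (\<xi> a))\<^sup>2 + 2 * (f (\<xi> a) - f (?\<tau> a b \<eta>))\<^sup>2)"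
        using square_add_le[of "f \<eta> - f (\<xi> a)" "f (\<xi> a) - f (?\<tau> a b \<eta>)"] w
        by (intro mult_left_mono) simp_all
      also have "\<dots> = 2 * (?w \<eta> * (f \<eta> - f (\<xi> a))\<^sup>2) + 2 * (?w \<eta> * (f (\<xi> a) - f (?\<tau> a b \<eta>))\<^sup>2)"
        by (simp add: algebra_simps)
      also have "\<dots> \<le> 2 * (2 * pair_rate \<gamma> i k \<eta> * (f \<eta> - f (\<xi> a))\<^sup>2)
          + 2 * (2 * pair_rate \<gamma> j k (\<xi> a) * (f (\<xi> a) - f (?\<tau> a b \<eta>))\<^sup>2)"
        using wA wB by (intro add_mono mult_left_mono mult_right_mono) simp_all
      finally have "?w \<eta> * (f \<eta> - f (?\<tau> a b \<eta>))\<^sup>2 \<le> 2 * (2 * pair_rate \<gamma> i k \<eta> * (f \<eta> - f (\<xi> a))\<^sup>2)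
          + 2 * (2 * pair_rate \<gamma> j k (\<xi> a) * (f (\<xi> a) - f (?\<tau> a b \<eta>))\<^sup>2)" .
      from ennreal_leI[OF this] show ?thesis
        unfolding A_def B_def \<tau> \<xi>_def[symmetric]
        by (subst (asm) ennreal_double_sum) (simp_all add: pair_rate_def)
    qed
    have inner: "(\<integral>\<^sup>+b. ?F \<eta> a b \<partial>half_lebesgue) \<le> A (a / c) + 2 * G2 (\<xi> a)" if a: "a \<in> {0..1/2}" for a
    proof -
      have c2: "1/2 \<le> 1 - a" "1 - a \<le> 1" using a by auto
      have mB': "(\<lambda>b. B a (b / (1 - a))) \<in> borel_measurable half_lebesgue"
        by (rule measurable_compose[OF measurable_half_rescale[OF c2(1)] mB[OF a]])
      have "(\<integral>\<^sup>+b. ?F \<eta> a b \<partial>half_lebesgue) \<le> (\<integral>\<^sup>+b. 2 * A (a / c) + 2 * B a (b / (1 - a)) \<partial>half_lebesgue)"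
        using pt[OF a] by (intro nn_integral_mono) simp
      also have "\<dots> = 2 * A (a / c) * ennreal (1/2) + 2 * (\<integral>\<^sup>+b. B a (b / (1 - a)) \<partial>half_lebesgue)"
        using nn_integral_linear_combination[OF _ mB', of "\<lambda>_. A (a / c)" 2 2, OF borel_measurable_const]
        by (simp only: nn_integral_const space_half_lebesgue emeasure_half_lebesgue mult.assoc)
      also have "2 * A (a / c) * ennreal (1/2) = A (a / c)"
        by (rule ennreal_two_halves)
      also have "(\<integral>\<^sup>+b. B a (b / (1 - a)) \<partial>half_lebesgue) \<le> (\<integral>\<^sup>+\<beta>. B a \<beta> \<partial>unit_lebesgue)"
        by (rule nn_integral_half_rescale[OF mB[OF a] c2])
      also have "\<dots> = G2 (\<xi> a)" by (simp add: B_def G2_def)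
      finally show ?thesis by (simp add: add_left_mono mult_left_mono)
    qed
    have "R \<eta> \<le> (\<integral>\<^sup>+a. A (a / c) + 2 * G2 (\<xi> a) \<partial>half_lebesgue)"
      unfolding R_def using inner by (intro nn_integral_mono) simp
    also have "\<dots> = (\<integral>\<^sup>+a. A (a / c) \<partial>half_lebesgue) + 2 * (\<integral>\<^sup>+a. G2 (\<xi> a) \<partial>half_lebesgue)"
      using nn_integral_linear_combination[OF mA' mG2', of 1 2] by simp
    also have "\<dots> \<le> (\<integral>\<^sup>+\<alpha>. A \<alpha> \<partial>unit_lebesgue) + 2 * (\<integral>\<^sup>+\<alpha>. G2 (exchange i k \<alpha> \<eta>) \<partial>unit_lebesgue)"
      unfolding \<xi>_def by (intro add_mono mult_left_mono nn_integral_half_rescale mA mG3 c) simp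
    also have "(\<integral>\<^sup>+\<alpha>. A \<alpha> \<partial>unit_lebesgue) = G1 \<eta>" by (simp add: A_def G1_def)
    finally show ?thesis .
  qed

  have "(\<integral>\<^sup>+\<eta>. R \<eta> \<partial>\<sigma>) \<le> (\<integral>\<^sup>+\<eta>. G1 \<eta> + 2 * (\<integral>\<^sup>+\<alpha>. G2 (exchange i k \<alpha> \<eta>) \<partial>unit_lebesgue) \<partial>\<sigma>)"
    using step2 by (intro nn_integral_mono) simp
  also have "\<dots> = (\<integral>\<^sup>+\<eta>. G1 \<eta> \<partial>\<sigma>) + 2 * (\<integral>\<^sup>+\<eta>. (\<integral>\<^sup>+\<alpha>. G2 (exchange i k \<alpha> \<eta>) \<partial>unit_lebesgue) \<partial>\<sigma>)"
    using nn_integral_linear_combination[OF G(1) measurable_nn_average[OF distinct_sitesD[OF ij(2)] G(2)], of 1 2] by simp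
  also have "\<dots> = 2 * nn_energy (pair_rate \<gamma> i k) i k f + 4 * nn_energy (pair_rate \<gamma> j k) j k f"
    by (simp add: nn_integral_exchange[OF distinct_sitesD[OF ij(2)] G(2)] intG mult.assoc[symmetric])
  finally have "16 * (\<integral>\<^sup>+\<eta>. R \<eta> \<partial>\<sigma>)
      \<le> 16 * (2 * nn_energy (pair_rate \<gamma> i k) i k f + 4 * nn_energy (pair_rate \<gamma> j k) j k f)"
    by (intro mult_left_mono) simp_all
  also have "\<dots> = 32 * nn_energy (pair_rate \<gamma> i k) i k f + 64 * nn_energy (pair_rate \<gamma> j k) j k f"
    by (simp add: distrib_left mult.assoc[symmetric])
  finally show ?thesis using step1 by simp
qed

lemma pair_rate_nonneg: "0 \<le> pair_rate \<gamma> i j \<eta>" by (simp add: pair_rate_def)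

lemma energy_add_weight:
  assumes "distinct_sites i j" "bounded_weight v" "bounded_weight w" "square_integrable \<sigma> f"
  shows "energy (\<lambda>\<eta>. v \<eta> + w \<eta>) i j f = energy v i j f + energy w i j f"
  unfolding energy_def using integrable_energy[OF assms(1,2,4)] integrable_energy[OF assms(1,3,4)]
  by (simp add: distrib_right)

text \<open>Either i and j together hold at least half of the energy of the triple and exchange fast enough
themselves, or k serves as a reservoir.\<close>

lemma triple_comparison:
  assumes ij: "distinct_sites i j" "distinct_sites i k" "distinct_sites j k" and \<gamma>: "0 \<le> \<gamma>" "\<gamma> \<le> 1" and f: "square_integrable \<sigma> f"
  shows "energy (\<lambda>\<eta>. triple_sum i j k \<eta> powr \<gamma>) i j f
    \<le> 64 * (energy (pair_rate \<gamma> i j) i j f + energy (pair_rate \<gamma> i k) i k f + energy (pair_rate \<gamma> j k) j k f)"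
proof -
  let ?E = "\<lambda>x y. energy (pair_rate \<gamma> x y) x y f"
  have E0: "0 \<le> ?E x y" for x y by (rule energy_nonneg) (simp add: pair_rate_nonneg)
  note bw = bounded_triple_powr[OF ij \<gamma>(1)]
  have bp: "bounded_weight (\<lambda>\<eta>. 2 * pair_rate \<gamma> i j \<eta>)"
    by (rule bounded_weight_scale[OF bounded_pair_rate[OF ij(1) \<gamma>(1)]])
  have bs: "bounded_weight (\<lambda>\<eta>. 2 * pair_rate \<gamma> i j \<eta> + reservoir_weight \<gamma> i j k \<eta>)"
    by (rule bounded_weight_add[OF bp bw(2)])
  have "energy (\<lambda>\<eta>. triple_sum i j k \<eta> powr \<gamma>) i j f
      \<le> energy (\<lambda>\<eta>. 2 * pair_rate \<gamma> i j \<eta> + reservoir_weight \<gamma> i j k \<eta>) i j f"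
  proof (rule energy_mono[OF ij(1) f bw(1) bs])
    fix \<eta> assume \<eta>: "\<eta> \<in> S"
    have T: "0 \<le> triple_sum i j k \<eta>" by (rule triple_sum_bounds[OF ij \<eta>])
    show "triple_sum i j k \<eta> powr \<gamma> \<le> 2 * pair_rate \<gamma> i j \<eta> + reservoir_weight \<gamma> i j k \<eta>"
    proof (cases "triple_sum i j k \<eta> < 2 * \<eta> k")
      case False
      then have "triple_sum i j k \<eta> powr \<gamma> \<le> 2 * (\<eta> i + \<eta> j) powr \<gamma>"
        using T \<gamma> by (intro half_power_bound) (simp_all add: triple_sum_def)
      then show ?thesis using False by (simp add: reservoir_weight_def pair_rate_def)
    qed (simp add: reservoir_weight_def pair_rate_nonneg)
  qed
  also have "\<dots> = 2 * ?E i j + energy (reservoir_weight \<gamma> i j k) i j f"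
    using energy_add_weight[OF ij(1) bp bw(2) f] energy_scale[of 2] by simp
  also have "energy (reservoir_weight \<gamma> i j k) i j f \<le> 32 * ?E i k + 64 * ?E j k"
  proof -
    have "ennreal (energy (reservoir_weight \<gamma> i j k) i j f) \<le> 32 * ennreal (?E i k) + 64 * ennreal (?E j k)"
      using nn_energy_reservoir[OF ij \<gamma> square_integrable_measurable[OF f]]
        nn_energy_eq[OF ij(1) bw(2) _ f] nn_energy_eq[OF ij(2) bounded_pair_rate[OF ij(2) \<gamma>(1)] _ f]
        nn_energy_eq[OF ij(3) bounded_pair_rate[OF ij(3) \<gamma>(1)] _ f]
      by (simp add: pair_rate_nonneg reservoir_weight_def)
    also have "\<dots> = ennreal (32 * ?E i k + 64 * ?E j k)"
      using E0 by (simp add: ennreal_plus ennreal_mult)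
    finally show ?thesis using E0 by (subst (asm) ennreal_le_iff) simp_all
  qed
  finally show ?thesis using E0[of i j] E0[of i k] by simp
qed

definition power_mean :: "real \<Rightarrow> (nat \<Rightarrow> real) \<Rightarrow> real" where
  "power_mean \<gamma> \<eta> = (\<Sum>k=1..N. \<eta> k powr \<gamma>) / real N"

lemma power_mean_nonneg: "0 \<le> power_mean \<gamma> \<eta>"
  by (simp add: power_mean_def sum_nonneg)

lemma bounded_power_mean:
  assumes "0 \<le> \<gamma>"
  shows "bounded_weight (power_mean \<gamma>)"
proof (rule bounded_weightI)
  show "power_mean \<gamma> \<in> borel_measurable \<sigma>" unfolding power_mean_def[abs_def] by measurable
  fix \<eta> assume \<eta>: "\<eta> \<in> S"
  have "(\<Sum>k=1..N. \<eta> k powr \<gamma>) \<le> (\<Sum>k=1..N. real N powr \<gamma>)"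
    using simplex_coordinate[OF \<eta>] assms by (intro sum_mono powr_mono2) auto
  then show "\<bar>power_mean \<gamma> \<eta>\<bar> \<le> real N powr \<gamma>"
    using power_mean_nonneg[of \<gamma> \<eta>] N_ge_2 by (simp add: power_mean_def field_simps)
qed

text \<open>The term \<open>\<eta> k powr \<gamma>\<close> is bounded by the term of the triple containing k, and
\<open>\<eta> i powr \<gamma>\<close>, \<open>\<eta> j powr \<gamma>\<close> by the term of any triple; at least one exists when N is 3 or more.\<close>

lemma power_mean_le_triples:
  assumes ij: "distinct_sites i j" and N: "3 \<le> N" and \<gamma>: "0 \<le> \<gamma>" and \<eta>: "\<eta> \<in> S"
  shows "real N * power_mean \<gamma> \<eta> \<le> 3 * (\<Sum>k\<in>{1..N} - {i} - {j}. triple_sum i j k \<eta> powr \<gamma>)"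
proof -
  let ?J = "{1..N} - {i} - {j}" and ?X = "\<Sum>k\<in>{1..N} - {i} - {j}. triple_sum i j k \<eta> powr \<gamma>"
  have nn: "0 \<le> \<eta> i" "0 \<le> \<eta> j" "\<And>k. k \<in> ?J \<Longrightarrow> 0 \<le> \<eta> k" using ij \<eta> by (auto simp: distinct_sites_def simplex_iff)
  have "card ?J = N - 2" using ij by (simp add: distinct_sites_def)
  then have "0 < card ?J" using N by simp
  then have "?J \<noteq> {}" unfolding card_gt_0_iff by (rule conjunct1)
  then obtain k0 where k0: "k0 \<in> ?J" by blast
  have "triple_sum i j k0 \<eta> powr \<gamma> \<le> ?X" using k0 by (intro member_le_sum) auto
  moreover have "\<eta> i powr \<gamma> \<le> triple_sum i j k0 \<eta> powr \<gamma>" "\<eta> j powr \<gamma> \<le> triple_sum i j k0 \<eta> powr \<gamma>"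
    using nn(1,2) nn(3)[OF k0] \<gamma> by (intro powr_mono2; simp add: triple_sum_def)+
  moreover have "(\<Sum>k\<in>?J. \<eta> k powr \<gamma>) \<le> ?X"
    using nn \<gamma> by (intro sum_mono powr_mono2) (auto simp: triple_sum_def)
  moreover have "real N * power_mean \<gamma> \<eta> = \<eta> i powr \<gamma> + \<eta> j powr \<gamma> + (\<Sum>k\<in>?J. \<eta> k powr \<gamma>)"
    using ij N_ge_2 by (simp add: power_mean_def distinct_sites_def sum.remove[of "{1..N}" i] sum.remove[of "{1..N} - {i}" j])
  ultimately show ?thesis by linarith
qed

lemma energy_sum_weight:
  assumes ij: "distinct_sites i j" and f: "square_integrable \<sigma> f" and w: "\<And>k. k \<in> K \<Longrightarrow> bounded_weight (w k)"
  shows "energy (\<lambda>\<eta>. \<Sum>k\<in>K. w k \<eta>) i j f = (\<Sum>k\<in>K. energy (w k) i j f)"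
proof -
  have "energy (\<lambda>\<eta>. \<Sum>k\<in>K. w k \<eta>) i j f = (LINT p|Q. (\<Sum>k\<in>K. w k (fst p) * (f (fst p) - f (moved i j p))\<^sup>2))"
    by (simp add: energy_def sum_distrib_right)
  also have "\<dots> = (\<Sum>k\<in>K. energy (w k) i j f)"
    unfolding energy_def by (rule Bochner_Integration.integral_sum) (rule integrable_energy[OF ij w f])
  finally show ?thesis .
qed

text \<open>Sum the comparison over all triples. Replacing the rate by \<open>power_mean \<gamma>\<close> makes it the same for all
pairs, which is what the constant-rate inequality needs.\<close>

lemma power_mean_energy_le:
  assumes \<gamma>: "0 \<le> \<gamma>" "\<gamma> \<le> 1" and f: "square_integrable \<sigma> f"
  shows "total_energy (\<lambda>_ _. power_mean \<gamma>) f \<le> 576 * total_energy (pair_rate \<gamma>) f"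
proof -
  define E where "E i j = (if i = j then 0 else energy (pair_rate \<gamma> i j) i j f)" for i j
  have E0: "0 \<le> E i j" for i j
    unfolding E_def using energy_nonneg[of "pair_rate \<gamma> i j" i j f] by (simp add: pair_rate_nonneg)
  have row: "(\<Sum>j=1..N. E i j) = (\<Sum>j\<in>{1..N} - {i}. energy (pair_rate \<gamma> i j) i j f)" if "i \<in> {1..N}" for i
    using that by (simp add: sum.remove[of "{1..N}" i] E_def)
  have total: "total_energy (pair_rate \<gamma>) f = (\<Sum>i=1..N. \<Sum>j=1..N. E i j)"
    unfolding total_energy_def by (rule sum.cong[OF refl]) (simp only: row)
  note bm = bounded_power_mean[OF \<gamma>(1)]
  have pair: "real N * energy (power_mean \<gamma>) i j f
      \<le> 192 * (real N * E i j + (\<Sum>k=1..N. E i k) + (\<Sum>k=1..N. E j k))" if ij: "distinct_sites i j" for i j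
  proof (cases "3 \<le> N")
    case True
    let ?J = "{1..N} - {i} - {j}"
    have trip: "distinct_sites i k" "distinct_sites j k" if "k \<in> ?J" for k using that ij by (auto simp: distinct_sites_def)
    have bt: "bounded_weight (\<lambda>\<eta>. triple_sum i j k \<eta> powr \<gamma>)" if "k \<in> ?J" for k
      by (rule bounded_triple_powr(1)[OF ij trip[OF that] \<gamma>(1)])
    have "real N * energy (power_mean \<gamma>) i j f = energy (\<lambda>\<eta>. real N * power_mean \<gamma> \<eta>) i j f"
      by (simp add: energy_scale)
    also have "\<dots> \<le> energy (\<lambda>\<eta>. 3 * (\<Sum>k\<in>?J. triple_sum i j k \<eta> powr \<gamma>)) i j f"
      by (intro energy_mono[OF ij f] bounded_weight_scale bm bounded_weight_sum bt
          power_mean_le_triples[OF ij True \<gamma>(1)])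
    also have "\<dots> = 3 * (\<Sum>k\<in>?J. energy (\<lambda>\<eta>. triple_sum i j k \<eta> powr \<gamma>) i j f)"
      by (simp only: energy_scale energy_sum_weight[OF ij f bt])
    also have "\<dots> \<le> 3 * (\<Sum>k\<in>?J. 64 * (E i j + E i k + E j k))"
    proof (intro mult_left_mono sum_mono)
      fix k assume k: "k \<in> ?J"
      have "i \<noteq> j" "i \<noteq> k" "j \<noteq> k" using k ij by (auto simp: distinct_sites_def)
      then show "energy (\<lambda>\<eta>. triple_sum i j k \<eta> powr \<gamma>) i j f \<le> 64 * (E i j + E i k + E j k)"
        using triple_comparison[OF ij trip[OF k] \<gamma> f] by (simp add: E_def)
    qed simp
    also have "\<dots> \<le> 3 * (\<Sum>k=1..N. 64 * (E i j + E i k + E j k))"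
      using E0 by (intro mult_left_mono sum_mono2) auto
    also have "\<dots> = 192 * (real N * E i j + (\<Sum>k=1..N. E i k) + (\<Sum>k=1..N. E j k))"
      by (simp add: sum.distrib sum_distrib_left[symmetric])
    finally show ?thesis .
  next
    \<comment> \<open>Two particles have no reservoir, but their rate is bounded below.\<close>
    case False
    then have N: "N = 2" using N_ge_2 by simp
    have "k \<in> {1..N} \<longleftrightarrow> k \<in> {i, j}" for k
      using distinct_sitesD[OF ij] unfolding N by simp presburger
    then have set: "{1..N} = {i, j}" by (rule set_eqI)
    have ne: "i \<noteq> j" using ij by (simp add: distinct_sites_def)
    have "energy (power_mean \<gamma>) i j f \<le> energy (pair_rate \<gamma> i j) i j f"
    proof (rule energy_mono[OF ij f bm bounded_pair_rate[OF ij \<gamma>(1)]])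
      fix \<eta> assume "\<eta> \<in> S"
      then have "0 \<le> \<eta> i" "0 \<le> \<eta> j" using ij by (auto simp: distinct_sites_def simplex_iff)
      then have "\<eta> i powr \<gamma> \<le> (\<eta> i + \<eta> j) powr \<gamma>" "\<eta> j powr \<gamma> \<le> (\<eta> i + \<eta> j) powr \<gamma>"
        using \<gamma> by (intro powr_mono2; simp)+
      then show "power_mean \<gamma> \<eta> \<le> pair_rate \<gamma> i j \<eta>"
        using ne unfolding power_mean_def set by (simp add: pair_rate_def N)
    qed
    then have "real N * energy (power_mean \<gamma>) i j f \<le> real N * E i j"
      using ne by (intro mult_left_mono) (simp_all add: E_def)
    also have "\<dots> \<le> 192 * (real N * E i j + (\<Sum>k=1..N. E i k) + (\<Sum>k=1..N. E j k))"
      using mult_nonneg_nonneg[of "real N" "E i j"] E0 sum_nonneg[of "{1..N}" "E i"] sum_nonneg[of "{1..N}" "E j"] by simp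
    finally show ?thesis .
  qed
  let ?T = "\<Sum>i=1..N. \<Sum>j=1..N. E i j"
  have "real N * total_energy (\<lambda>_ _. power_mean \<gamma>) f
      = (\<Sum>i=1..N. \<Sum>j\<in>{1..N} - {i}. real N * energy (power_mean \<gamma>) i j f)"
    by (simp add: total_energy_def sum_distrib_left)
  also have "\<dots> \<le> (\<Sum>i=1..N. \<Sum>j\<in>{1..N} - {i}. 192 * (real N * E i j + (\<Sum>k=1..N. E i k) + (\<Sum>k=1..N. E j k)))"
    by (intro sum_mono pair) (auto simp: distinct_sites_def)
  also have "\<dots> \<le> (\<Sum>i=1..N. \<Sum>j=1..N. 192 * (real N * E i j + (\<Sum>k=1..N. E i k) + (\<Sum>k=1..N. E j k)))"
    using E0 by (intro sum_mono sum_mono2) (auto intro!: add_nonneg_nonneg sum_nonneg)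
  also have "\<dots> = 192 * (real N * ?T + real N * ?T + real N * ?T)"
    by (simp add: sum.distrib sum_distrib_left[symmetric])
  finally have "real N * total_energy (\<lambda>_ _. power_mean \<gamma>) f \<le> real N * (576 * ?T)" by simp
  then show ?thesis using N_ge_2 by (simp add: total)
qed

end

section \<open>Poincare inequalities at degenerate rates\<close>

text \<open>Each summand satisfies \<open>u * (x + y) powr (a - 1) \<le> u powr a\<close>, the exponent \<open>a - 1\<close> being
nonpositive.\<close>

lemma powr_subadditive:
  fixes x y :: real
  assumes "0 \<le> x" "0 \<le> y" "0 \<le> a" "a \<le> 1"
  shows "(x + y) powr a \<le> x powr a + y powr a"
proof -
  have part: "u * t powr (a - 1) \<le> u powr a" if "0 \<le> u" "u \<le> t" for u t :: real
  proof (cases "u = 0")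
    case False
    then have u: "0 < u" using that by simp
    have "u * t powr (a - 1) \<le> u * u powr (a - 1)"
      using u that assms by (intro mult_left_mono powr_mono2') simp_all
    also have "\<dots> = u powr a" using u by (simp add: powr_diff)
    finally show ?thesis .
  qed simp
  show ?thesis
  proof (cases "x + y = 0")
    case True
    then show ?thesis using assms by simp
  next
    case False
    then have "(x + y) powr a = (x + y) * (x + y) powr (a - 1)"
      using assms by (simp add: powr_diff)
    also have "\<dots> = x * (x + y) powr (a - 1) + y * (x + y) powr (a - 1)"
      by (rule distrib_right)
    also have "\<dots> \<le> x powr a + y powr a"
      using assms by (intro add_mono part) simp_all
    finally show ?thesis .
  qed
qed

lemma powr_le_one_plus:
  fixes x :: real
  assumes "0 \<le> x" "0 \<le> a" "a \<le> 1"
  shows "x powr a \<le> 1 + x"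
proof (cases "x \<le> 1")
  case True
  then have "x powr a \<le> 1 powr a" using assms by (intro powr_mono2) simp_all
  then show ?thesis using assms by simp
next
  case False
  then have "x powr a \<le> x powr 1" using assms by (intro powr_mono) simp_all
  then show ?thesis using False by simp
qed

lemma lyapunov_pointwise:
  fixes a b u v :: real
  assumes "0 < u" "0 < v"
  shows "a\<^sup>2 * ((u - v) / u) + b\<^sup>2 * ((v - u) / v) \<le> (a - b)\<^sup>2"
proof -
  have "(a - b)\<^sup>2 - (a\<^sup>2 * ((u - v) / u) + b\<^sup>2 * ((v - u) / v)) = (a * v - b * u)\<^sup>2 / (u * v)"
    using assms by (simp add: field_simps power2_eq_square)
  moreover have "0 \<le> (a * v - b * u)\<^sup>2 / (u * v)" using assms by simp
  ultimately show ?thesis by linarith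
qed

context exchange_model
begin

lemma sum_pairs_coordinates:
  assumes "\<eta> \<in> S"
  shows "(\<Sum>q\<in>pairs. \<eta> (fst q) + \<eta> (snd q)) = 2 * real N * (real N - 1)"
proof -
  have row: "(\<Sum>j\<in>{1..N} - {i}. \<eta> i + \<eta> j) = (real N - 2) * \<eta> i + real N" if "i \<in> {1..N}" for i
    using that sum_coordinates[OF assms] N_ge_2
    by (simp add: sum.distrib sum_diff1 of_nat_diff algebra_simps)
  have "(\<Sum>q\<in>pairs. \<eta> (fst q) + \<eta> (snd q)) = (\<Sum>i=1..N. \<Sum>j\<in>{1..N} - {i}. \<eta> i + \<eta> j)"
    by (rule sum_pairs)
  also have "\<dots> = (\<Sum>i=1..N. (real N - 2) * \<eta> i + real N)"
    by (rule sum.cong[OF refl]) (simp only: row)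
  also have "\<dots> = (real N - 2) * real N + real N * real N"
    using sum_coordinates[OF assms] by (simp add: sum.distrib sum_distrib_left[symmetric])
  finally show ?thesis by (simp add: algebra_simps)
qed

lemma sum_pairs_product_le:
  fixes x y :: "nat \<Rightarrow> real"
  assumes "\<And>k. k \<in> {1..N} \<Longrightarrow> 0 \<le> x k" "\<And>k. k \<in> {1..N} \<Longrightarrow> 0 \<le> y k"
  shows "(\<Sum>q\<in>pairs. x (fst q) * y (snd q)) \<le> (\<Sum>k=1..N. x k) * (\<Sum>k=1..N. y k)"
proof -
  have "(\<Sum>q\<in>pairs. x (fst q) * y (snd q)) = (\<Sum>i=1..N. \<Sum>j\<in>{1..N} - {i}. x i * y j)"
    by (rule sum_pairs)
  also have "\<dots> \<le> (\<Sum>i=1..N. \<Sum>j=1..N. x i * y j)"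
    using assms by (intro sum_mono sum_mono2) auto
  finally show ?thesis by (simp add: sum_product)
qed

lemma sum_pairs_swap: "(\<Sum>q\<in>pairs. T (snd q) (fst q)) = (\<Sum>q\<in>pairs. T (fst q) (snd q))"
  for T :: "nat \<Rightarrow> nat \<Rightarrow> real"
proof -
  have "pairs = prod.swap ` pairs" by (auto simp: pairs_def image_iff)
  then have "(\<Sum>q\<in>pairs. T (fst q) (snd q)) = (\<Sum>q\<in>prod.swap ` pairs. T (fst q) (snd q))" by simp
  also have "\<dots> = (\<Sum>q\<in>pairs. T (snd q) (fst q))" by (subst sum.reindex) auto
  finally show ?thesis ..
qed

lemma power_mean_le_2:
  assumes "\<eta> \<in> S" "0 \<le> a" "a \<le> 1"
  shows "power_mean a \<eta> \<le> 2"
proof -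
  have "(\<Sum>k=1..N. \<eta> k powr a) \<le> (\<Sum>k=1..N. 1 + \<eta> k)"
    using assms by (intro sum_mono powr_le_one_plus) (auto simp: simplex_iff)
  also have "\<dots> = 2 * real N" using sum_coordinates[OF assms(1)] by (simp add: sum.distrib)
  finally show ?thesis using N_ge_2 by (simp add: power_mean_def field_simps)
qed

text \<open>Concavity of the power: \<open>x powr \<gamma> \<ge> x * N powr (\<gamma> - 1)\<close> for x between 0 and N. The bound is attained
when a single particle holds all the energy.\<close>

lemma power_mean_ge:
  assumes \<eta>: "\<eta> \<in> S" and \<gamma>: "0 \<le> \<gamma>" "\<gamma> \<le> 1"
  shows "real N powr (\<gamma> - 1) \<le> power_mean \<gamma> \<eta>"
proof -
  have "(\<Sum>k=1..N. \<eta> k * real N powr (\<gamma> - 1)) \<le> (\<Sum>k=1..N. \<eta> k powr \<gamma>)"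
  proof (rule sum_mono)
    fix k assume k: "k \<in> {1..N}"
    note c = simplex_coordinate[OF \<eta> k]
    show "\<eta> k * real N powr (\<gamma> - 1) \<le> \<eta> k powr \<gamma>"
    proof (cases "\<eta> k = 0")
      case False
      then have "\<eta> k * real N powr (\<gamma> - 1) \<le> \<eta> k * \<eta> k powr (\<gamma> - 1)"
        using c \<gamma> by (intro mult_left_mono powr_mono2') simp_all
      also have "\<dots> = \<eta> k powr \<gamma>" using c False by (simp add: powr_diff)
      finally show ?thesis .
    qed simp
  qed
  then have "real N * real N powr (\<gamma> - 1) \<le> (\<Sum>k=1..N. \<eta> k powr \<gamma>)"
    using sum_coordinates[OF \<eta>] by (simp add: sum_distrib_right[symmetric])
  then show ?thesis using N_ge_2 by (simp add: power_mean_def field_simps)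
qed

lemma total_energy_le_dirichlet:
  assumes \<gamma>: "0 \<le> \<gamma>" and f: "square_integrable \<sigma> f"
  shows "total_energy (pair_rate \<gamma>) f \<le> 2 * real N * dirichlet_form \<gamma> N f"
    and "0 \<le> dirichlet_form \<gamma> N f"
proof -
  let ?W = "total_energy (pair_rate \<gamma>) f"
  have W: "0 \<le> ?W" unfolding total_energy_def by (intro sum_nonneg energy_nonneg pair_rate_nonneg)
  then show "0 \<le> dirichlet_form \<gamma> N f" using N_ge_2 by (simp add: dirichlet_form_eq[OF \<gamma> f])
  have "?W \<le> ?W * (real N / (real N - 1))"
    using N_ge_2 W by (simp add: field_simps)
  also have "\<dots> = 2 * real N * dirichlet_form \<gamma> N f"
    using N_ge_2 by (simp add: dirichlet_form_eq[OF \<gamma> f] field_simps)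
  finally show "?W \<le> 2 * real N * dirichlet_form \<gamma> N f" .
qed

text \<open>Bounding \<open>power_mean \<gamma>\<close> from below by its minimum is sharp enough for \<open>\<gamma> = 1\<close>, and for any bounded
number of particles.\<close>

lemma poincare_crude:
  assumes \<gamma>: "0 \<le> \<gamma>" "\<gamma> \<le> 1" and f: "square_integrable \<sigma> f" and mean: "(LINT \<eta>|\<sigma>. f \<eta>) = 0"
  shows "real N powr (\<gamma> - 1) * (LINT \<eta>|\<sigma>. (f \<eta>)\<^sup>2) \<le> 13824 * dirichlet_form \<gamma> N f"
proof -
  let ?c = "real N powr (\<gamma> - 1)" and ?W = "total_energy (pair_rate \<gamma>) f"
  have "?c * uniform_energy f = (\<Sum>q\<in>pairs. energy (\<lambda>_. ?c * 1) (fst q) (snd q) f)"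
    unfolding uniform_energy_pairs energy_scale by (simp add: sum_distrib_left)
  also have "\<dots> \<le> (\<Sum>q\<in>pairs. energy (power_mean \<gamma>) (fst q) (snd q) f)"
    using power_mean_ge[OF _ \<gamma>]
    by (intro sum_mono energy_mono pairs_sites f bounded_const bounded_power_mean \<gamma>) simp_all
  also have "\<dots> = total_energy (\<lambda>_ _. power_mean \<gamma>) f"
    unfolding total_energy_def by (rule sum_pairs)
  also have "\<dots> \<le> 576 * ?W" by (rule power_mean_energy_le[OF \<gamma> f])
  finally have UE: "?c * uniform_energy f \<le> 576 * ?W" .
  have "?c * (real N * (LINT \<eta>|\<sigma>. (f \<eta>)\<^sup>2)) \<le> ?c * (12 * uniform_energy f)"
    using poincare_uniform[OF f] mean by (intro mult_left_mono) simp_all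
  then have "real N * (?c * (LINT \<eta>|\<sigma>. (f \<eta>)\<^sup>2)) \<le> 6912 * ?W" using UE by (simp add: mult_ac)
  also have "\<dots> \<le> 6912 * (2 * real N * dirichlet_form \<gamma> N f)"
    using total_energy_le_dirichlet(1)[OF \<gamma>(1) f] by simp
  finally have "real N * (?c * (LINT \<eta>|\<sigma>. (f \<eta>)\<^sup>2)) \<le> real N * (13824 * dirichlet_form \<gamma> N f)"
    by (simp add: mult_ac)
  then show ?thesis using N_ge_2 by simp
qed

text \<open>The rate \<open>s powr 0\<close> differs from 1 only at \<open>s = 0\<close>, where an exchange changes nothing.\<close>

lemma poincare_rate_zero:
  assumes f: "square_integrable \<sigma> f" and mean: "(LINT \<eta>|\<sigma>. f \<eta>) = 0"
  shows "(LINT \<eta>|\<sigma>. (f \<eta>)\<^sup>2) \<le> 24 * dirichlet_form 0 N f"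
proof -
  have "energy (\<lambda>_. 1) i j f = energy (pair_rate 0 i j) i j f" if ij: "distinct_sites i j" for i j
    unfolding energy_def
  proof (rule Bochner_Integration.integral_cong[OF refl])
    fix p assume p: "p \<in> space Q"
    show "1 * (f (fst p) - f (moved i j p))\<^sup>2 = pair_rate 0 i j (fst p) * (f (fst p) - f (moved i j p))\<^sup>2"
    proof (cases "fst p i + fst p j = 0")
      case True
      have "0 \<le> fst p i" "0 \<le> fst p j"
        using simplex_coordinate[OF fst_in_simplex[OF p]] ij by (auto simp: distinct_sites_def)
      then have "moved i j p = fst p" using True by (auto simp: exchange_def)
      then show ?thesis by simp
    qed (simp add: pair_rate_def)
  qed
  then have "uniform_energy f = total_energy (pair_rate 0) f"
    unfolding total_energy_def by (auto intro!: sum.cong simp: distinct_sites_def)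
  then have "real N * (LINT \<eta>|\<sigma>. (f \<eta>)\<^sup>2) \<le> 12 * (2 * real N * dirichlet_form 0 N f)"
    using poincare_uniform[OF f] mean total_energy_le_dirichlet(1)[OF order_refl f] by simp
  then show ?thesis using N_ge_2 by simp
qed

text \<open>A bound on the squared change of \<open>power_mean \<gamma>\<close> in one exchange: the change is at most
\<open>2 * s powr \<gamma> / N\<close>, s being the energy of the pair, and \<open>s powr (2 * \<gamma>) \<le> N powr \<gamma> * (1 + s)\<close>. In this form
its sum over all pairs is the same for every configuration.\<close>

definition oscillation_bound :: "real \<Rightarrow> nat \<Rightarrow> nat \<Rightarrow> (nat \<Rightarrow> real) \<Rightarrow> real" where
  "oscillation_bound \<gamma> i j \<eta> = 4 * real N powr \<gamma> / (real N)\<^sup>2 * (1 + \<eta> i + \<eta> j)"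

lemma bounded_oscillation: "distinct_sites i j \<Longrightarrow> bounded_weight (oscillation_bound \<gamma> i j)"
proof -
  assume ij: "distinct_sites i j"
  have "bounded_weight (\<lambda>\<eta>. 1 + \<eta> i + \<eta> j)"
  proof (rule bounded_weightI[where B="1 + 2 * real N"])
    fix \<eta> assume \<eta>: "\<eta> \<in> S"
    show "\<bar>1 + \<eta> i + \<eta> j\<bar> \<le> 1 + 2 * real N"
      using simplex_coordinate[OF \<eta> distinct_sitesD(1)[OF ij]] simplex_coordinate[OF \<eta> distinct_sitesD(2)[OF ij]] by simp
  qed measurable
  then show ?thesis unfolding oscillation_bound_def[abs_def] by (rule bounded_weight_scale)
qed

lemma power_mean_increment:
  assumes ij: "distinct_sites i j" and \<gamma>: "0 \<le> \<gamma>" "\<gamma> \<le> 1" and \<eta>: "\<eta> \<in> S" and \<alpha>: "\<alpha> \<in> {0..1}"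
  shows "(power_mean \<gamma> \<eta> - power_mean \<gamma> (exchange i j \<alpha> \<eta>))\<^sup>2 \<le> oscillation_bound \<gamma> i j \<eta>"
proof -
  let ?\<xi> = "exchange i j \<alpha> \<eta>" and ?s = "\<eta> i + \<eta> j"
  have ne: "i \<noteq> j" by (rule distinct_sitesD(3)[OF ij])
  have nn: "0 \<le> \<eta> i" "0 \<le> \<eta> j" using \<eta> ij by (auto simp: simplex_iff distinct_sites_def)
  have sN: "?s \<le> real N"
  proof -
    have "?s = (\<Sum>k\<in>{i, j}. \<eta> k)" using ne by simp
    also have "\<dots> \<le> (\<Sum>k=1..N. \<eta> k)"
      using ij \<eta> by (intro sum_mono2) (auto simp: distinct_sites_def simplex_iff)
    finally show ?thesis using sum_coordinates[OF \<eta>] by simp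
  qed
  have split: "real N * power_mean \<gamma> z = z i powr \<gamma> + z j powr \<gamma> + (\<Sum>k\<in>{1..N} - {i} - {j}. z k powr \<gamma>)" for z
    using ij N_ge_2
    by (simp add: power_mean_def distinct_sites_def sum.remove[of "{1..N}" i] sum.remove[of "{1..N} - {i}" j])
  have rest: "(\<Sum>k\<in>{1..N} - {i} - {j}. ?\<xi> k powr \<gamma>) = (\<Sum>k\<in>{1..N} - {i} - {j}. \<eta> k powr \<gamma>)"
    by (intro sum.cong) (auto simp: exchange_def)
  have \<xi>nn: "0 \<le> ?\<xi> i" "0 \<le> ?\<xi> j" using nn \<alpha> ne by (simp_all add: exchange_def)
  have \<xi>s: "?\<xi> i + ?\<xi> j = ?s" by (rule exchange_pair_sum[OF ne])
  have up: "u powr \<gamma> \<le> ?s powr \<gamma>" if "0 \<le> u" "u \<le> ?s" for u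
    using that \<gamma> by (intro powr_mono2)
  have "real N * (power_mean \<gamma> \<eta> - power_mean \<gamma> ?\<xi>)
      = (\<eta> i powr \<gamma> + \<eta> j powr \<gamma>) - (?\<xi> i powr \<gamma> + ?\<xi> j powr \<gamma>)"
    by (simp add: right_diff_distrib split rest)
  also have "\<bar>\<dots>\<bar> \<le> 2 * ?s powr \<gamma>"
  proof -
    have "\<eta> i powr \<gamma> \<le> ?s powr \<gamma>" "\<eta> j powr \<gamma> \<le> ?s powr \<gamma>"
      "?\<xi> i powr \<gamma> \<le> ?s powr \<gamma>" "?\<xi> j powr \<gamma> \<le> ?s powr \<gamma>"
      using nn \<xi>nn \<xi>s by (intro up; linarith)+
    then show ?thesis
      using powr_ge_zero[of "\<eta> i" \<gamma>] powr_ge_zero[of "\<eta> j" \<gamma>]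
        powr_ge_zero[of "?\<xi> i" \<gamma>] powr_ge_zero[of "?\<xi> j" \<gamma>]
      by (intro abs_leI) linarith+
  qed
  finally have "(real N * (power_mean \<gamma> \<eta> - power_mean \<gamma> ?\<xi>))\<^sup>2 \<le> (2 * ?s powr \<gamma>)\<^sup>2"
    using abs_le_square_iff[of "real N * (power_mean \<gamma> \<eta> - power_mean \<gamma> ?\<xi>)" "2 * ?s powr \<gamma>"] by simp
  also have "\<dots> = 4 * (?s powr \<gamma> * ?s powr \<gamma>)" by (simp add: power2_eq_square)
  also have "\<dots> \<le> 4 * (real N powr \<gamma> * (1 + ?s))"
    using nn sN \<gamma> by (intro mult_left_mono mult_mono powr_mono2 powr_le_one_plus) simp_all
  finally have "(real N)\<^sup>2 * (power_mean \<gamma> \<eta> - power_mean \<gamma> ?\<xi>)\<^sup>2 \<le> 4 * (real N powr \<gamma> * (1 + ?s))"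
    by (simp only: power_mult_distrib)
  then show ?thesis
    using N_ge_2 by (simp add: oscillation_bound_def field_simps)
qed

lemma oscillation_exchange: "distinct_sites i j \<Longrightarrow> oscillation_bound \<gamma> i j (exchange i j \<alpha> \<eta>) = oscillation_bound \<gamma> i j \<eta>"
  using exchange_pair_sum[OF distinct_sitesD(3), of i j \<alpha> \<eta>] by (simp add: oscillation_bound_def add.assoc)

text \<open>The product rule for increments: those of f come with the factor \<open>(power_mean \<gamma>)\<^sup>2\<close>, which is at
most twice \<open>power_mean \<gamma>\<close>, those of \<open>power_mean \<gamma>\<close> are small.\<close>

lemma localised_energy:
  assumes \<gamma>: "0 \<le> \<gamma>" "\<gamma> \<le> 1" and f: "square_integrable \<sigma> f"
  shows "uniform_energy (\<lambda>\<eta>. power_mean \<gamma> \<eta> * f \<eta>)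
    \<le> 4 * total_energy (\<lambda>_ _. power_mean \<gamma>) f + 24 * real N powr \<gamma> * (LINT \<eta>|\<sigma>. (f \<eta>)\<^sup>2)"
proof -
  let ?m = "power_mean \<gamma>" and ?osc = "oscillation_bound \<gamma>"
  note bm = bounded_power_mean[OF \<gamma>(1)]
  have mf: "square_integrable \<sigma> (\<lambda>\<eta>. ?m \<eta> * f \<eta>)" by (rule square_integrable_weighted[OF bm f])
  have osc_int: "integrable \<sigma> (\<lambda>\<eta>. ?osc (fst q) (snd q) \<eta> * (f \<eta>)\<^sup>2)" if "q \<in> pairs" for q
    using square_integrable_mult[OF square_integrable_weighted[OF bounded_oscillation[OF pairs_sites[OF that]] f] f]
    by (simp add: power2_eq_square mult.assoc)
  have pair: "energy (\<lambda>_. 1) (fst q) (snd q) (\<lambda>\<eta>. ?m \<eta> * f \<eta>)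
      \<le> 4 * energy ?m (fst q) (snd q) f + 2 * (LINT \<eta>|\<sigma>. ?osc (fst q) (snd q) \<eta> * (f \<eta>)\<^sup>2)" if q: "q \<in> pairs" for q
  proof -
    let ?i = "fst q" and ?j = "snd q"
    note ij = pairs_sites[OF q]
    let ?g = "\<lambda>\<eta>. ?osc ?i ?j \<eta> * (f \<eta>)\<^sup>2"
    have gi: "integrable Q (\<lambda>p. ?g (moved ?i ?j p))" by (rule integrable_moved[OF ij osc_int[OF q]])
    have "energy (\<lambda>_. 1) ?i ?j (\<lambda>\<eta>. ?m \<eta> * f \<eta>)
        \<le> (LINT p|Q. 4 * (?m (fst p) * (f (fst p) - f (moved ?i ?j p))\<^sup>2) + 2 * ?g (moved ?i ?j p))"
      unfolding energy_def
    proof (rule integral_mono[OF integrable_energy[OF ij bounded_const mf]])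
      show "integrable Q (\<lambda>p. 4 * (?m (fst p) * (f (fst p) - f (moved ?i ?j p))\<^sup>2) + 2 * ?g (moved ?i ?j p))"
        using gi integrable_energy[OF ij bm f] by simp
      fix p assume p: "p \<in> space Q"
      let ?\<eta> = "fst p" and ?\<xi> = "moved ?i ?j p"
      have \<eta>: "?\<eta> \<in> S" by (rule fst_in_simplex[OF p])
      have m: "0 \<le> ?m ?\<eta>" "?m ?\<eta> \<le> 2" using power_mean_nonneg power_mean_le_2[OF \<eta> \<gamma>] by auto
      have "?m ?\<eta> * f ?\<eta> - ?m ?\<xi> * f ?\<xi> = ?m ?\<eta> * (f ?\<eta> - f ?\<xi>) + (?m ?\<eta> - ?m ?\<xi>) * f ?\<xi>"
        by (simp add: algebra_simps)
      then have "(?m ?\<eta> * f ?\<eta> - ?m ?\<xi> * f ?\<xi>)\<^sup>2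
          \<le> 2 * (?m ?\<eta> * (f ?\<eta> - f ?\<xi>))\<^sup>2 + 2 * ((?m ?\<eta> - ?m ?\<xi>) * f ?\<xi>)\<^sup>2"
        using square_add_le by simp
      also have "\<dots> = 2 * ((?m ?\<eta> * ?m ?\<eta>) * (f ?\<eta> - f ?\<xi>)\<^sup>2) + 2 * ((?m ?\<eta> - ?m ?\<xi>)\<^sup>2 * (f ?\<xi>)\<^sup>2)"
        by (simp add: power2_eq_square mult_ac)
      also have "\<dots> \<le> 2 * ((2 * ?m ?\<eta>) * (f ?\<eta> - f ?\<xi>)\<^sup>2) + 2 * (?osc ?i ?j ?\<eta> * (f ?\<xi>)\<^sup>2)"
      proof -
        have "snd p \<in> {0..1}" using p by (auto simp: space_pair_measure)
        from power_mean_increment[OF ij \<gamma> \<eta> this] show ?thesis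
          using m by (intro add_mono mult_left_mono mult_right_mono) simp_all
      qed
      finally show "1 * (?m ?\<eta> * f ?\<eta> - ?m ?\<xi> * f ?\<xi>)\<^sup>2
          \<le> 4 * (?m ?\<eta> * (f ?\<eta> - f ?\<xi>)\<^sup>2) + 2 * ?g ?\<xi>"
        by (simp add: oscillation_exchange[OF ij] mult.assoc)
    qed
    also have "\<dots> = 4 * energy ?m ?i ?j f + 2 * (LINT p|Q. ?g (moved ?i ?j p))"
      unfolding energy_def using gi integrable_energy[OF ij bm f] by simp
    also have "(LINT p|Q. ?g (moved ?i ?j p)) = (LINT \<eta>|\<sigma>. ?g \<eta>)"
      by (rule integral_moved[OF ij borel_measurable_integrable[OF osc_int[OF q]]])
    finally show ?thesis .
  qed
  have "(\<Sum>q\<in>pairs. (LINT \<eta>|\<sigma>. ?osc (fst q) (snd q) \<eta> * (f \<eta>)\<^sup>2))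
      = (LINT \<eta>|\<sigma>. (\<Sum>q\<in>pairs. ?osc (fst q) (snd q) \<eta> * (f \<eta>)\<^sup>2))"
    by (rule Bochner_Integration.integral_sum[symmetric]) (rule osc_int)
  also have "\<dots> = (LINT \<eta>|\<sigma>. 12 * real N powr \<gamma> * (real N - 1) / real N * (f \<eta>)\<^sup>2)"
  proof (rule Bochner_Integration.integral_cong[OF refl])
    fix \<eta> assume "\<eta> \<in> space \<sigma>"
    then have \<eta>: "\<eta> \<in> S" by simp
    have "(\<Sum>q\<in>pairs. ?osc (fst q) (snd q) \<eta>)
        = 4 * real N powr \<gamma> / (real N)\<^sup>2 * (\<Sum>q\<in>pairs. 1 + (\<eta> (fst q) + \<eta> (snd q)))"
      by (simp only: oscillation_bound_def sum_distrib_left add.assoc)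
    also have "(\<Sum>q\<in>pairs. 1 + (\<eta> (fst q) + \<eta> (snd q))) = 3 * real N * (real N - 1)"
      using sum_pairs_coordinates[OF \<eta>] by (simp add: sum.distrib card_pairs)
    also have "4 * real N powr \<gamma> / (real N)\<^sup>2 * (3 * real N * (real N - 1)) = 12 * real N powr \<gamma> * (real N - 1) / real N"
      using N_ge_2 by (simp add: power2_eq_square)
    finally show "(\<Sum>q\<in>pairs. ?osc (fst q) (snd q) \<eta> * (f \<eta>)\<^sup>2)
        = 12 * real N powr \<gamma> * (real N - 1) / real N * (f \<eta>)\<^sup>2"
      by (simp only: sum_distrib_right[symmetric])
  qed
  also have "\<dots> = 12 * real N powr \<gamma> * (real N - 1) / real N * (LINT \<eta>|\<sigma>. (f \<eta>)\<^sup>2)"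
    by (rule Bochner_Integration.integral_mult_right_zero)
  also have "\<dots> \<le> 12 * real N powr \<gamma> * (LINT \<eta>|\<sigma>. (f \<eta>)\<^sup>2)"
    using N_ge_2 by (intro mult_right_mono) (simp_all add: field_simps)
  finally have osc: "(\<Sum>q\<in>pairs. (LINT \<eta>|\<sigma>. ?osc (fst q) (snd q) \<eta> * (f \<eta>)\<^sup>2))
      \<le> 12 * real N powr \<gamma> * (LINT \<eta>|\<sigma>. (f \<eta>)\<^sup>2)" .
  have "uniform_energy (\<lambda>\<eta>. ?m \<eta> * f \<eta>)
      \<le> (\<Sum>q\<in>pairs. 4 * energy ?m (fst q) (snd q) f + 2 * (LINT \<eta>|\<sigma>. ?osc (fst q) (snd q) \<eta> * (f \<eta>)\<^sup>2))"
    unfolding uniform_energy_pairs by (rule sum_mono[OF pair])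
  also have "\<dots> = 4 * (\<Sum>q\<in>pairs. energy ?m (fst q) (snd q) f)
      + 2 * (\<Sum>q\<in>pairs. (LINT \<eta>|\<sigma>. ?osc (fst q) (snd q) \<eta> * (f \<eta>)\<^sup>2))"
    by (simp add: sum.distrib sum_distrib_left)
  also have "(\<Sum>q\<in>pairs. energy ?m (fst q) (snd q) f) = total_energy (\<lambda>_ _. ?m) f"
    unfolding total_energy_def by (rule sum_pairs)
  finally show ?thesis using osc by simp
qed

text \<open>The constant-rate Poincare inequality for \<open>power_mean \<gamma> * f\<close>. Its mean is the covariance of
\<open>power_mean \<gamma>\<close> and f; the variance of \<open>power_mean \<gamma>\<close> in turn is bounded by the Poincare inequality.\<close>

lemma localised_norm:
  assumes \<gamma>: "0 \<le> \<gamma>" "\<gamma> \<le> 1" and f: "square_integrable \<sigma> f" and mean: "(LINT \<eta>|\<sigma>. f \<eta>) = 0"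
  shows "real N * (LINT \<eta>|\<sigma>. (power_mean \<gamma> \<eta>)\<^sup>2 * (f \<eta>)\<^sup>2)
    \<le> 27648 * total_energy (pair_rate \<gamma>) f + 576 * real N powr \<gamma> * (LINT \<eta>|\<sigma>. (f \<eta>)\<^sup>2)"
proof -
  let ?m = "power_mean \<gamma>" and ?V = "LINT \<eta>|\<sigma>. (f \<eta>)\<^sup>2"
  note bm = bounded_power_mean[OF \<gamma>(1)]
  note m2 = bounded_weight_square_integrable[OF bm]
  have mf: "square_integrable \<sigma> (\<lambda>\<eta>. ?m \<eta> * f \<eta>)" by (rule square_integrable_weighted[OF bm f])
  let ?c = "LINT \<eta>|\<sigma>. ?m \<eta>"
  have "uniform_energy ?m \<le> 24 * real N powr \<gamma>"
    using localised_energy[OF \<gamma> sigma.square_integrable_const[of 1]] sigma.prob_space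
    by (simp add: total_energy_def energy_def)
  then have var_m: "real N * ((LINT \<eta>|\<sigma>. (?m \<eta>)\<^sup>2) - ?c\<^sup>2) \<le> 288 * real N powr \<gamma>"
    using poincare_uniform[OF m2] by simp
  have "(LINT \<eta>|\<sigma>. ?m \<eta> * f \<eta>) = (LINT \<eta>|\<sigma>. (?m \<eta> - ?c) * f \<eta>)"
  proof -
    have "(LINT \<eta>|\<sigma>. (?m \<eta> - ?c) * f \<eta>) = (LINT \<eta>|\<sigma>. ?m \<eta> * f \<eta> - ?c * f \<eta>)"
      by (simp add: left_diff_distrib)
    also have "\<dots> = (LINT \<eta>|\<sigma>. ?m \<eta> * f \<eta>) - ?c * (LINT \<eta>|\<sigma>. f \<eta>)"
      using square_integrable_mult[OF m2 f] sigma.square_integrable_integrable[OF f] by simp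
    finally show ?thesis using mean by simp
  qed
  then have "(LINT \<eta>|\<sigma>. ?m \<eta> * f \<eta>)\<^sup>2 \<le> (LINT \<eta>|\<sigma>. (?m \<eta> - ?c)\<^sup>2) * ?V"
    using cauchy_schwarz_integral[OF square_integrable_diff[OF m2 sigma.square_integrable_const] f] by simp
  also have "(LINT \<eta>|\<sigma>. (?m \<eta> - ?c)\<^sup>2) = (LINT \<eta>|\<sigma>. (?m \<eta>)\<^sup>2) - ?c\<^sup>2"
    using sigma.square_integrable_integrable[OF m2] square_integrable_square[OF m2]
    by (rule sigma.variance_eq)
  finally have "real N * (LINT \<eta>|\<sigma>. ?m \<eta> * f \<eta>)\<^sup>2 \<le> real N * (((LINT \<eta>|\<sigma>. (?m \<eta>)\<^sup>2) - ?c\<^sup>2) * ?V)"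
    by (intro mult_left_mono) simp_all
  also have "\<dots> \<le> 288 * real N powr \<gamma> * ?V"
    using mult_right_mono[OF var_m, of ?V] by (simp add: mult.assoc)
  finally have mean_mf: "real N * (LINT \<eta>|\<sigma>. ?m \<eta> * f \<eta>)\<^sup>2 \<le> 288 * real N powr \<gamma> * ?V" .
  have "uniform_energy (\<lambda>\<eta>. ?m \<eta> * f \<eta>) \<le> 2304 * total_energy (pair_rate \<gamma>) f + 24 * real N powr \<gamma> * ?V"
    using localised_energy[OF \<gamma> f] power_mean_energy_le[OF \<gamma> f] by simp
  then show ?thesis
    using poincare_uniform[OF mf] mean_mf by (simp add: power_mult_distrib right_diff_distrib)
qed

text \<open>The standard Lyapunov estimate for reversible jump processes: with L the part of the generator
belonging to the pair, \<open>- L U / U\<close> is a potential dominated by the Dirichlet form. It is the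
expectation of \<open>lyapunov_pointwise\<close> over the exchangeable pair.\<close>

lemma lyapunov_pair:
  assumes ij: "distinct_sites i j" and w: "bounded_weight w" "\<And>\<eta>. \<eta> \<in> S \<Longrightarrow> 0 \<le> w \<eta>"
    and inv: "\<And>\<alpha> \<eta>. w (exchange i j \<alpha> \<eta>) = w \<eta>"
    and U: "bounded_weight U" and c: "0 < c" "\<And>\<eta>. \<eta> \<in> S \<Longrightarrow> c \<le> U \<eta>" and f: "square_integrable \<sigma> f"
  shows "(LINT \<eta>|\<sigma>. w \<eta> / U \<eta> * (U \<eta> - pair_average i j U \<eta>) * (f \<eta>)\<^sup>2) \<le> energy w i j f / 2"
    and "integrable \<sigma> (\<lambda>\<eta>. w \<eta> / U \<eta> * (U \<eta> - pair_average i j U \<eta>) * (f \<eta>)\<^sup>2)"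
proof -
  obtain B where B: "\<And>\<eta>. \<eta> \<in> S \<Longrightarrow> \<bar>w \<eta>\<bar> \<le> B" using w(1) by (auto simp: bounded_weight_def)
  obtain D where D: "\<And>\<eta>. \<eta> \<in> S \<Longrightarrow> \<bar>U \<eta>\<bar> \<le> D" using U by (auto simp: bounded_weight_def)
  note [measurable] = bounded_weight_measurable[OF w(1)] bounded_weight_measurable[OF U]
    square_integrable_measurable[OF f] measurable_moved[OF ij]
  define F where "F \<eta> \<xi> = w \<eta> * ((f \<eta>)\<^sup>2 * ((U \<eta> - U \<xi>) / U \<eta>))" for \<eta> \<xi>
  have Fm: "(\<lambda>(\<eta>, \<xi>). F \<eta> \<xi>) \<in> borel_measurable (\<sigma> \<Otimes>\<^sub>M \<sigma>)" unfolding F_def by measurable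
  have ratio: "\<bar>w \<eta> * ((U \<eta> - U \<xi>) / U \<eta>)\<bar> \<le> B * (2 * D / c)" if \<eta>: "\<eta> \<in> S" and \<xi>: "\<xi> \<in> S" for \<eta> \<xi>
  proof -
    have Up: "0 < U \<eta>" using c(1) c(2)[OF \<eta>] by linarith
    have "\<bar>U \<eta> - U \<xi>\<bar> \<le> 2 * D" using D[OF \<eta>] D[OF \<xi>] by linarith
    then have "\<bar>U \<eta> - U \<xi>\<bar> / \<bar>U \<eta>\<bar> \<le> 2 * D / c"
      using c(1) c(2)[OF \<eta>] Up by (intro frac_le) auto
    then have "\<bar>(U \<eta> - U \<xi>) / U \<eta>\<bar> \<le> 2 * D / c" by (simp add: abs_divide)
    moreover have "0 \<le> B" using B[OF \<eta>] by linarith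
    ultimately show ?thesis unfolding abs_mult by (intro mult_mono B[OF \<eta>]) simp_all
  qed
  have iF: "integrable Q (\<lambda>p. F (fst p) (moved i j p))"
  proof -
    have m: "(\<lambda>p. w (fst p) * ((U (fst p) - U (moved i j p)) / U (fst p))) \<in> borel_measurable Q"
      by measurable
    have "integrable Q (\<lambda>p. (w (fst p) * ((U (fst p) - U (moved i j p)) / U (fst p))) * (f (fst p))\<^sup>2)"
      by (rule bounded_mult_integrable[OF square_integrable_square[OF square_integrable_fst[OF f]], where B="B * (2 * D / c)"])
         (use ratio fst_in_simplex moved_in_simplex[OF ij] m in auto)
    then show ?thesis by (simp add: F_def mult_ac)
  qed
  have iF': "integrable Q (\<lambda>p. F (moved i j p) (fst p))"
    using integrable_exchangeable[OF ij, of "\<lambda>\<eta> \<xi>. F \<xi> \<eta>"] iF Fm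
    by (simp add: measurable_split_conv) measurable
  have "2 * (LINT p|Q. F (fst p) (moved i j p)) = (LINT p|Q. F (fst p) (moved i j p) + F (moved i j p) (fst p))"
    using integral_exchangeable[OF ij Fm] iF iF' by simp
  also have "\<dots> \<le> energy w i j f"
    unfolding energy_def
  proof (rule integral_mono[OF _ integrable_energy[OF ij w(1) f]])
    show "integrable Q (\<lambda>p. F (fst p) (moved i j p) + F (moved i j p) (fst p))" using iF iF' by simp
    fix p assume p: "p \<in> space Q"
    let ?\<eta> = "fst p" and ?\<xi> = "moved i j p"
    have S: "?\<eta> \<in> S" "?\<xi> \<in> S" by (rule fst_in_simplex[OF p], rule moved_in_simplex[OF ij p])
    have "0 < U ?\<eta>" "0 < U ?\<xi>" using c(1) c(2)[OF S(1)] c(2)[OF S(2)] by linarith+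
    from mult_left_mono[OF lyapunov_pointwise[OF this, of "f ?\<eta>" "f ?\<xi>"] w(2)[OF S(1)]]
    show "F ?\<eta> ?\<xi> + F ?\<xi> ?\<eta> \<le> w ?\<eta> * (f ?\<eta> - f ?\<xi>)\<^sup>2"
      by (simp add: F_def inv distrib_left)
  qed
  finally have main: "(LINT p|Q. F (fst p) (moved i j p)) \<le> energy w i j f / 2" by simp
  have inner: "(\<integral>\<alpha>. F (fst (\<eta>, \<alpha>)) (moved i j (\<eta>, \<alpha>)) \<partial>unit_lebesgue)
      = w \<eta> / U \<eta> * (U \<eta> - pair_average i j U \<eta>) * (f \<eta>)\<^sup>2" if \<eta>: "\<eta> \<in> S" for \<eta>
  proof -
    have iU: "integrable unit_lebesgue (\<lambda>\<alpha>. U (exchange i j \<alpha> \<eta>))"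
      by (rule unit.square_integrable_integrable[OF square_integrable_along_exchange[OF ij U \<eta>]])
    have "(\<integral>\<alpha>. F (fst (\<eta>, \<alpha>)) (moved i j (\<eta>, \<alpha>)) \<partial>unit_lebesgue)
        = (\<integral>\<alpha>. w \<eta> / U \<eta> * (f \<eta>)\<^sup>2 * (U \<eta> - U (exchange i j \<alpha> \<eta>)) \<partial>unit_lebesgue)"
      by (simp add: F_def mult_ac)
    also have "\<dots> = w \<eta> / U \<eta> * (f \<eta>)\<^sup>2 * (\<integral>\<alpha>. U \<eta> - U (exchange i j \<alpha> \<eta>) \<partial>unit_lebesgue)"
      by (rule Bochner_Integration.integral_mult_right_zero)
    also have "(\<integral>\<alpha>. U \<eta> - U (exchange i j \<alpha> \<eta>) \<partial>unit_lebesgue) = U \<eta> - pair_average i j U \<eta>"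
      using iU unit.prob_space by (simp add: pair_average_unit)
    finally show ?thesis by (simp add: mult_ac)
  qed
  have cong: "integrable \<sigma> (\<lambda>\<eta>. \<integral>\<alpha>. F (fst (\<eta>, \<alpha>)) (moved i j (\<eta>, \<alpha>)) \<partial>unit_lebesgue)
      = integrable \<sigma> (\<lambda>\<eta>. w \<eta> / U \<eta> * (U \<eta> - pair_average i j U \<eta>) * (f \<eta>)\<^sup>2)"
    by (rule Bochner_Integration.integrable_cong[OF refl]) (rule inner, simp)
  show "integrable \<sigma> (\<lambda>\<eta>. w \<eta> / U \<eta> * (U \<eta> - pair_average i j U \<eta>) * (f \<eta>)\<^sup>2)"
    using Q.integrable_fst'[OF iF] unfolding cong .
  have "(LINT \<eta>|\<sigma>. w \<eta> / U \<eta> * (U \<eta> - pair_average i j U \<eta>) * (f \<eta>)\<^sup>2) = (LINT p|Q. F (fst p) (moved i j p))"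
    unfolding Q.integral_fst'[OF iF, symmetric]
    by (rule Bochner_Integration.integral_cong[OF refl]) (rule inner[symmetric], simp)
  then show "(LINT \<eta>|\<sigma>. w \<eta> / U \<eta> * (U \<eta> - pair_average i j U \<eta>) * (f \<eta>)\<^sup>2) \<le> energy w i j f / 2"
    using main by simp
qed

text \<open>The shift by \<open>3 * N\<close> keeps the function between N and \<open>3 * N\<close>, so that dividing by it costs
only a constant.\<close>

definition lyapunov :: "real \<Rightarrow> (nat \<Rightarrow> real) \<Rightarrow> real" where
  "lyapunov \<gamma> \<eta> = real N * (3 - power_mean (1 - \<gamma>) \<eta>)"

lemma lyapunov_bounds:
  assumes "\<eta> \<in> S" "0 \<le> \<gamma>" "\<gamma> \<le> 1"
  shows "real N \<le> lyapunov \<gamma> \<eta>" "lyapunov \<gamma> \<eta> \<le> 3 * real N"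
proof -
  have "1 \<le> 3 - power_mean (1 - \<gamma>) \<eta>" "3 - power_mean (1 - \<gamma>) \<eta> \<le> 3"
    using power_mean_le_2[of \<eta> "1 - \<gamma>"] power_mean_nonneg[of "1 - \<gamma>" \<eta>] assms by auto
  then show "real N \<le> lyapunov \<gamma> \<eta>" "lyapunov \<gamma> \<eta> \<le> 3 * real N"
    unfolding lyapunov_def
    using mult_left_mono[of 1 "3 - power_mean (1 - \<gamma>) \<eta>" "real N"]
      mult_left_mono[of "3 - power_mean (1 - \<gamma>) \<eta>" 3 "real N"] by linarith+
qed

lemma bounded_lyapunov:
  assumes "0 \<le> \<gamma>" "\<gamma> \<le> 1"
  shows "bounded_weight (lyapunov \<gamma>)"
proof (rule bounded_weightI)
  have [measurable]: "power_mean (1 - \<gamma>) \<in> borel_measurable \<sigma>"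
    using bounded_power_mean[of "1 - \<gamma>"] assms by (simp add: bounded_weight_def)
  show "lyapunov \<gamma> \<in> borel_measurable \<sigma>" unfolding lyapunov_def[abs_def] by measurable
  fix \<eta> assume "\<eta> \<in> S"
  then show "\<bar>lyapunov \<gamma> \<eta>\<bar> \<le> 3 * real N" using lyapunov_bounds[of \<eta> \<gamma>] assms by simp
qed

text \<open>After an exchange the expected value of \<open>\<eta> i powr (1 - \<gamma>) + \<eta> j powr (1 - \<gamma>)\<close> is
\<open>s powr (1 - \<gamma>) * 2 / (2 - \<gamma>)\<close>. Multiplied by the rate this is \<open>s * 2 / (2 - \<gamma>)\<close>, which exceeds the
diagonal terms \<open>s\<close> of the loss by \<open>\<gamma> / 2 * s\<close> at least.\<close>

lemma lyapunov_drift: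
  assumes ij: "distinct_sites i j" and \<gamma>: "0 < \<gamma>" "\<gamma> < 1" and \<eta>: "\<eta> \<in> S"
  shows "pair_rate \<gamma> i j \<eta> * (lyapunov \<gamma> \<eta> - pair_average i j (lyapunov \<gamma>) \<eta>)
    \<ge> \<gamma> / 2 * (\<eta> i + \<eta> j) - \<eta> i powr \<gamma> * \<eta> j powr (1 - \<gamma>) - \<eta> j powr \<gamma> * \<eta> i powr (1 - \<gamma>)"
proof -
  let ?b = "1 - \<gamma>" and ?s = "\<eta> i + \<eta> j"
  have ne: "i \<noteq> j" by (rule distinct_sitesD(3)[OF ij])
  have nn: "0 \<le> \<eta> i" "0 \<le> \<eta> j" using \<eta> ij by (auto simp: simplex_iff distinct_sites_def)
  have split: "real N * power_mean ?b z = z i powr ?b + z j powr ?b + (\<Sum>k\<in>{1..N} - {i} - {j}. z k powr ?b)" for z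
    using ij N_ge_2
    by (simp add: power_mean_def distinct_sites_def sum.remove[of "{1..N}" i] sum.remove[of "{1..N} - {i}" j])
  have ex: "lyapunov \<gamma> (exchange i j \<alpha> \<eta>) = lyapunov \<gamma> \<eta> + (\<eta> i powr ?b + \<eta> j powr ?b)
      - ?s powr ?b * (\<alpha> powr ?b + (1 - \<alpha>) powr ?b)" if "\<alpha> \<in> {0..1}" for \<alpha>
  proof -
    have rest: "(\<Sum>k\<in>{1..N} - {i} - {j}. exchange i j \<alpha> \<eta> k powr ?b) = (\<Sum>k\<in>{1..N} - {i} - {j}. \<eta> k powr ?b)"
      by (intro sum.cong) (auto simp: exchange_def)
    have "exchange i j \<alpha> \<eta> i powr ?b + exchange i j \<alpha> \<eta> j powr ?b = ?s powr ?b * (\<alpha> powr ?b + (1 - \<alpha>) powr ?b)"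
    proof -
      have "exchange i j \<alpha> \<eta> i = \<alpha> * ?s" "exchange i j \<alpha> \<eta> j = (1 - \<alpha>) * ?s"
        using ne by (simp_all add: exchange_def)
      moreover have "(\<alpha> * ?s) powr ?b = \<alpha> powr ?b * ?s powr ?b"
        "((1 - \<alpha>) * ?s) powr ?b = (1 - \<alpha>) powr ?b * ?s powr ?b"
        using that nn by (intro powr_mult; simp)+
      ultimately show ?thesis by (simp only: distrib_left mult.commute)
    qed
    then show ?thesis unfolding lyapunov_def right_diff_distrib split rest by simp
  qed
  have i: "integrable unit_lebesgue (\<lambda>\<alpha>. \<alpha> powr ?b)" "integrable unit_lebesgue (\<lambda>\<alpha>. (1 - \<alpha>) powr ?b)"
  proof -
    have le: "\<bar>x powr ?b\<bar> \<le> 1" if "0 \<le> x" "x \<le> 1" for x :: real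
      using powr_mono2[of ?b x 1] that \<gamma> by simp
    have "(\<lambda>\<alpha>. \<alpha> powr ?b) \<in> borel_measurable borel" "(\<lambda>\<alpha>. (1 - \<alpha>) powr ?b) \<in> borel_measurable borel"
      by measurable
    from this[THEN borel_measurable_unit_lebesgue]
    show "integrable unit_lebesgue (\<lambda>\<alpha>. \<alpha> powr ?b)" "integrable unit_lebesgue (\<lambda>\<alpha>. (1 - \<alpha>) powr ?b)"
      by (auto intro!: integrable_unit_bounded[where B=1] le)
  qed
  have "pair_average i j (lyapunov \<gamma>) \<eta>
      = (LINT \<alpha>|unit_lebesgue. lyapunov \<gamma> \<eta> + (\<eta> i powr ?b + \<eta> j powr ?b)
          - ?s powr ?b * (\<alpha> powr ?b + (1 - \<alpha>) powr ?b))"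
    unfolding pair_average_unit by (rule Bochner_Integration.integral_cong[OF refl]) (rule ex, simp)
  also have "\<dots> = lyapunov \<gamma> \<eta> + (\<eta> i powr ?b + \<eta> j powr ?b)
      - ?s powr ?b * (LINT \<alpha>|unit_lebesgue. \<alpha> powr ?b + (1 - \<alpha>) powr ?b)"
    using i unit.prob_space by simp
  also have "(LINT \<alpha>|unit_lebesgue. \<alpha> powr ?b + (1 - \<alpha>) powr ?b) = 2 / (2 - \<gamma>)"
    using i integral_unit_reflect[of "\<lambda>\<alpha>. \<alpha> powr ?b"] unit_moment_powr[of ?b] \<gamma> by simp
  finally have drift: "lyapunov \<gamma> \<eta> - pair_average i j (lyapunov \<gamma>) \<eta>
      = ?s powr ?b * (2 / (2 - \<gamma>)) - (\<eta> i powr ?b + \<eta> j powr ?b)" by simp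
  have ss: "?s powr \<gamma> * ?s powr ?b = ?s" using nn by (simp add: powr_add[symmetric])
  have xx: "x powr \<gamma> * x powr ?b = x" if "0 \<le> x" for x :: real using that by (simp add: powr_add[symmetric])
  have "pair_rate \<gamma> i j \<eta> * (lyapunov \<gamma> \<eta> - pair_average i j (lyapunov \<gamma>) \<eta>)
      = (?s powr \<gamma> * ?s powr ?b) * (2 / (2 - \<gamma>)) - ?s powr \<gamma> * (\<eta> i powr ?b + \<eta> j powr ?b)"
    unfolding drift pair_rate_def by (simp only: right_diff_distrib mult.assoc)
  also have "\<dots> \<ge> (1 + \<gamma> / 2) * ?s - (\<eta> i powr \<gamma> + \<eta> j powr \<gamma>) * (\<eta> i powr ?b + \<eta> j powr ?b)"
  proof -
    have "1 + \<gamma> / 2 \<le> 2 / (2 - \<gamma>)" using \<gamma> by (simp add: field_simps power2_eq_square)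
    then have "(1 + \<gamma> / 2) * ?s \<le> 2 / (2 - \<gamma>) * ?s" using nn by (intro mult_right_mono) simp_all
    moreover have "?s powr \<gamma> * (\<eta> i powr ?b + \<eta> j powr ?b)
        \<le> (\<eta> i powr \<gamma> + \<eta> j powr \<gamma>) * (\<eta> i powr ?b + \<eta> j powr ?b)"
      using nn \<gamma> by (intro mult_right_mono powr_subadditive) simp_all
    ultimately show ?thesis unfolding ss by (simp add: mult.commute)
  qed
  finally have "(1 + \<gamma> / 2) * ?s - (\<eta> i powr \<gamma> + \<eta> j powr \<gamma>) * (\<eta> i powr ?b + \<eta> j powr ?b)
      \<le> pair_rate \<gamma> i j \<eta> * (lyapunov \<gamma> \<eta> - pair_average i j (lyapunov \<gamma>) \<eta>)" .
  moreover have "(\<eta> i powr \<gamma> + \<eta> j powr \<gamma>) * (\<eta> i powr ?b + \<eta> j powr ?b)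
      = ?s + \<eta> i powr \<gamma> * \<eta> j powr ?b + \<eta> j powr \<gamma> * \<eta> i powr ?b"
    using xx[OF nn(1)] xx[OF nn(2)] by (simp add: distrib_left distrib_right)
  ultimately show ?thesis by (simp add: distrib_right)
qed

text \<open>The gains \<open>\<gamma> / 2 * s\<close> add up to order \<open>N\<^sup>2\<close>, while the mixed terms are at most
\<open>N\<^sup>2 * power_mean \<gamma> \<eta> * power_mean (1 - \<gamma>) \<eta>\<close>.\<close>

lemma lyapunov_total_drift:
  assumes \<gamma>: "0 < \<gamma>" "\<gamma> < 1" and \<eta>: "\<eta> \<in> S"
  shows "real N * (\<gamma> / 6 - 4 * power_mean \<gamma> \<eta>)
    \<le> (\<Sum>q\<in>pairs. pair_rate \<gamma> (fst q) (snd q) \<eta> / lyapunov \<gamma> \<eta>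
         * (lyapunov \<gamma> \<eta> - pair_average (fst q) (snd q) (lyapunov \<gamma>) \<eta>))" (is "_ \<le> ?R")
proof -
  let ?U = "lyapunov \<gamma> \<eta>" and ?b = "1 - \<gamma>"
  let ?D = "\<Sum>q\<in>pairs. pair_rate \<gamma> (fst q) (snd q) \<eta> * (?U - pair_average (fst q) (snd q) (lyapunov \<gamma>) \<eta>)"
  let ?A = "(real N)\<^sup>2 * (\<gamma> / 2)" and ?B = "4 * (real N)\<^sup>2 * power_mean \<gamma> \<eta>"
  have U: "real N \<le> ?U" "?U \<le> 3 * real N" using lyapunov_bounds[OF \<eta>] \<gamma> by auto
  have N0: "0 < real N" using N_ge_2 by simp
  have "(\<Sum>q\<in>pairs. \<eta> (fst q) powr \<gamma> * \<eta> (snd q) powr ?b) \<le> (\<Sum>k=1..N. \<eta> k powr \<gamma>) * (\<Sum>k=1..N. \<eta> k powr ?b)"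
    by (rule sum_pairs_product_le) simp_all
  also have "\<dots> = (real N)\<^sup>2 * (power_mean \<gamma> \<eta> * power_mean ?b \<eta>)"
    using N0 by (simp add: power_mean_def power2_eq_square)
  also have "\<dots> \<le> (real N)\<^sup>2 * (power_mean \<gamma> \<eta> * 2)"
    using power_mean_le_2[OF \<eta>, of ?b] power_mean_nonneg[of \<gamma> \<eta>] \<gamma> by (intro mult_left_mono) simp_all
  finally have cross: "(\<Sum>q\<in>pairs. \<eta> (fst q) powr \<gamma> * \<eta> (snd q) powr ?b) \<le> ?B / 2" by (simp add: mult_ac)
  have "?A - ?B \<le> \<gamma> / 2 * (2 * real N * (real N - 1)) - 2 * (\<Sum>q\<in>pairs. \<eta> (fst q) powr \<gamma> * \<eta> (snd q) powr ?b)"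
  proof -
    have "(real N)\<^sup>2 \<le> 2 * real N * (real N - 1)"
      using N_ge_2 by (simp add: power2_eq_square)
    from mult_left_mono[OF this, of "\<gamma> / 2"]
    have "?A \<le> \<gamma> / 2 * (2 * real N * (real N - 1))" using \<gamma> by (simp only: mult.commute[of "\<gamma> / 2"])
    then show ?thesis using cross by linarith
  qed
  also have "\<dots> = (\<Sum>q\<in>pairs. \<gamma> / 2 * (\<eta> (fst q) + \<eta> (snd q)) - \<eta> (fst q) powr \<gamma> * \<eta> (snd q) powr ?b
      - \<eta> (snd q) powr \<gamma> * \<eta> (fst q) powr ?b)"
    unfolding sum_subtractf sum_distrib_left[symmetric] sum_pairs_coordinates[OF \<eta>]
      sum_pairs_swap[of "\<lambda>i j. \<eta> i powr \<gamma> * \<eta> j powr ?b"] by simp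
  also have "\<dots> \<le> ?D" by (intro sum_mono lyapunov_drift pairs_sites \<gamma> \<eta>)
  finally have D: "?A - ?B \<le> ?D" .
  have "real N * (\<gamma> / 6 - 4 * power_mean \<gamma> \<eta>) = ?A / (3 * real N) - ?B / real N"
    using N0 by (simp add: power2_eq_square field_simps)
  also have "\<dots> \<le> ?A / ?U - ?B / ?U"
    using U N0 \<gamma> power_mean_nonneg[of \<gamma> \<eta>] by (intro diff_mono divide_left_mono) simp_all
  also have "\<dots> \<le> ?D / ?U" 
    unfolding diff_divide_distrib[symmetric] using D U N0 by (intro divide_right_mono) simp_all
  also have "\<dots> = ?R" by (simp add: sum_divide_distrib)
  finally show ?thesis .
qed

lemma lyapunov_inequality:
  assumes \<gamma>: "0 < \<gamma>" "\<gamma> < 1" and f: "square_integrable \<sigma> f"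
  shows "real N * (LINT \<eta>|\<sigma>. (\<gamma> / 6 - 4 * power_mean \<gamma> \<eta>) * (f \<eta>)\<^sup>2) \<le> total_energy (pair_rate \<gamma>) f / 2"
proof -
  let ?G = "\<lambda>q \<eta>. pair_rate \<gamma> (fst q) (snd q) \<eta> / lyapunov \<gamma> \<eta>
      * (lyapunov \<gamma> \<eta> - pair_average (fst q) (snd q) (lyapunov \<gamma>) \<eta>) * (f \<eta>)\<^sup>2"
  have N0: "0 < real N" using N_ge_2 by simp
  have \<gamma>': "0 \<le> \<gamma>" "\<gamma> \<le> 1" using \<gamma> by auto
  have pair: "(LINT \<eta>|\<sigma>. ?G q \<eta>) \<le> energy (pair_rate \<gamma> (fst q) (snd q)) (fst q) (snd q) f / 2"
    "integrable \<sigma> (?G q)" if "q \<in> pairs" for q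
    by (rule lyapunov_pair[OF pairs_sites[OF that] bounded_pair_rate[OF pairs_sites[OF that] \<gamma>'(1)]
        pair_rate_nonneg pair_rate_exchange[OF pairs_sites[OF that]] bounded_lyapunov[OF \<gamma>'] N0
        lyapunov_bounds(1)[OF _ \<gamma>'] f]; assumption)+
  have mi: "integrable \<sigma> (\<lambda>\<eta>. power_mean \<gamma> \<eta> * (f \<eta>)\<^sup>2)"
    using square_integrable_mult[OF square_integrable_weighted[OF bounded_power_mean[OF \<gamma>'(1)] f] f]
    by (simp add: power2_eq_square mult.assoc)
  have "real N * (LINT \<eta>|\<sigma>. (\<gamma> / 6 - 4 * power_mean \<gamma> \<eta>) * (f \<eta>)\<^sup>2)
      = (LINT \<eta>|\<sigma>. real N * (\<gamma> / 6 - 4 * power_mean \<gamma> \<eta>) * (f \<eta>)\<^sup>2)"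
    by (simp add: mult.assoc)
  also have "\<dots> \<le> (LINT \<eta>|\<sigma>. (\<Sum>q\<in>pairs. ?G q \<eta>))"
  proof (rule integral_mono)
    have "integrable \<sigma> (\<lambda>\<eta>. real N * (\<gamma> / 6) * (f \<eta>)\<^sup>2 - real N * 4 * (power_mean \<gamma> \<eta> * (f \<eta>)\<^sup>2))"
      using mi square_integrable_square[OF f] by simp
    then show "integrable \<sigma> (\<lambda>\<eta>. real N * (\<gamma> / 6 - 4 * power_mean \<gamma> \<eta>) * (f \<eta>)\<^sup>2)"
      by (simp add: algebra_simps)
    show "integrable \<sigma> (\<lambda>\<eta>. \<Sum>q\<in>pairs. ?G q \<eta>)"
      by (rule Bochner_Integration.integrable_sum) (rule pair(2))
    fix \<eta> assume "\<eta> \<in> space \<sigma>"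
    then have "\<eta> \<in> S" by simp
    from mult_right_mono[OF lyapunov_total_drift[OF \<gamma> this], of "(f \<eta>)\<^sup>2"]
    show "real N * (\<gamma> / 6 - 4 * power_mean \<gamma> \<eta>) * (f \<eta>)\<^sup>2 \<le> (\<Sum>q\<in>pairs. ?G q \<eta>)"
      by (simp add: sum_distrib_right)
  qed
  also have "\<dots> = (\<Sum>q\<in>pairs. (LINT \<eta>|\<sigma>. ?G q \<eta>))"
    by (rule Bochner_Integration.integral_sum) (rule pair(2))
  also have "\<dots> \<le> (\<Sum>q\<in>pairs. energy (pair_rate \<gamma> (fst q) (snd q)) (fst q) (snd q) f / 2)"
    by (rule sum_mono[OF pair(1)])
  also have "\<dots> = (\<Sum>q\<in>pairs. energy (pair_rate \<gamma> (fst q) (snd q)) (fst q) (snd q) f) / 2"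
    by (simp add: sum_divide_distrib)
  also have "\<dots> = total_energy (pair_rate \<gamma>) f / 2"
    unfolding total_energy_def sum_pairs[of "\<lambda>i j. energy (pair_rate \<gamma> i j) i j f"] ..
  finally show ?thesis .
qed

text \<open>The Lyapunov inequality leaves the integral of \<open>power_mean \<gamma> * f\<^sup>2\<close>, which Young's inequality reduces
to that of \<open>(power_mean \<gamma> * f)\<^sup>2\<close>. The assumption on N makes the error term of \<open>localised_norm\<close> at
most half of the left-hand side.\<close>

lemma poincare_many_particles:
  assumes \<gamma>: "0 < \<gamma>" "\<gamma> < 1" and f: "square_integrable \<sigma> f" and mean: "(LINT \<eta>|\<sigma>. f \<eta>) = 0"
    and N: "663552 / \<gamma>\<^sup>2 \<le> real N powr (1 - \<gamma>)"
  shows "(LINT \<eta>|\<sigma>. (f \<eta>)\<^sup>2) \<le> 48 / \<gamma> * (1327104 / \<gamma> + 1 / 2) * dirichlet_form \<gamma> N f"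
proof -
  let ?V = "LINT \<eta>|\<sigma>. (f \<eta>)\<^sup>2" and ?W = "total_energy (pair_rate \<gamma>) f"
  let ?P = "LINT \<eta>|\<sigma>. (power_mean \<gamma> \<eta>)\<^sup>2 * (f \<eta>)\<^sup>2"
  have \<gamma>': "0 \<le> \<gamma>" "\<gamma> \<le> 1" using \<gamma> by auto
  have N0: "0 < real N" using N_ge_2 by simp
  note bm = bounded_power_mean[OF \<gamma>'(1)]
  have mf: "square_integrable \<sigma> (\<lambda>\<eta>. power_mean \<gamma> \<eta> * f \<eta>)" by (rule square_integrable_weighted[OF bm f])
  have pi: "integrable \<sigma> (\<lambda>\<eta>. (power_mean \<gamma> \<eta>)\<^sup>2 * (f \<eta>)\<^sup>2)"
    using square_integrable_square[OF mf] by (simp add: power_mult_distrib)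
  have mi: "integrable \<sigma> (\<lambda>\<eta>. power_mean \<gamma> \<eta> * (f \<eta>)\<^sup>2)"
    using square_integrable_mult[OF mf f] by (simp add: power2_eq_square mult.assoc)
  have vi: "integrable \<sigma> (\<lambda>\<eta>. (f \<eta>)\<^sup>2)" by (rule square_integrable_square[OF f])
  have "\<gamma> / 12 * ?V - 48 / \<gamma> * ?P = (LINT \<eta>|\<sigma>. \<gamma> / 12 * (f \<eta>)\<^sup>2 - 48 / \<gamma> * ((power_mean \<gamma> \<eta>)\<^sup>2 * (f \<eta>)\<^sup>2))"
    using pi vi by simp
  also have "\<dots> \<le> (LINT \<eta>|\<sigma>. (\<gamma> / 6 - 4 * power_mean \<gamma> \<eta>) * (f \<eta>)\<^sup>2)"
  proof (rule integral_mono)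
    show "integrable \<sigma> (\<lambda>\<eta>. \<gamma> / 12 * (f \<eta>)\<^sup>2 - 48 / \<gamma> * ((power_mean \<gamma> \<eta>)\<^sup>2 * (f \<eta>)\<^sup>2))"
      using pi vi by simp
    have "integrable \<sigma> (\<lambda>\<eta>. \<gamma> / 6 * (f \<eta>)\<^sup>2 - 4 * (power_mean \<gamma> \<eta> * (f \<eta>)\<^sup>2))" using mi vi by simp
    then show "integrable \<sigma> (\<lambda>\<eta>. (\<gamma> / 6 - 4 * power_mean \<gamma> \<eta>) * (f \<eta>)\<^sup>2)"
      by (simp add: left_diff_distrib mult.assoc)
    fix \<eta>
    let ?m = "power_mean \<gamma> \<eta>"
    have "\<gamma> / 12 - 48 / \<gamma> * ?m\<^sup>2 \<le> \<gamma> / 6 - 4 * ?m"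
    proof -
      have "0 \<le> (\<gamma> - 24 * ?m)\<^sup>2 / (12 * \<gamma>)" using \<gamma> by simp
      also have "\<dots> = \<gamma> / 12 - 4 * ?m + 48 / \<gamma> * ?m\<^sup>2"
        using \<gamma> by (simp add: power2_eq_square field_simps)
      finally show ?thesis by simp
    qed
    from mult_right_mono[OF this, of "(f \<eta>)\<^sup>2"]
    show "\<gamma> / 12 * (f \<eta>)\<^sup>2 - 48 / \<gamma> * (?m\<^sup>2 * (f \<eta>)\<^sup>2) \<le> (\<gamma> / 6 - 4 * ?m) * (f \<eta>)\<^sup>2"
      by (simp add: left_diff_distrib mult.assoc)
  qed
  finally have "real N * (\<gamma> / 12 * ?V - 48 / \<gamma> * ?P) \<le> ?W / 2"
    using lyapunov_inequality[OF \<gamma> f] mult_left_mono[of _ _ "real N"] by (smt (verit) of_nat_0_le_iff)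
  then have "real N * (\<gamma> / 12) * ?V \<le> 48 / \<gamma> * (real N * ?P) + ?W / 2"
    by (simp add: right_diff_distrib mult_ac)
  also have "\<dots> \<le> 48 / \<gamma> * (27648 * ?W + 576 * real N powr \<gamma> * ?V) + ?W / 2"
    using localised_norm[OF \<gamma>' f mean] \<gamma> by (intro add_right_mono mult_left_mono) simp_all
  also have "\<dots> = (1327104 / \<gamma> + 1 / 2) * ?W + 27648 / \<gamma> * real N powr \<gamma> * ?V"
    using \<gamma> by (simp add: field_simps)
  also have "27648 / \<gamma> * real N powr \<gamma> \<le> real N * (\<gamma> / 24)"
  proof -
    have "663552 / \<gamma>\<^sup>2 * real N powr \<gamma> \<le> real N powr (1 - \<gamma>) * real N powr \<gamma>"
      using N by (rule mult_right_mono) simp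
    also have "\<dots> = real N" using N0 by (simp add: powr_add[symmetric])
    finally have "663552 / \<gamma>\<^sup>2 * real N powr \<gamma> * (\<gamma> / 24) \<le> real N * (\<gamma> / 24)"
      using \<gamma> by (intro mult_right_mono) simp_all
    moreover have "663552 / \<gamma>\<^sup>2 * real N powr \<gamma> * (\<gamma> / 24) = 27648 / \<gamma> * real N powr \<gamma>"
      using \<gamma> by (simp add: power2_eq_square)
    ultimately show ?thesis by simp
  qed
  finally have "real N * (\<gamma> / 12) * ?V \<le> (1327104 / \<gamma> + 1 / 2) * ?W + real N * (\<gamma> / 24) * ?V"
    by (simp add: mult_right_mono)
  moreover have "real N * (\<gamma> / 12) * ?V = 2 * (real N * (\<gamma> / 24) * ?V)" by simp
  ultimately have "real N * (\<gamma> / 24) * ?V \<le> (1327104 / \<gamma> + 1 / 2) * ?W" by linarith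
  also have "\<dots> \<le> (1327104 / \<gamma> + 1 / 2) * (2 * real N * dirichlet_form \<gamma> N f)"
    using total_energy_le_dirichlet(1)[OF \<gamma>'(1) f] \<gamma> by (intro mult_left_mono) simp_all
  finally have "real N * (\<gamma> / 24 * ?V) \<le> real N * ((1327104 / \<gamma> + 1 / 2) * 2 * dirichlet_form \<gamma> N f)"
    by (simp only: mult_ac)
  then have "\<gamma> / 24 * ?V \<le> (1327104 / \<gamma> + 1 / 2) * 2 * dirichlet_form \<gamma> N f" using N0 by simp
  from mult_left_mono[OF this, of "24 / \<gamma>"] show ?thesis using \<gamma> by (simp add: mult_ac)
qed

section \<open>Spectral gap\<close>

lemma L2_space_eq: "f \<in> L2_space N \<longleftrightarrow> square_integrable \<sigma> f"
  by (simp add: L2_space_def square_integrable_def)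

text \<open>The infimum that defines the gap must be over a nonempty set. A multiple of \<open>\<eta> i - \<eta> j\<close> works for a
suitable pair: it becomes \<open>(2 * \<alpha> - 1) * (\<eta> i + \<eta> j)\<close> after an exchange, so its mean is zero and its
second moment is a third of that of \<open>\<eta> i + \<eta> j\<close>.\<close>

lemma normalised_function_exists:
  "\<exists>f. square_integrable \<sigma> f \<and> (LINT \<eta>|\<sigma>. (f \<eta>)\<^sup>2) = 1 \<and> (LINT \<eta>|\<sigma>. f \<eta>) = 0"
proof -
  define d where "d i j \<eta> = \<eta> i - \<eta> j" for i j and \<eta> :: "nat \<Rightarrow> real"
  define s where "s i j \<eta> = \<eta> i + \<eta> j" for i j and \<eta> :: "nat \<Rightarrow> real"
  note [measurable] = measurable_unit_lebesgue
  have b: "bounded_weight (d i j)" "bounded_weight (s i j)" if ij: "distinct_sites i j" for i j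
  proof -
    have "\<bar>d i j \<eta>\<bar> \<le> 2 * real N" "\<bar>s i j \<eta>\<bar> \<le> 2 * real N" if "\<eta> \<in> S" for \<eta>
      using simplex_coordinate[OF that distinct_sitesD(1)[OF ij]] simplex_coordinate[OF that distinct_sitesD(2)[OF ij]]
      by (simp_all add: d_def s_def)
    moreover have "d i j \<in> borel_measurable \<sigma>" "s i j \<in> borel_measurable \<sigma>"
      unfolding d_def[abs_def] s_def[abs_def] by measurable
    ultimately show "bounded_weight (d i j)" "bounded_weight (s i j)" by (auto intro: bounded_weightI)
  qed
  have si: "square_integrable \<sigma> (d i j)" "square_integrable \<sigma> (s i j)" if "distinct_sites i j" for i j
    using b[OF that] by (auto intro: bounded_weight_square_integrable)
  have moved_d: "d i j (exchange i j \<alpha> \<eta>) = (2 * \<alpha> - 1) * s i j \<eta>" if "distinct_sites i j" for i j \<alpha> \<eta>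
    using distinct_sitesD(3)[OF that] by (simp add: d_def s_def exchange_def algebra_simps)
  have u1: "(LINT \<alpha>|unit_lebesgue. 2 * \<alpha> - 1) = 0"
  proof -
    have i: "integrable unit_lebesgue (\<lambda>\<alpha>. \<alpha>)"
      by (rule integrable_unit_bounded[where B=1]) simp_all
    then have "(LINT \<alpha>|unit_lebesgue. 1 - \<alpha>) = 1 - (LINT \<alpha>|unit_lebesgue. \<alpha>)"
      using unit.prob_space by simp
    then have "(LINT \<alpha>|unit_lebesgue. \<alpha>) = 1 / 2" using integral_unit_reflect[of "\<lambda>\<alpha>. \<alpha>"] by simp
    then show ?thesis using i unit.prob_space by simp
  qed
  have u2: "(LINT \<alpha>|unit_lebesgue. (2 * \<alpha> - 1)\<^sup>2) = 1 / 3"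
  proof -
    have "(LINT \<alpha>|unit_lebesgue. (2 * \<alpha> - 1)\<^sup>2) = (LINT \<alpha>|unit_lebesgue. 2 * (\<alpha>\<^sup>2 + (1 - \<alpha>)\<^sup>2) - 1)"
      by (intro Bochner_Integration.integral_cong) (simp_all add: power2_eq_square algebra_simps)
    also have "\<dots> = (LINT \<alpha>|unit_lebesgue. 2 * (\<alpha>\<^sup>2 + (1 - \<alpha>)\<^sup>2)) - (LINT \<alpha>|unit_lebesgue. 1)"
      by (rule Bochner_Integration.integral_diff) (rule integrable_mult_right[OF unit_moments(2)], simp)
    also have "(LINT \<alpha>|unit_lebesgue. 2 * (\<alpha>\<^sup>2 + (1 - \<alpha>)\<^sup>2)) = 2 * (2 / 3)"
      by (simp only: Bochner_Integration.integral_mult_right_zero unit_moments(1))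
    also have "2 * (2 / 3) - (LINT \<alpha>|unit_lebesgue. 1) = (1 / 3 :: real)" using unit.prob_space by simp
    finally show ?thesis .
  qed
  have mean: "(LINT \<eta>|\<sigma>. d i j \<eta>) = 0" if ij: "distinct_sites i j" for i j
  proof -
    have "(LINT \<eta>|\<sigma>. d i j \<eta>) = (LINT p|Q. d i j (moved i j p))"
      by (rule integral_moved[OF ij square_integrable_measurable[OF si(1)[OF ij]], symmetric])
    also have "\<dots> = (LINT \<eta>|\<sigma>. (LINT \<alpha>|unit_lebesgue. d i j (moved i j (\<eta>, \<alpha>))))"
      by (rule Q.integral_fst'[OF integrable_moved[OF ij sigma.square_integrable_integrable[OF si(1)[OF ij]]], symmetric])
    also have "\<dots> = 0" by (simp add: moved_d[OF ij] u1)
    finally show ?thesis .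
  qed
  have norm: "(LINT \<eta>|\<sigma>. (d i j \<eta>)\<^sup>2) = (LINT \<eta>|\<sigma>. (s i j \<eta>)\<^sup>2) / 3" if ij: "distinct_sites i j" for i j
  proof -
    note sq = square_integrable_square[OF si(1)[OF ij]]
    have "(LINT \<eta>|\<sigma>. (d i j \<eta>)\<^sup>2) = (LINT p|Q. (d i j (moved i j p))\<^sup>2)"
      using integral_moved[OF ij borel_measurable_integrable[OF sq]] by simp
    also have "\<dots> = (LINT \<eta>|\<sigma>. (LINT \<alpha>|unit_lebesgue. (d i j (moved i j (\<eta>, \<alpha>)))\<^sup>2))"
      by (rule Q.integral_fst'[OF integrable_moved[OF ij sq], symmetric])
    also have "\<dots> = (LINT \<eta>|\<sigma>. (s i j \<eta>)\<^sup>2) / 3" by (simp add: moved_d[OF ij] power_mult_distrib u2)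
    finally show ?thesis .
  qed
  have "\<exists>q\<in>pairs. (LINT \<eta>|\<sigma>. (d (fst q) (snd q) \<eta>)\<^sup>2) \<noteq> 0"
  proof (rule ccontr)
    assume "\<not> ?thesis"
    then have "(LINT \<eta>|\<sigma>. s (fst q) (snd q) \<eta>) = 0" if "q \<in> pairs" for q
      using sigma.square_of_mean_le[OF si(2)[OF pairs_sites[OF that]]] norm[OF pairs_sites[OF that]] that by auto
    then have "0 = (\<Sum>q\<in>pairs. (LINT \<eta>|\<sigma>. s (fst q) (snd q) \<eta>))" by simp
    also have "\<dots> = (LINT \<eta>|\<sigma>. (\<Sum>q\<in>pairs. s (fst q) (snd q) \<eta>))"
      by (rule Bochner_Integration.integral_sum[symmetric])
         (rule sigma.square_integrable_integrable[OF si(2)[OF pairs_sites]])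
    also have "\<dots> = (LINT \<eta>|\<sigma>. 2 * real N * (real N - 1))"
      by (rule Bochner_Integration.integral_cong[OF refl]) (simp add: s_def sum_pairs_coordinates)
    also have "\<dots> = 2 * real N * (real N - 1)" using sigma.prob_space by simp
    finally show False using N_ge_2 by simp
  qed
  then obtain q where q: "q \<in> pairs" "(LINT \<eta>|\<sigma>. (d (fst q) (snd q) \<eta>)\<^sup>2) \<noteq> 0" by blast
  let ?d = "d (fst q) (snd q)" let ?v = "LINT \<eta>|\<sigma>. (?d \<eta>)\<^sup>2"
  have v: "0 < ?v" using q(2) by (simp add: less_le)
  let ?f = "\<lambda>\<eta>. 1 / sqrt ?v * ?d \<eta>"
  have "square_integrable \<sigma> ?f" by (rule square_integrable_scale[OF si(1)[OF pairs_sites[OF q(1)]]])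
  moreover have "(LINT \<eta>|\<sigma>. (?f \<eta>)\<^sup>2) = 1"
    using v by (simp only: power_mult_distrib Bochner_Integration.integral_mult_right_zero) (simp add: power_divide)
  moreover have "(LINT \<eta>|\<sigma>. ?f \<eta>) = 0"
    by (simp only: Bochner_Integration.integral_mult_right_zero mean[OF pairs_sites[OF q(1)]] mult_zero_right)
  ultimately show ?thesis by blast
qed

lemma spectral_gap_ge:
  assumes "\<And>f. square_integrable \<sigma> f \<Longrightarrow> (LINT \<eta>|\<sigma>. f \<eta>) = 0 \<Longrightarrow>
      C * (LINT \<eta>|\<sigma>. (f \<eta>)\<^sup>2) \<le> dirichlet_form \<gamma> N f"
  shows "C \<le> spectral_gap \<gamma> N"
  unfolding spectral_gap_def
proof (rule cInf_greatest)
  have norm: "L2_norm N f = 1 \<longleftrightarrow> (LINT \<eta>|\<sigma>. (f \<eta>)\<^sup>2) = 1" for f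
    by (simp add: L2_norm_def L2_inner_def power2_eq_square)
  show "{dirichlet_form \<gamma> N f |f. f \<in> L2_space N \<and> L2_norm N f = 1 \<and> L2_inner N f (\<lambda>_. 1) = 0} \<noteq> {}"
    using normalised_function_exists by (auto simp: norm L2_space_eq L2_inner_def)
  fix x assume "x \<in> {dirichlet_form \<gamma> N f |f. f \<in> L2_space N \<and> L2_norm N f = 1 \<and> L2_inner N f (\<lambda>_. 1) = 0}"
  then obtain f where x: "x = dirichlet_form \<gamma> N f" and f: "square_integrable \<sigma> f"
      "(LINT \<eta>|\<sigma>. (f \<eta>)\<^sup>2) = 1" "(LINT \<eta>|\<sigma>. f \<eta>) = 0"
    by (auto simp: norm L2_space_eq L2_inner_def)
  show "C \<le> x" using assms[OF f(1,3)] by (simp add: x f(2))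
qed

end

theorem theorem1p3:
  fixes \<gamma> :: real
  assumes "\<gamma> \<in> {0..1}"
  shows "\<exists>C>0. \<forall>N\<ge>2. spectral_gap \<gamma> N \<ge> C"
proof -
  consider "\<gamma> = 0" | "\<gamma> = 1" | "0 < \<gamma>" "\<gamma> < 1" using assms by fastforce
  then show ?thesis
  proof cases
    case 1
    have "1 / 24 \<le> spectral_gap \<gamma> N" if "2 \<le> N" for N
    proof -
      interpret exchange_model N by unfold_locales (rule that)
      show ?thesis
      proof (rule spectral_gap_ge)
        fix f assume f: "square_integrable (sigma_unif N) f" "(LINT \<eta>|sigma_unif N. f \<eta>) = 0"
        show "1 / 24 * (LINT \<eta>|sigma_unif N. (f \<eta>)\<^sup>2) \<le> dirichlet_form \<gamma> N f"
          unfolding 1 using poincare_rate_zero[OF f] by linarith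
      qed
    qed
    then show ?thesis by (intro exI[of _ "1 / 24"]) auto
  next
    case 2
    have "1 / 13824 \<le> spectral_gap \<gamma> N" if "2 \<le> N" for N
    proof -
      interpret exchange_model N by unfold_locales (rule that)
      show ?thesis
      proof (rule spectral_gap_ge)
        fix f assume f: "square_integrable (sigma_unif N) f" "(LINT \<eta>|sigma_unif N. f \<eta>) = 0"
        have "real N powr (1 - 1) = 1" using that by simp
        then show "1 / 13824 * (LINT \<eta>|sigma_unif N. (f \<eta>)\<^sup>2) \<le> dirichlet_form \<gamma> N f"
          unfolding 2 using poincare_crude[OF _ _ f, of 1] by simp
      qed
    qed
    then show ?thesis by (intro exI[of _ "1 / 13824"]) auto
  next
    case 3
    define K where "K = 48 / \<gamma> * (1327104 / \<gamma> + 1 / 2)"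
    define R where "R = 663552 / \<gamma>\<^sup>2"
    let ?C = "min (1 / K) (1 / (13824 * R))"
    have K: "0 < K" unfolding K_def using 3 by (intro mult_pos_pos add_pos_pos) simp_all
    have R: "0 < R" unfolding R_def using 3 by simp
    have "?C \<le> spectral_gap \<gamma> N" if N: "2 \<le> N" for N
    proof -
      interpret exchange_model N by unfold_locales (rule N)
      show ?thesis
      proof (rule spectral_gap_ge)
        fix f assume f: "square_integrable (sigma_unif N) f" "(LINT \<eta>|sigma_unif N. f \<eta>) = 0"
        let ?V = "LINT \<eta>|sigma_unif N. (f \<eta>)\<^sup>2" and ?E = "dirichlet_form \<gamma> N f"
        have V: "0 \<le> ?V" by simp
        show "?C * ?V \<le> ?E"
        \<comment> \<open>Many particles, or a number of particles bounded in terms of \<open>\<gamma>\<close>.\<close>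
        proof (cases "R \<le> real N powr (1 - \<gamma>)")
          case True
          have "?V \<le> K * ?E" unfolding K_def by (rule poincare_many_particles[OF 3 f True[unfolded R_def]])
          then have "1 / K * ?V \<le> ?E" using K by (simp add: pos_divide_le_eq mult.commute)
          moreover have "?C * ?V \<le> 1 / K * ?V" using V by (intro mult_right_mono) simp_all
          ultimately show ?thesis by linarith
        next
          case False
          have N0: "0 < real N" using N by simp
          have "1 / R \<le> 1 / real N powr (1 - \<gamma>)"
            using False N0 R by (intro divide_left_mono mult_pos_pos) simp_all
          also have "\<dots> = real N powr (\<gamma> - 1)"
            using powr_minus_divide[of "real N" "1 - \<gamma>"] by simp
          finally have "1 / R * ?V \<le> real N powr (\<gamma> - 1) * ?V" using V by (rule mult_right_mono)
          also have "\<dots> \<le> 13824 * ?E" using 3 f by (intro poincare_crude) simp_all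
          finally have "1 / (13824 * R) * ?V \<le> ?E" by simp
          moreover have "?C * ?V \<le> 1 / (13824 * R) * ?V" using V by (intro mult_right_mono) simp_all
          ultimately show ?thesis by linarith
        qed
      qed
    qed
    moreover have "0 < ?C" using K R by simp
    ultimately show ?thesis by (intro exI[of _ ?C]) simp
  qed
qed

end
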